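(* For every $q_0,q_1\in\mathcal Q_1^{\mathscr S}$ and $\lambda\in[0,1]$, we have $$\psi((1-\lambda)q_0+\lambda q_1)\le(1-\lambda)\psi(q_0)+\lambda\psi(q_1).$$
   Context: $\mathscr S$ is a finite set and $\lambda_\infty=(\lambda_{\infty,s})_{s\in\mathscr S}\in(0,1)^{\mathscr S}$ with $\sum_s\lambda_{\infty,s}=1$. $\mathcal Q$ is the set of right-continuous nondecreasing paths $q:[0,1)\to\mathbb R_+$, and $\mathcal Q_1=\mathcal Q\cap L^1[0,1)$. For $q=(q_s)_{s\in\mathscr S}\in\mathcal Q_1^{\mathscr S}$, $\psi(q)=\sum_{s\in\mathscr S}\lambda_{\infty,s}\psi_\circ(q_s)$. The function $\psi_\circ:\mathcal Q_1\to\mathbb R$ is defined as follows. Let $(B_t)_{t\ge0}$ be a standard Brownian motion. For $m,t\ge0$, let $T_{m,t}f(x)=\frac1m\log\mathbb E\,e^{mf(x+B_{2t})}$ if $m>0$, and $T_{0,t}f(x)=\mathbb Ef(x+B_{2t})$. For a path $q=\sum_{i=0}^kq_i\mathbf 1_{[m_i,m_{i+1})}$ taking finitely many values, with $0=m_0<m_1<\dots<m_k<m_{k+1}=1$ and $0=q_{-1}\le q_0\le q_1\le\dots\le q_k$, set $f_{k+1}(x)=\log\cosh x$, recursively $f_i=T_{m_i,\,q_i-q_{i-1}}f_{i+1}$ for $i=k,k-1,\dots,0$, and $\psi_\circ(q)=q_k-f_0(0)$. The value does not depend on the chosen representation of $q$. On paths with finitely many values, $|\psi_\circ(q)-\psi_\circ(q')|\le|q-q'|_{L^1}$,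 and $\psi_\circ$ is extended to $\mathcal Q_1$ by continuity. *)

theory Defs
  imports "HOL-Probability.Probability"
begin

text \<open>A path is a total function on the reals of which only the values on \<open>{0..<1}\<close> matter.\<close>

definition paths :: "(real \<Rightarrow> real) set" where
  "paths = {q. (\<forall>u\<in>{0..<1}. 0 \<le> q u) \<and> mono_on {0..<1} q
               \<and> (\<forall>u\<in>{0..<1}. (q \<longlongrightarrow> q u) (at_right u))}"

definition L1_paths :: "(real \<Rightarrow> real) set" where
  "L1_paths = paths \<inter> {q. set_integrable lborel {0..<1} q}"

definition L1_dist :: "(real \<Rightarrow> real) \<Rightarrow> (real \<Rightarrow> real) \<Rightarrow> real" where
  "L1_dist p q = (LINT u:{0..<1}|lborel. \<bar>p u - q u\<bar>)"

text \<open>The law of \<open>B\<^sub>t\<close> for a standard Brownian motion \<open>B\<close>. Only these one-dimensional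
  marginals enter the recursion. The case \<open>t = 0\<close> is separate because
  \<open>normal_density\<close> degenerates to \<open>0\<close> there.\<close>

definition brownian_law :: "real \<Rightarrow> real measure" where
  "brownian_law t =
     (if t = 0 then return borel 0 else density lborel (\<lambda>x. ennreal (normal_density 0 (sqrt t) x)))"

definition T_op :: "real \<Rightarrow> real \<Rightarrow> (real \<Rightarrow> real) \<Rightarrow> real \<Rightarrow> real" where
  "T_op m t f x =
     (if m = 0 then (LINT b|brownian_law (2 * t). f (x + b))
      else (1 / m) * ln (LINT b|brownian_law (2 * t). exp (m * f (x + b))))"

text \<open>\<open>parisi_rec k m v i\<close> is the function \<open>f\<^sub>i\<close>; the terminal value
  \<open>f\<^bsub>k+1\<^esub>\<close> is used for every index beyond \<open>k\<close>, and \<open>v\<^bsub>-1\<^esub> = 0\<close>.\<close>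

function parisi_rec ::
    "nat \<Rightarrow> (nat \<Rightarrow> real) \<Rightarrow> (nat \<Rightarrow> real) \<Rightarrow> nat \<Rightarrow> real \<Rightarrow> real" where
  "parisi_rec k m v i =
     (if i \<le> k
      then T_op (m i) (v i - (if i = 0 then 0 else v (i - 1))) (parisi_rec k m v (Suc i))
      else (\<lambda>x. ln (cosh x)))"
  by auto
termination
  by (relation "Wellfounded.measure (\<lambda>(k, m, v, i). Suc k - i)") auto

declare parisi_rec.simps [simp del]

definition step_repr ::
    "(real \<Rightarrow> real) \<Rightarrow> nat \<Rightarrow> (nat \<Rightarrow> real) \<Rightarrow> (nat \<Rightarrow> real) \<Rightarrow> bool" where
  "step_repr q k m v \<longleftrightarrow>
     m 0 = 0 \<and> m (Suc k) = 1 \<and> (\<forall>i\<le>k. m i < m (Suc i)) \<and>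
     0 \<le> v 0 \<and> (\<forall>i<k. v i \<le> v (Suc i)) \<and>
     (\<forall>u\<in>{0..<1}. q u = (\<Sum>i\<le>k. v i * indicator {m i..<m (Suc i)} u))"

definition step_paths :: "(real \<Rightarrow> real) set" where
  "step_paths = {q. \<exists>k m v. step_repr q k m v}"

text \<open>The value does not depend on the representation, so the description is proper on
  \<open>step_paths\<close>.\<close>

definition psi_step :: "(real \<Rightarrow> real) \<Rightarrow> real" where
  "psi_step q = (THE L. \<exists>k m v. step_repr q k m v \<and> L = v k - parisi_rec k m v 0 0)"

text \<open>Extension by \<open>L\<^sup>1\<close>-continuity: the limit of \<open>psi_step p\<close> as the step path \<open>p\<close>
  tends to \<open>q\<close> in \<open>L\<^sup>1\<close>. The point \<open>q\<close> itself is not excluded from the filter.\<close>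

definition psi_circ :: "(real \<Rightarrow> real) \<Rightarrow> real" where
  "psi_circ q =
     Lim (inf (filtercomap (\<lambda>p. L1_dist p q) (nhds 0)) (principal step_paths)) psi_step"

definition psi :: "'s set \<Rightarrow> ('s \<Rightarrow> real) \<Rightarrow> ('s \<Rightarrow> real \<Rightarrow> real) \<Rightarrow> real" where
  "psi S lam q = (\<Sum>s\<in>S. lam s * psi_circ (q s))"

end

theory Submission
  imports Defs
begin

text \<open>
  For a step path \<open>q\<close> with values \<open>q\<^sub>0 \<le> \<dots> \<le> q\<^sub>k\<close> the functional is \<open>q\<^sub>k - f\<^sub>0(0)\<close>, so convexity
  says that \<open>f\<^sub>0(0)\<close> is concave in the values when the breakpoints are fixed. Move the values along
  a segment with parameter \<open>t\<close>. Then every \<open>f\<^sub>i\<close> is a function \<open>V(x, t)\<close>, and one step of the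
  recursion replaces \<open>V\<close> by \<open>(1/m) log P exp(m V)\<close>, where \<open>P\<close> is the heat semigroup at a time
  that is affine in \<open>t\<close>. Pointwise concavity in \<open>t\<close> does not survive such a step. What survives is an
  integrated form of it: for all \<open>x \<ge> 0\<close> and all real \<open>\<beta>\<close>,
  the integral over \<open>[0, x]\<close> of \<open>exp(2 m V)\<close> times a second derivative of \<open>V\<close> is nonpositive. This
  derivative is taken while \<open>t\<close> moves with speed \<open>1\<close> and the time of the flow of \<open>T\<^sub>m\<close>, applied to
  \<open>V\<close>, moves with speed \<open>\<beta>\<close>. After integration of
  total derivatives this reads
    \<open>\<integral>\<^sub>0\<^sup>x exp(2 m V) V\<^sub>t\<^sub>t + exp(2 m V(x)) (2 \<beta> V\<^sub>t\<^sub>x + \<beta>\<^sup>2 (V\<^sub>x\<^sub>x + m V\<^sub>x\<^sup>2)\<^sub>x) \<le> 0\<close>,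
  the predicate \<open>tilt_concave\<close>.

  \<^item> For \<open>V = log cosh\<close> and \<open>m = 1\<close> it is trivial, because \<open>V\<^sub>x\<^sub>x + V\<^sub>x\<^sup>2 = 1\<close>.
  \<^item> It passes from \<open>m\<close> to smaller \<open>m\<close>, because \<open>V\<close> is even and convex in \<open>x\<close> (\<open>tilt_concave_mono\<close>).
  \<^item> It is preserved by the step with the same \<open>m\<close> (\<open>hopf_cole_step\<close>). With \<open>\<phi> = exp(m V)\<close> the step is
    the heat flow, and the condition says that \<open>\<phi> D\<^sup>2\<phi> - (D\<phi>)\<^sup>2\<close> has nonpositive integral over \<open>[0, x]\<close>
    for every operator \<open>D = \<partial>\<^sub>t + \<beta> \<partial>\<^sub>x\<^sup>2\<close>. The core of the whole proof is \<open>gaussian_kernel_inequality\<close>: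
    these conditions are stable under Gaussian averaging.
  \<^item> At \<open>m = 0\<close> and \<open>x = 0\<close>, Gaussian integration by parts turns it into true concavity
    (\<open>gaussian_average_concave\<close>).

  The same induction controls the first derivative in \<open>t\<close> (\<open>slope_bound\<close>) and yields the bound
  \<open>|\<psi>(q) - \<psi>(q')| \<le> |q - q'|\<close> in \<open>L\<^sup>1\<close>. This bound, together with the density of step paths, makes the
  extension by continuity an honest limit, through which convexity passes. Independence of the
  representation of a step path comes from the fact that an additional breakpoint, at which the value is
  repeated, contributes a step of heat time \<open>0\<close>, which is the identity.
\<close>


section \<open>The standard Gaussian measure\<close>

definition gauss :: "real measure" where
  "gauss = density lborel (\<lambda>x. ennreal (std_normal_density x))"

lemma sets_gauss [measurable_cong, simp]: "sets gauss = sets borel"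
  and space_gauss [simp]: "space gauss = UNIV"
  by (auto simp: gauss_def)

interpretation gauss: prob_space gauss
  unfolding gauss_def by (rule prob_space_normal_density) simp

lemma integral_gauss:
  fixes f :: "real \<Rightarrow> real"
  assumes "f \<in> borel_measurable borel"
  shows "(\<integral>z. f z \<partial>gauss) = (\<integral>z. std_normal_density z * f z \<partial>lborel)"
  unfolding gauss_def using assms by (subst integral_density) auto

lemma integrable_gauss_iff:
  fixes f :: "real \<Rightarrow> real"
  assumes "f \<in> borel_measurable borel"
  shows "integrable gauss f \<longleftrightarrow> integrable lborel (\<lambda>z. std_normal_density z * f z)"
  unfolding gauss_def using assms by (subst integrable_density) auto

text \<open>Tilting by \<open>exp (l z)\<close> turns the standard normal density into a multiple of a shifted one, so both
  one-sided exponentials are integrable.\<close>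
lemma integrable_gauss_exp_abs: "integrable gauss (\<lambda>z. exp (k * \<bar>z\<bar>))"
proof -
  have tilt: "std_normal_density z * exp (l * z) = exp (l\<^sup>2 / 2) * normal_density l 1 z" for l z :: real
  proof -
    have "- (z\<^sup>2) / 2 + l * z = l\<^sup>2 / 2 - (z - l)\<^sup>2 / 2"
      by (simp add: power2_eq_square field_simps)
    then show ?thesis
      by (simp add: normal_density_def flip: exp_add)
  qed
  have lin: "integrable gauss (\<lambda>z. exp (l * z))" for l :: real
    by (subst integrable_gauss_iff) (simp_all add: tilt)
  show ?thesis
  proof (rule Bochner_Integration.integrable_bound)
    show "integrable gauss (\<lambda>z. exp (k * z) + exp (- k * z))"
      using lin by (intro Bochner_Integration.integrable_add)
    have "exp (k * \<bar>z\<bar>) \<le> exp (k * z) + exp (- k * z)" for z :: real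
      by (cases "z \<ge> 0") auto
    then show "AE z in gauss. norm (exp (k * \<bar>z\<bar>)) \<le> norm (exp (k * z) + exp (- k * z))"
      by (intro AE_I2) (force intro: order_trans[OF _ abs_ge_self])
  qed simp
qed

lemma integrable_gauss_bound:
  fixes f :: "real \<Rightarrow> real"
  assumes "f \<in> borel_measurable borel" and "\<And>z. \<bar>f z\<bar> \<le> K * exp (k * \<bar>z\<bar>)"
  shows "integrable gauss f"
proof (rule Bochner_Integration.integrable_bound)
  show "integrable gauss (\<lambda>z. K * exp (k * \<bar>z\<bar>))"
    using integrable_gauss_exp_abs by simp
  show "AE z in gauss. norm (f z) \<le> norm (K * exp (k * \<bar>z\<bar>))"
    using assms(2) by (intro AE_I2) (force intro: order_trans[OF _ abs_ge_self])
qed (use assms in simp)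

lemma gauss_reflect:
  fixes f :: "real \<Rightarrow> real"
  assumes [measurable]: "f \<in> borel_measurable borel"
  shows "(\<integral>z. f (- z) \<partial>gauss) = (\<integral>z. f z \<partial>gauss)"
proof -
  have "(\<integral>z. std_normal_density z * f z \<partial>lborel)
      = (\<integral>z. std_normal_density (- z) * f (- z) \<partial>lborel)"
    using lborel_integral_real_affine[of "-1" "\<lambda>z. std_normal_density z * f z" 0] by simp
  then show ?thesis
    by (subst (1 2) integral_gauss) (auto simp: std_normal_density_def)
qed

text \<open>The Gaussian density \<open>n\<close> satisfies \<open>n' = - z n\<close>, so the difference of the two integrands is the
  derivative of \<open>n g\<close>. This function vanishes at both infinities, because the Gaussian beats every
  exponential.\<close>
lemma gaussian_integration_by_parts:
  fixes g g' :: "real \<Rightarrow> real"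
  assumes der: "\<And>z. (g has_real_derivative g' z) (at z)"
    and cont: "continuous_on UNIV g'"
    and bg: "\<And>z. \<bar>g z\<bar> \<le> K * exp (k * \<bar>z\<bar>)"
    and bg': "\<And>z. \<bar>g' z\<bar> \<le> K * exp (k * \<bar>z\<bar>)"
  shows "(\<integral>z. g z * z \<partial>gauss) = (\<integral>z. g' z \<partial>gauss)"
proof -
  have cg: "continuous_on UNIV g"
    using der by (meson DERIV_isCont continuous_at_imp_continuous_on)
  have [measurable]: "g \<in> borel_measurable borel" "g' \<in> borel_measurable borel"
    using cg cont by (auto intro: borel_measurable_continuous_onI)
  have K: "0 \<le> K"
    using order_trans[OF abs_ge_zero bg[of 0]] by simp
  have zb: "\<bar>z\<bar> \<le> exp \<bar>z\<bar>" for z :: real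
    using exp_ge_add_one_self[of "\<bar>z\<bar>"] by linarith
  have bz: "\<bar>g z * z\<bar> \<le> K * exp ((k + 1) * \<bar>z\<bar>)" for z
  proof -
    have "\<bar>g z * z\<bar> \<le> (K * exp (k * \<bar>z\<bar>)) * exp \<bar>z\<bar>"
      unfolding abs_mult using bg[of z] zb[of z] K by (intro mult_mono) auto
    then show ?thesis by (simp add: distrib_right exp_add mult.assoc)
  qed
  have i1: "integrable gauss (\<lambda>z. g z * z)" by (rule integrable_gauss_bound[OF _ bz]) simp
  have i2: "integrable gauss g'" by (rule integrable_gauss_bound[OF _ bg']) simp
  let ?n = std_normal_density
  have dn: "(?n has_real_derivative - z * ?n z) (at z)" for z
    unfolding std_normal_density_def by (auto intro!: derivative_eq_intros simp: field_simps)
  define F where "F z = ?n z * g z" for z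
  define f where "f z = ?n z * g' z - ?n z * (g z * z)" for z
  have dF: "(F has_real_derivative f z) (at z)" for z
    unfolding F_def f_def by (rule derivative_eq_intros dn der)+ (simp add: algebra_simps)
  have intf: "integrable lborel f"
    unfolding f_def using i1 i2 by (simp add: integrable_gauss_iff)
  have contf: "isCont f z" for z
  proof -
    have "continuous_on UNIV f"
      unfolding f_def std_normal_density_def by (intro continuous_intros cg cont) auto
    then show ?thesis by (simp add: continuous_on_eq_continuous_at)
  qed
  have lim: "((\<lambda>z. K * (1 / sqrt (2 * pi)) * (exp (k * z) * exp (- z\<^sup>2 / 2))) \<longlongrightarrow> 0) at_top"
  proof -
    have "((\<lambda>z::real. K * (1 / sqrt (2 * pi)) * (exp (k\<^sup>2 / 2) * exp (- (z - k)\<^sup>2 / 2))) \<longlongrightarrow> 0) at_top"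
    proof -
      have "filterlim (\<lambda>z::real. (z - k)\<^sup>2 / 2) at_top at_top"
      proof -
        have "filterlim (\<lambda>z::real. z - k) at_top at_top"
          by (rule filterlim_tendsto_add_at_top[of "\<lambda>_. - k" "- k", simplified]) (auto simp: filterlim_ident add.commute)
        then have "filterlim (\<lambda>z::real. (z - k)^2) at_top at_top"
          by (rule filterlim_pow_at_top[rotated]) simp
        then show ?thesis
          using filterlim_tendsto_pos_mult_at_top[of "\<lambda>_. 1/2" "1/2::real" at_top "\<lambda>z. (z - k)^2"] by (simp add: mult.commute)
      qed
      then have "((\<lambda>z::real. exp (- ((z - k)\<^sup>2 / 2))) \<longlongrightarrow> 0) at_top"
        by (rule filterlim_compose[OF exp_at_bot filterlim_compose[OF filterlim_uminus_at_bot_at_top]])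
      from tendsto_mult_left[OF tendsto_mult_left[OF this, of "exp (k\<^sup>2/2)"], of "K * (1 / sqrt (2 * pi))"]
      show ?thesis by simp
    qed
    moreover have "exp (k\<^sup>2 / 2) * exp (- (z - k)\<^sup>2 / 2) = exp (k * z) * exp (- z\<^sup>2 / 2)" for z :: real
      by (simp add: power2_eq_square field_simps flip: exp_add)
    ultimately show ?thesis by simp
  qed
  have bF: "\<bar>F z\<bar> \<le> K * (1 / sqrt (2 * pi)) * (exp (k * \<bar>z\<bar>) * exp (- \<bar>z\<bar>\<^sup>2 / 2))" for z
  proof -
    have "\<bar>F z\<bar> \<le> ?n z * (K * exp (k * \<bar>z\<bar>))"
      unfolding F_def abs_mult by (intro mult_mono bg) auto
    then show ?thesis by (simp add: std_normal_density_def mult_ac)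
  qed
  have top: "(F \<longlongrightarrow> 0) at_top"
    using bF by (intro Lim_null_comparison[OF _ lim] eventually_at_top_linorderI[of 0])
      (metis abs_of_nonneg real_norm_def)
  have "((\<lambda>z. F (- z)) \<longlongrightarrow> 0) at_top"
    using bF by (intro Lim_null_comparison[OF _ lim] eventually_at_top_linorderI[of 0])
      (metis abs_of_nonneg abs_minus_cancel real_norm_def)
  then have bot: "(F \<longlongrightarrow> 0) at_bot"
    by (simp add: filterlim_at_bot_mirror)
  have "(LBINT z=-\<infinity>..\<infinity>. f z) = 0 - 0"
  proof (rule interval_integral_FTC_integrable)
    show "(F has_vector_derivative f z) (at z)" for z
      using dF by (simp add: has_real_derivative_iff_has_vector_derivative)
    show "((F \<circ> real_of_ereal) \<longlongrightarrow> 0) (at_right (-\<infinity>))"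
      unfolding ereal_tendsto_simps1 using bot by simp
    show "((F \<circ> real_of_ereal) \<longlongrightarrow> 0) (at_left \<infinity>)"
      unfolding ereal_tendsto_simps1 using top by simp
    show "set_integrable lborel (einterval (-\<infinity>) \<infinity>) f"
      using intf by (simp add: set_integrable_def)
  qed (use contf in auto)
  then have "(\<integral>z. f z \<partial>lborel) = 0"
    by (simp add: interval_lebesgue_integral_def set_lebesgue_integral_def)
  moreover have "(\<integral>z. f z \<partial>lborel) = (\<integral>z. g' z \<partial>gauss) - (\<integral>z. g z * z \<partial>gauss)"
    unfolding f_def using i1 i2
    by (subst Bochner_Integration.integral_diff) (simp_all add: integrable_gauss_iff integral_gauss)
  ultimately show ?thesis by simp
qed


text \<open>Rotation invariance of the planar Gaussian measure, by an angle of 45 degrees. The rotation is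
  carried out as two one-dimensional affine substitutions, with an exchange of the integrals in between;
  hence only Fubini's theorem is needed and no change of variables in the plane.\<close>
lemma gauss_rotation:
  fixes f :: "real \<Rightarrow> real \<Rightarrow> real"
  assumes cont: "continuous_on UNIV (\<lambda>p. f (fst p) (snd p))"
    and bnd: "\<And>x y. \<bar>f x y\<bar> \<le> K * exp (k * (\<bar>x\<bar> + \<bar>y\<bar>))"
  shows "(\<integral>x. (\<integral>y. f x y \<partial>gauss) \<partial>gauss)
       = (\<integral>x. (\<integral>y. f ((x + y) / sqrt 2) ((x - y) / sqrt 2) \<partial>gauss) \<partial>gauss)"
proof -
  let ?n = std_normal_density and ?s = "sqrt 2"
  have K: "0 \<le> K"
    using order_trans[OF abs_ge_zero bnd[of 0 0]] by simp
  have meas: "(\<lambda>p. f (fst p) (snd p)) \<in> borel_measurable borel"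
    using cont by (rule borel_measurable_continuous_onI)
  have fm: "(\<lambda>q. f (a q) (b q)) \<in> borel_measurable M"
    if "a \<in> borel_measurable M" "b \<in> borel_measurable M" for a b :: "'b \<Rightarrow> real" and M
    using measurable_compose[OF borel_measurable_Pair[OF that] meas] by simp
  define E where "E = (\<integral>y. exp (k * \<bar>y\<bar>) \<partial>gauss)"
  \<comment> \<open>The integrand after the first substitution \<open>y = \<surd>2 q - z\<close>, where \<open>q = (z + y) / \<surd>2\<close>.\<close>
  define F where "F z q = ?s * (?n z * (?n (?s * q - z) * f z (?s * q - z)))" for z q
  have Fm: "(\<lambda>(z, q). F z q) \<in> borel_measurable (lborel \<Otimes>\<^sub>M lborel)"
    unfolding F_def split_beta by (intro borel_measurable_times fm; measurable)
  have aff: "(\<integral>q. ?s * h (?s * q - z) \<partial>lborel) = (\<integral>y. h y \<partial>lborel)" for h :: "real \<Rightarrow> real" and z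
    using lborel_integral_real_affine[of "?s" h "-z"] by (simp add: mult.commute)
  have affi: "integrable lborel (\<lambda>q. h (?s * q - z)) \<longleftrightarrow> integrable lborel h" for h :: "real \<Rightarrow> real" and z
    using lborel_integrable_real_affine_iff[of "?s" h "-z"] by (simp add: mult.commute)
  have ify: "integrable gauss (f z)" for z
  proof (rule integrable_gauss_bound)
    show "\<bar>f z y\<bar> \<le> (K * exp (k * \<bar>z\<bar>)) * exp (k * \<bar>y\<bar>)" for y
      using bnd[of z y] by (simp add: distrib_left exp_add mult_ac)
  qed (rule fm; simp)
  have Fi: "integrable (lborel \<Otimes>\<^sub>M lborel) (\<lambda>(z, q). F z q)"
  proof (rule lborel_pair.Fubini_integrable[OF Fm])
    have iF: "integrable lborel (F z)" for z
    proof -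
      have "integrable lborel (\<lambda>y. ?n y * f z y)"
        using ify[of z] by (simp add: integrable_gauss_iff fm)
      then show ?thesis
        unfolding F_def using affi[of "\<lambda>y. ?n y * f z y" z] by simp
    qed
    then show "AE z in lborel. integrable lborel (\<lambda>q. case (z, q) of (z, q) \<Rightarrow> F z q)" by simp
    show "integrable lborel (\<lambda>z. \<integral>q. norm (case (z, q) of (z, q) \<Rightarrow> F z q) \<partial>lborel)"
    proof (rule Bochner_Integration.integrable_bound)
      show "integrable lborel (\<lambda>z. K * E * (?n z * exp (k * \<bar>z\<bar>)))"
        using integrable_gauss_exp_abs[of k] by (simp add: integrable_gauss_iff)
      have "(\<integral>q. \<bar>F z q\<bar> \<partial>lborel) \<le> K * E * (?n z * exp (k * \<bar>z\<bar>))" for z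
      proof -
        have "(\<integral>q. \<bar>F z q\<bar> \<partial>lborel) = (\<integral>q. ?s * (?n z * (?n (?s * q - z) * \<bar>f z (?s * q - z)\<bar>)) \<partial>lborel)"
          by (simp add: F_def abs_mult)
        also have "\<dots> = (\<integral>y. ?n z * (?n y * \<bar>f z y\<bar>) \<partial>lborel)"
          by (rule aff)
        also have "\<dots> = ?n z * (\<integral>y. \<bar>f z y\<bar> \<partial>gauss)"
          by (subst integral_gauss) (auto intro!: borel_measurable_abs fm)
        finally have 1: "(\<integral>q. \<bar>F z q\<bar> \<partial>lborel) = ?n z * (\<integral>y. \<bar>f z y\<bar> \<partial>gauss)" .
        have "(\<integral>y. \<bar>f z y\<bar> \<partial>gauss) \<le> (\<integral>y. K * exp (k * \<bar>z\<bar>) * exp (k * \<bar>y\<bar>) \<partial>gauss)"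
          using bnd[of z] ify integrable_gauss_exp_abs[of k]
          by (intro integral_mono) (auto simp: distrib_left exp_add mult_ac)
        also have "\<dots> = K * exp (k * \<bar>z\<bar>) * E"
          by (simp add: E_def)
        finally have "?n z * (\<integral>y. \<bar>f z y\<bar> \<partial>gauss) \<le> ?n z * (K * exp (k * \<bar>z\<bar>) * E)"
          by (rule mult_left_mono) simp
        then show ?thesis unfolding 1 by (simp add: mult_ac)
      qed
      then show "AE z in lborel. norm (\<integral>q. norm (case (z, q) of (z, q) \<Rightarrow> F z q) \<partial>lborel)
          \<le> norm (K * E * (?n z * exp (k * \<bar>z\<bar>)))"
        by (intro AE_I2) (force intro: order_trans[OF _ abs_ge_self])
      show "(\<lambda>z. \<integral>q. norm (case (z, q) of (z, q) \<Rightarrow> F z q) \<partial>lborel) \<in> borel_measurable lborel"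
        using Fm by measurable
    qed
  qed
  have inner: "(\<integral>y. f x y \<partial>gauss) = (\<integral>y. ?n y * f x y \<partial>lborel)" for x
    by (rule integral_gauss) (rule fm; simp)
  have "(\<integral>x. (\<integral>y. f x y \<partial>gauss) \<partial>gauss) = (\<integral>x. ?n x * (\<integral>y. f x y \<partial>gauss) \<partial>lborel)"
  proof (rule integral_gauss)
    have "(\<lambda>(x, y). f x y) \<in> borel_measurable (borel \<Otimes>\<^sub>M gauss)"
      unfolding split_beta by (rule fm; measurable)
    then show "(\<lambda>x. \<integral>y. f x y \<partial>gauss) \<in> borel_measurable borel"
      by measurable
  qed
  also have "\<dots> = (\<integral>z. (\<integral>q. F z q \<partial>lborel) \<partial>lborel)"
    unfolding F_def inner
    by (intro Bochner_Integration.integral_cong refl)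
      (subst aff[of "\<lambda>y. ?n _ * (?n y * f _ y)"], simp)
  also have "\<dots> = (\<integral>q. (\<integral>z. F z q \<partial>lborel) \<partial>lborel)"
    using lborel_pair.Fubini_integral[OF Fi] by simp
  also have "\<dots> = (\<integral>q. ?n q * (\<integral>p. f ((q + p) / ?s) ((q - p) / ?s) \<partial>gauss) \<partial>lborel)"
  proof (rule Bochner_Integration.integral_cong)
    fix q :: real
    have "(\<integral>z. F z q \<partial>lborel) = (\<integral>p. F (q / ?s + 1 / ?s * p) q / ?s \<partial>lborel)"
      using lborel_integral_real_affine[of "1 / ?s" "\<lambda>z. F z q" "q / ?s"] by simp
    also have "\<dots> = (\<integral>p. ?n q * (?n p * f ((q + p) / ?s) ((q - p) / ?s)) \<partial>lborel)"
    proof (rule Bochner_Integration.integral_cong)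
      fix p :: real
      have 1: "q / ?s + 1 / ?s * p = (q + p) / ?s" by (simp add: add_divide_distrib)
      have 2: "?s * q - (q + p) / ?s = (q - p) / ?s" by (simp add: field_simps)
      have 3: "?n ((q + p) / ?s) * ?n ((q - p) / ?s) = ?n q * ?n p"
        by (simp add: std_normal_density_def power_divide power2_eq_square field_simps flip: exp_add)
      show "F (q / ?s + 1 / ?s * p) q / ?s = ?n q * (?n p * f ((q + p) / ?s) ((q - p) / ?s))"
        unfolding F_def 1 2 using 3 by (simp add: mult.assoc[symmetric])
    qed simp
    also have "\<dots> = ?n q * (\<integral>p. f ((q + p) / ?s) ((q - p) / ?s) \<partial>gauss)"
      by (subst integral_gauss) (auto intro!: fm)
    finally show "(\<integral>z. F z q \<partial>lborel) = ?n q * (\<integral>p. f ((q + p) / ?s) ((q - p) / ?s) \<partial>gauss)" .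
  qed simp
  also have "\<dots> = (\<integral>x. (\<integral>y. f ((x + y) / ?s) ((x - y) / ?s) \<partial>gauss) \<partial>gauss)"
  proof (rule integral_gauss[symmetric])
    have "(\<lambda>(x, y). f ((x + y) / ?s) ((x - y) / ?s)) \<in> borel_measurable (borel \<Otimes>\<^sub>M gauss)"
      unfolding split_beta by (rule fm; measurable)
    then show "(\<lambda>x. \<integral>y. f ((x + y) / ?s) ((x - y) / ?s) \<partial>gauss) \<in> borel_measurable borel"
      by measurable
  qed
  finally show ?thesis .
qed

text \<open>Differentiation under the integral sign, for several parameters at once: a dominating function for the
  derivative near \<open>p0\<close> dominates, by the mean value inequality, all difference quotients.\<close>
lemma has_derivative_gauss_integral:
  fixes h :: "'a::euclidean_space \<Rightarrow> real \<Rightarrow> real"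
  assumes e: "0 < e"
    and der: "\<And>p z. p \<in> ball p0 e \<Longrightarrow> ((\<lambda>p. h p z) has_derivative h' p z) (at p)"
    and meas: "\<And>p. p \<in> ball p0 e \<Longrightarrow> h p \<in> borel_measurable borel"
    and meas': "\<And>v. (\<lambda>z. h' p0 z v) \<in> borel_measurable borel"
    and int0: "integrable gauss (h p0)"
    and bnd: "\<And>p z v. p \<in> ball p0 e \<Longrightarrow> \<bar>h' p z v\<bar> \<le> B z * norm v"
    and intB: "integrable gauss B"
  shows "((\<lambda>p. \<integral>z. h p z \<partial>gauss) has_derivative (\<lambda>v. \<integral>z. h' p0 z v \<partial>gauss)) (at p0)"
proof -
  have p0: "p0 \<in> ball p0 e" using e by simp
  have lin: "bounded_linear (h' p0 z)" for z
    using der[OF p0] by (rule has_derivative_bounded_linear)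
  have int': "integrable gauss (\<lambda>z. h' p0 z v)" for v
    by (rule Bochner_Integration.integrable_bound[of _ "\<lambda>z. B z * norm v"])
      (use intB meas' in \<open>auto intro!: AE_I2 order_trans[OF bnd[OF p0] abs_ge_self]\<close>)
  have lip: "\<bar>h p z - h p0 z\<bar> \<le> B z * norm (p - p0)" if "p \<in> ball p0 e" for p z
  proof -
    have "norm (h p z - h p0 z) \<le> B z * norm (p - p0)"
    proof (rule differentiable_bound[of "ball p0 e" "\<lambda>p. h p z" "\<lambda>p. h' p z" "B z"])
      show "((\<lambda>p. h p z) has_derivative h' q z) (at q within ball p0 e)" if "q \<in> ball p0 e" for q
        using der[OF that] by (rule has_derivative_at_withinI)
      show "onorm (h' q z) \<le> B z" if "q \<in> ball p0 e" for q
        by (rule onorm_le) (use bnd[OF that, of z] in simp)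
    qed (use that p0 in auto)
    then show ?thesis by simp
  qed
  have inth: "integrable gauss (h p)" if "p \<in> ball p0 e" for p
  proof -
    have "integrable gauss (\<lambda>z. h p z - h p0 z)"
      by (rule Bochner_Integration.integrable_bound[of _ "\<lambda>z. B z * norm (p - p0)"])
        (use intB meas[OF that] meas[OF p0] in \<open>auto intro!: AE_I2 order_trans[OF lip[OF that] abs_ge_self]\<close>)
    from Bochner_Integration.integrable_add[OF this int0] show ?thesis by simp
  qed
  define q where "q p z = (h p z - h p0 z - h' p0 z (p - p0)) / norm (p - p0)" for p z
  have intq: "(\<integral>z. h p z \<partial>gauss) - (\<integral>z. h p0 z \<partial>gauss) - (\<integral>z. h' p0 z (p - p0) \<partial>gauss)
      = norm (p - p0) * (\<integral>z. q p z \<partial>gauss)" if "p \<in> ball p0 e" "p \<noteq> p0" for p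
  proof -
    have "norm (p - p0) * (\<integral>z. q p z \<partial>gauss) = (\<integral>z. norm (p - p0) * q p z \<partial>gauss)" by simp
    also have "\<dots> = (\<integral>z. h p z - h p0 z - h' p0 z (p - p0) \<partial>gauss)"
      unfolding q_def using that by (intro Bochner_Integration.integral_cong) auto
    finally show ?thesis
      using inth[OF that(1)] int0 int' by (simp add: Bochner_Integration.integral_diff)
  qed
  show ?thesis
  proof (rule has_derivativeI_sandwich[OF e, where H = "\<lambda>p. \<bar>\<integral>z. q p z \<partial>gauss\<bar>"])
    show "bounded_linear (\<lambda>v. \<integral>z. h' p0 z v \<partial>gauss)"
    proof (rule bounded_linear_intro[where K = "\<integral>z. B z \<partial>gauss"])
      show "(\<integral>z. h' p0 z (v + w) \<partial>gauss) = (\<integral>z. h' p0 z v \<partial>gauss) + (\<integral>z. h' p0 z w \<partial>gauss)" for v w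
        using int' by (simp add: bounded_linear.linear[OF lin] linear_add)
      show "(\<integral>z. h' p0 z (r *\<^sub>R v) \<partial>gauss) = r *\<^sub>R (\<integral>z. h' p0 z v \<partial>gauss)" for r v
        by (simp add: bounded_linear.linear[OF lin] linear_cmul)
      show "norm (\<integral>z. h' p0 z v \<partial>gauss) \<le> norm v * (\<integral>z. B z \<partial>gauss)" for v
      proof -
        have "norm (\<integral>z. h' p0 z v \<partial>gauss) \<le> (\<integral>z. norm v * B z \<partial>gauss)"
          using int' intB bnd[OF p0]
          by (intro Bochner_Integration.integral_norm_bound_integral) (auto simp: mult.commute)
        then show ?thesis by simp
      qed
    qed
    show "norm ((\<integral>z. h p z \<partial>gauss) - (\<integral>z. h p0 z \<partial>gauss) - (\<integral>z. h' p0 z (p - p0) \<partial>gauss)) / norm (p - p0)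
        \<le> \<bar>\<integral>z. q p z \<partial>gauss\<bar>" if "p \<noteq> p0" "dist p p0 < e" for p
      using that by (subst intq) (auto simp: abs_mult dist_commute)
    show "((\<lambda>p. \<bar>\<integral>z. q p z \<partial>gauss\<bar>) \<longlongrightarrow> 0) (at p0)"
    proof (rule tendsto_rabs_zero)
      show "((\<lambda>p. \<integral>z. q p z \<partial>gauss) \<longlongrightarrow> 0) (at p0)"
        unfolding tendsto_at_iff_sequentially comp_def
      proof (intro allI impI)
        fix X :: "nat \<Rightarrow> 'a"
        assume X: "\<forall>i. X i \<in> UNIV - {p0}" "X \<longlonglongrightarrow> p0"
        \<comment> \<open>Only the tail of the sequence lies in the ball on which the domination holds;
        the remaining terms are replaced by zero.\<close>
        define r where "r i z = (if X i \<in> ball p0 e then q (X i) z else 0)" for i z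
        have ev: "eventually (\<lambda>i. X i \<in> ball p0 e) sequentially"
          using topological_tendstoD[OF X(2) open_ball p0] .
        have qlim: "(\<lambda>i. q (X i) z) \<longlonglongrightarrow> 0" for z
        proof -
          have "((\<lambda>p. norm (h p z - h p0 z - h' p0 z (p - p0)) / norm (p - p0)) \<longlongrightarrow> 0) (at p0)"
            using der[OF p0, of z] by (simp add: has_derivative_iff_norm)
          then have "((\<lambda>p. q p z) \<longlongrightarrow> 0) (at p0)"
            by (subst tendsto_norm_zero_iff[symmetric]) (simp add: q_def)
          then show ?thesis
            using X unfolding tendsto_at_iff_sequentially comp_def by blast
        qed
        have "(\<lambda>i. \<integral>z. r i z \<partial>gauss) \<longlonglongrightarrow> (\<integral>z. 0 \<partial>gauss)"
        proof (rule integral_dominated_convergence[where w = "\<lambda>z. 2 * B z"])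
          show "r i \<in> borel_measurable gauss" for i
            using meas[of "X i"] meas[OF p0] meas'
            by (cases "X i \<in> ball p0 e") (auto simp: r_def[abs_def] q_def[abs_def])
          show "AE z in gauss. (\<lambda>i. r i z) \<longlonglongrightarrow> 0"
          proof (intro AE_I2)
            fix z
            have "eventually (\<lambda>i. q (X i) z = r i z) sequentially"
              using ev by eventually_elim (simp add: r_def)
            then show "(\<lambda>i. r i z) \<longlonglongrightarrow> 0"
              using qlim[of z] by (rule Lim_transform_eventually[rotated])
          qed
          show "AE z in gauss. norm (r i z) \<le> 2 * B z" for i
          proof (intro AE_I2)
            fix z
            have B0: "0 \<le> B z"
            proof -
              have "0 \<le> B z * norm (X i - p0)"
                using order_trans[OF abs_ge_zero bnd[OF p0, of z "X i - p0"]] .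
              moreover have "0 < norm (X i - p0)" using X(1) by auto
              ultimately show ?thesis by (simp add: zero_le_mult_iff)
            qed
            show "norm (r i z) \<le> 2 * B z"
            proof (cases "X i \<in> ball p0 e")
              case True
              have "\<bar>h (X i) z - h p0 z - h' p0 z (X i - p0)\<bar> \<le> 2 * B z * norm (X i - p0)"
                using lip[OF True, of z] bnd[OF p0, of z "X i - p0"] by linarith
              moreover have "0 < norm (X i - p0)" using X(1) by auto
              ultimately show ?thesis using True by (simp add: r_def q_def field_simps)
            qed (use B0 in \<open>simp add: r_def\<close>)
          qed
        qed (use intB in auto)
        moreover have "eventually (\<lambda>i. (\<integral>z. r i z \<partial>gauss) = (\<integral>z. q (X i) z \<partial>gauss)) sequentially"
          using ev by eventually_elim (simp add: r_def)
        ultimately show "(\<lambda>i. \<integral>z. q (X i) z \<partial>gauss) \<longlonglongrightarrow> 0"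
          by (simp add: Lim_transform_eventually)
      qed
    qed
  qed
qed

section \<open>Exponentially bounded functions\<close>

text \<open>Growth at most exponential is the growth class of the whole development: it is stable under sums,
  products, antiderivatives and Gaussian averages, and contains \<open>exp (m V)\<close> for Lipschitz \<open>V\<close>.\<close>
definition expbd :: "(real \<Rightarrow> real) \<Rightarrow> bool" where
  "expbd f \<longleftrightarrow> (\<exists>K k. 0 \<le> K \<and> 0 \<le> k \<and> (\<forall>x. \<bar>f x\<bar> \<le> K * exp (k * \<bar>x\<bar>)))"

definition expbd2 :: "(real \<Rightarrow> real \<Rightarrow> real) \<Rightarrow> bool" where
  "expbd2 f \<longleftrightarrow> (\<exists>K k. 0 \<le> K \<and> 0 \<le> k \<and> (\<forall>x y. \<bar>f x y\<bar> \<le> K * exp (k * (\<bar>x\<bar> + \<bar>y\<bar>))))"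

lemma expbdE:
  assumes "expbd f"
  obtains K k where "0 \<le> K" "0 \<le> k" "\<And>x. \<bar>f x\<bar> \<le> K * exp (k * \<bar>x\<bar>)"
  using assms unfolding expbd_def by blast

lemma expbd2E:
  assumes "expbd2 f"
  obtains K k where "0 \<le> K" "0 \<le> k" "\<And>x y. \<bar>f x y\<bar> \<le> K * exp (k * (\<bar>x\<bar> + \<bar>y\<bar>))"
  using assms unfolding expbd2_def by blast

lemma exp_bound_add:
  fixes a b K k L l s :: real
  assumes "\<bar>a\<bar> \<le> K * exp (k * s)" "\<bar>b\<bar> \<le> L * exp (l * s)" "0 \<le> K" "0 \<le> L" "0 \<le> s"
  shows "\<bar>a + b\<bar> \<le> (K + L) * exp (max k l * s)"
proof -
  have "K * exp (k * s) \<le> K * exp (max k l * s)" "L * exp (l * s) \<le> L * exp (max k l * s)"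
    using assms by (auto intro!: mult_left_mono mult_right_mono)
  then show ?thesis using assms by (simp add: distrib_right)
qed

lemma exp_bound_mult:
  fixes a b K k L l s :: real
  assumes "\<bar>a\<bar> \<le> K * exp (k * s)" "\<bar>b\<bar> \<le> L * exp (l * s)"
  shows "\<bar>a * b\<bar> \<le> (K * L) * exp ((k + l) * s)"
proof -
  have "\<bar>a\<bar> * \<bar>b\<bar> \<le> (K * exp (k * s)) * (L * exp (l * s))"
    using assms by (intro mult_mono) (auto intro: order_trans[OF abs_ge_zero])
  then show ?thesis by (simp add: abs_mult exp_add algebra_simps)
qed

lemma expbd2_add: assumes "expbd2 f" "expbd2 g" shows "expbd2 (\<lambda>x y. f x y + g x y)"
proof -
  from assms obtain K k L l where *: "0 \<le> K" "0 \<le> k" "\<And>x y. \<bar>f x y\<bar> \<le> K * exp (k * (\<bar>x\<bar> + \<bar>y\<bar>))"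
    "0 \<le> L" "0 \<le> l" "\<And>x y. \<bar>g x y\<bar> \<le> L * exp (l * (\<bar>x\<bar> + \<bar>y\<bar>))"
    by (elim expbd2E) metis
  have "\<bar>f x y + g x y\<bar> \<le> (K + L) * exp (max k l * (\<bar>x\<bar> + \<bar>y\<bar>))" for x y
    using * by (intro exp_bound_add) auto
  then show ?thesis unfolding expbd2_def
    using * by (intro exI[of _ "K + L"] exI[of _ "max k l"]) auto
qed

lemma expbd2_mult: assumes "expbd2 f" "expbd2 g" shows "expbd2 (\<lambda>x y. f x y * g x y)"
proof -
  from assms obtain K k L l where *: "0 \<le> K" "0 \<le> k" "\<And>x y. \<bar>f x y\<bar> \<le> K * exp (k * (\<bar>x\<bar> + \<bar>y\<bar>))"
    "0 \<le> L" "0 \<le> l" "\<And>x y. \<bar>g x y\<bar> \<le> L * exp (l * (\<bar>x\<bar> + \<bar>y\<bar>))"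
    by (elim expbd2E) metis
  have "\<bar>f x y * g x y\<bar> \<le> (K * L) * exp ((k + l) * (\<bar>x\<bar> + \<bar>y\<bar>))" for x y
    using * by (intro exp_bound_mult) auto
  then show ?thesis unfolding expbd2_def
    using * by (intro exI[of _ "K * L"] exI[of _ "k + l"]) auto
qed

lemma expbd2_const: "expbd2 (\<lambda>x y. c)"
  unfolding expbd2_def by (intro exI[of _ "\<bar>c\<bar>"] exI[of _ 0]) auto

lemma expbd2_uminus: "expbd2 f \<Longrightarrow> expbd2 (\<lambda>x y. - f x y)"
  unfolding expbd2_def by simp

lemma expbd2_diff: "expbd2 f \<Longrightarrow> expbd2 g \<Longrightarrow> expbd2 (\<lambda>x y. f x y - g x y)"
  using expbd2_add[OF _ expbd2_uminus, of f g] by simp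

lemma expbd2_affine:
  assumes "expbd f" shows "expbd2 (\<lambda>x y. f (a + b * x + c * y))"
proof -
  from assms obtain K k where *: "0 \<le> K" "0 \<le> k" "\<And>x. \<bar>f x\<bar> \<le> K * exp (k * \<bar>x\<bar>)"
    unfolding expbd_def by blast
  define l where "l = max \<bar>b\<bar> \<bar>c\<bar>"
  have "\<bar>f (a + b * x + c * y)\<bar> \<le> (K * exp (k * \<bar>a\<bar>)) * exp ((k * l) * (\<bar>x\<bar> + \<bar>y\<bar>))" for x y
  proof -
    have "\<bar>a + b * x + c * y\<bar> \<le> \<bar>a\<bar> + l * \<bar>x\<bar> + l * \<bar>y\<bar>"
    proof -
      have "\<bar>b * x\<bar> \<le> l * \<bar>x\<bar>" "\<bar>c * y\<bar> \<le> l * \<bar>y\<bar>"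
        unfolding abs_mult l_def by (auto intro!: mult_right_mono)
      then show ?thesis by linarith
    qed
    then have "k * \<bar>a + b * x + c * y\<bar> \<le> k * \<bar>a\<bar> + (k * l) * (\<bar>x\<bar> + \<bar>y\<bar>)"
      using mult_left_mono[OF _ *(2)] by (fastforce simp: algebra_simps)
    then have "K * exp (k * \<bar>a + b * x + c * y\<bar>) \<le> K * exp (k * \<bar>a\<bar> + (k * l) * (\<bar>x\<bar> + \<bar>y\<bar>))"
      using *(1) by (intro mult_left_mono) auto
    then show ?thesis using *(3)[of "a + b * x + c * y"] by (simp add: exp_add mult.assoc)
  qed
  moreover have "0 \<le> k * l" using * by (simp add: l_def)
  ultimately show ?thesis unfolding expbd2_def using *(1)
    by (intro exI[of _ "K * exp (k * \<bar>a\<bar>)"] exI[of _ "k * l"]) auto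
qed

lemma expbd_iff_expbd2: "expbd f \<longleftrightarrow> expbd2 (\<lambda>x y. f x)"
proof
  assume "expbd f" from expbd2_affine[OF this, of 0 1 0] show "expbd2 (\<lambda>x y. f x)" by simp
next
  assume "expbd2 (\<lambda>x y. f x)"
  then obtain K k where *: "0 \<le> K" "0 \<le> k" "\<And>x y::real. \<bar>f x\<bar> \<le> K * exp (k * (\<bar>x\<bar> + \<bar>y\<bar>))"
    unfolding expbd2_def by blast
  show "expbd f" unfolding expbd_def
    using *(1,2) *(3)[of _ 0] by (intro exI[of _ K] exI[of _ k]) simp
qed

lemma expbd_add: "expbd f \<Longrightarrow> expbd g \<Longrightarrow> expbd (\<lambda>x. f x + g x)"
  and expbd_mult: "expbd f \<Longrightarrow> expbd g \<Longrightarrow> expbd (\<lambda>x. f x * g x)"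
  and expbd_diff: "expbd f \<Longrightarrow> expbd g \<Longrightarrow> expbd (\<lambda>x. f x - g x)"
  and expbd_uminus: "expbd f \<Longrightarrow> expbd (\<lambda>x. - f x)"
  and expbd_const: "expbd (\<lambda>x. c)"
  unfolding expbd_iff_expbd2
  by (auto intro: expbd2_add expbd2_mult expbd2_diff expbd2_uminus expbd2_const)

lemma expbd_ident: "expbd (\<lambda>x. x)"
proof -
  have "\<bar>x\<bar> \<le> exp \<bar>x\<bar>" for x :: real
    using exp_ge_add_one_self[of "\<bar>x\<bar>"] by linarith
  then show ?thesis unfolding expbd_def by (intro exI[of _ 1]) auto
qed

lemma expbd_mono: "expbd g \<Longrightarrow> (\<And>x. \<bar>f x\<bar> \<le> \<bar>g x\<bar>) \<Longrightarrow> expbd f"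
  unfolding expbd_def by (meson order_trans)

lemma expbd_divide_ge1:
  assumes "expbd f" "\<And>x. 1 \<le> g x" shows "expbd (\<lambda>x. f x / g x)"
proof (rule expbd_mono[OF assms(1)])
  fix x
  have "\<bar>f x\<bar> * 1 \<le> \<bar>f x\<bar> * g x" using assms(2) by (intro mult_left_mono) auto
  then show "\<bar>f x / g x\<bar> \<le> \<bar>f x\<bar>"
    using assms(2)[of x] by (simp add: abs_divide divide_le_eq)
qed

lemma expbd_antiderivative:
  assumes "\<And>x. (F has_real_derivative f x) (at x)" "F 0 = 0" "expbd f"
  shows "expbd F"
proof -
  from assms(3) obtain K k where *: "0 \<le> K" "0 \<le> k" "\<And>x. \<bar>f x\<bar> \<le> K * exp (k * \<bar>x\<bar>)"
    unfolding expbd_def by blast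
  have "\<bar>F x\<bar> \<le> \<bar>(K * exp (k * \<bar>x\<bar>)) * x\<bar>" for x
  proof -
    have "norm (F x - F 0) \<le> (K * exp (k * \<bar>x\<bar>)) * norm (x - 0)"
    proof (rule field_differentiable_bound[of "{- \<bar>x\<bar>..\<bar>x\<bar>}"])
      show "(F has_field_derivative f z) (at z within {- \<bar>x\<bar>..\<bar>x\<bar>})" for z
        using assms(1) by (rule has_field_derivative_at_within)
      show "norm (f z) \<le> K * exp (k * \<bar>x\<bar>)" if "z \<in> {- \<bar>x\<bar>..\<bar>x\<bar>}" for z
      proof -
        have "\<bar>z\<bar> \<le> \<bar>x\<bar>" using that by auto
        then have "K * exp (k * \<bar>z\<bar>) \<le> K * exp (k * \<bar>x\<bar>)"
          using * by (intro mult_left_mono) (auto intro: mult_left_mono)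
        then show ?thesis using *(3)[of z] by simp
      qed
    qed auto
    then show ?thesis using assms(2) *(1) by (simp add: abs_mult)
  qed
  moreover have "expbd (\<lambda>x. K * exp (k * \<bar>x\<bar>) * x)"
  proof (intro expbd_mult expbd_ident)
    show "expbd (\<lambda>x. exp (k * \<bar>x\<bar>))"
      unfolding expbd_def using * by (intro exI[of _ 1] exI[of _ k]) auto
  qed (rule expbd_const)
  ultimately show ?thesis by (rule expbd_mono[rotated])
qed

lemma antiderivative_exists:
  fixes f :: "real \<Rightarrow> real"
  assumes "continuous_on UNIV f"
  obtains F where "\<And>x. (F has_real_derivative f x) (at x)" "F 0 = 0"
proof -
  obtain G where G: "\<And>x. (G has_vector_derivative f x) (at x)"
    using einterval_antiderivative[of "-\<infinity>" \<infinity> f] assms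
    by (auto simp: continuous_on_eq_continuous_at)
  show ?thesis
  proof
    show "((\<lambda>x. G x - G 0) has_real_derivative f x) (at x)" for x
      using G[of x] by (auto simp: has_real_derivative_iff_has_vector_derivative[symmetric] intro!: derivative_eq_intros)
  qed simp
qed

lemma integrable_gauss_expbd:
  assumes "f \<in> borel_measurable borel" "expbd f" shows "integrable gauss f"
  using assms(2) by (elim expbdE) (rule integrable_gauss_bound[OF assms(1)])

lemma gaussian_integration_by_parts_expbd:
  assumes "\<And>z. (g has_real_derivative g' z) (at z)" "continuous_on UNIV g'" "expbd g" "expbd g'"
  shows "(\<integral>z. g z * z \<partial>gauss) = (\<integral>z. g' z \<partial>gauss)"
proof -
  obtain K k where 1: "0 \<le> K" "0 \<le> k" "\<And>z. \<bar>g z\<bar> \<le> K * exp (k * \<bar>z\<bar>)"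
    using assms(3) unfolding expbd_def by blast
  obtain L l where 2: "0 \<le> L" "0 \<le> l" "\<And>z. \<bar>g' z\<bar> \<le> L * exp (l * \<bar>z\<bar>)"
    using assms(4) unfolding expbd_def by blast
  have up: "P * exp (p * \<bar>z\<bar>) \<le> (K + L) * exp ((k + l) * \<bar>z\<bar>)"
    if "0 \<le> P" "P \<le> K + L" "p \<le> k + l" for P p z :: real
    using that 1 2 by (intro mult_mono) (auto intro: mult_right_mono)
  show ?thesis
  proof (rule gaussian_integration_by_parts[OF assms(1,2)])
    show "\<bar>g z\<bar> \<le> (K + L) * exp ((k + l) * \<bar>z\<bar>)" for z
      using 1 2 by (intro order_trans[OF 1(3) up]) auto
    show "\<bar>g' z\<bar> \<le> (K + L) * exp ((k + l) * \<bar>z\<bar>)" for z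
      using 1 2 by (intro order_trans[OF 2(3) up]) auto
  qed
qed

lemma expbd_section: "expbd2 f \<Longrightarrow> expbd (f x)"
proof (elim expbd2E)
  fix K k assume *: "0 \<le> K" "0 \<le> k" "\<And>x y. \<bar>f x y\<bar> \<le> K * exp (k * (\<bar>x\<bar> + \<bar>y\<bar>))"
  then have "\<bar>f x y\<bar> \<le> (K * exp (k * \<bar>x\<bar>)) * exp (k * \<bar>y\<bar>)" for y
    by (simp add: distrib_left exp_add mult.assoc)
  then show ?thesis unfolding expbd_def using *
    by (intro exI[of _ "K * exp (k * \<bar>x\<bar>)"] exI[of _ k]) auto
qed

lemma expbd_gauss_integral:
  assumes "expbd2 f" and "\<And>x. f x \<in> borel_measurable borel"
  shows "expbd (\<lambda>x. \<integral>z. f x z \<partial>gauss)"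
proof -
  from assms(1) obtain K k where *: "0 \<le> K" "0 \<le> k" "\<And>x y. \<bar>f x y\<bar> \<le> K * exp (k * (\<bar>x\<bar> + \<bar>y\<bar>))"
    unfolding expbd2_def by blast
  define E where "E = (\<integral>z. exp (k * \<bar>z\<bar>) \<partial>gauss)"
  have "\<bar>\<integral>z. f x z \<partial>gauss\<bar> \<le> (K * E) * exp (k * \<bar>x\<bar>)" for x
  proof -
    have "norm (\<integral>z. f x z \<partial>gauss) \<le> (\<integral>z. K * exp (k * \<bar>x\<bar>) * exp (k * \<bar>z\<bar>) \<partial>gauss)"
      using *(3)[of x] integrable_gauss_exp_abs integrable_gauss_expbd[OF assms(2) expbd_section[OF assms(1)]]
      by (intro Bochner_Integration.integral_norm_bound_integral) (auto simp: distrib_left exp_add mult.assoc)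
    then show ?thesis by (simp add: E_def mult_ac)
  qed
  moreover have "0 \<le> E" unfolding E_def by (intro Bochner_Integration.integral_nonneg) simp
  ultimately show ?thesis unfolding expbd_def using * by (intro exI[of _ "K * E"] exI[of _ k]) auto
qed

lemma has_real_derivative_gauss_integral:
  fixes f f' :: "real \<Rightarrow> real \<Rightarrow> real"
  assumes der: "\<And>x z. ((\<lambda>x. f x z) has_real_derivative f' x z) (at x)"
    and meas: "\<And>x. f x \<in> borel_measurable borel" "\<And>x. f' x \<in> borel_measurable borel"
    and bnd: "expbd2 f" "expbd2 f'"
  shows "((\<lambda>x. \<integral>z. f x z \<partial>gauss) has_real_derivative (\<integral>z. f' x z \<partial>gauss)) (at x)"
proof -
  from bnd(2) obtain K k where *: "0 \<le> K" "0 \<le> k" "\<And>x y. \<bar>f' x y\<bar> \<le> K * exp (k * (\<bar>x\<bar> + \<bar>y\<bar>))"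
    unfolding expbd2_def by blast
  define B where "B z = K * exp (k * (\<bar>x\<bar> + 1)) * exp (k * \<bar>z\<bar>)" for z
  have "((\<lambda>x. \<integral>z. f x z \<partial>gauss) has_derivative (\<lambda>v. \<integral>z. f' x z * v \<partial>gauss)) (at x)"
  proof (rule has_derivative_gauss_integral[of 1 _ _ "\<lambda>p z v. f' p z * v" B])
    show "((\<lambda>p. f p z) has_derivative (*) (f' p z)) (at p)" for p z
      using der[of z p] by (simp add: has_field_derivative_def)
    show "integrable gauss (f x)"
      using meas expbd_section[OF bnd(1)] by (intro integrable_gauss_expbd) auto
    show "integrable gauss B"
      unfolding B_def using integrable_gauss_exp_abs by simp
    show "\<bar>f' p z * v\<bar> \<le> B z * norm v" if "p \<in> ball x 1" for p z v
    proof -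
      have "\<bar>p\<bar> \<le> \<bar>x\<bar> + 1" using that by (simp add: dist_real_def)
      then have "k * (\<bar>p\<bar> + \<bar>z\<bar>) \<le> k * (\<bar>x\<bar> + 1) + k * \<bar>z\<bar>"
        using mult_left_mono[of "\<bar>p\<bar>" "\<bar>x\<bar> + 1" k] * by (simp add: distrib_left)
      then have "K * exp (k * (\<bar>p\<bar> + \<bar>z\<bar>)) \<le> B z"
        unfolding B_def mult.assoc exp_add[symmetric] using * by (intro mult_left_mono) auto
      then have "\<bar>f' p z\<bar> \<le> B z" using *(3)[of p z] by linarith
      then show ?thesis by (simp add: abs_mult mult_right_mono)
    qed
  qed (use meas in auto)
  moreover have "(\<integral>z. f' x z * v \<partial>gauss) = (\<integral>z. f' x z \<partial>gauss) * v" for v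
    by simp
  ultimately show ?thesis by (simp only: has_field_derivative_def)
qed

text \<open>A Gaussian centred at \<open>R \<ge> 0\<close> gives every point \<open>x \<ge> 0\<close> at least the weight of \<open>- x\<close>, so it sees
  more of the half-line where the odd function \<open>M\<close> is nonpositive.\<close>
lemma gauss_mean_odd_le_0:
  assumes M [measurable]: "M \<in> borel_measurable borel" and "expbd M"
    and odd: "\<And>x. M (- x) = - M x" and neg: "\<And>x. 0 \<le> x \<Longrightarrow> M x \<le> 0"
    and s: "0 < s" and R: "0 \<le> R"
  shows "(\<integral>z. M (R + s * z) \<partial>gauss) \<le> 0"
proof -
  let ?n = std_normal_density
  have int: "integrable gauss (\<lambda>z. M (a + s * z))" for a
    using expbd_section[OF expbd2_affine[OF assms(2), of a 0 s], of 0]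
    by (intro integrable_gauss_expbd) simp_all
  have shift: "(\<integral>z. M (a + s * z) \<partial>gauss) = (\<integral>x. ?n ((x - a) / s) * M x / s \<partial>lborel)"
    and shifti: "integrable lborel (\<lambda>x. ?n ((x - a) / s) * M x / s)" for a
  proof -
    have "(\<integral>z. M (a + s * z) \<partial>gauss) = (\<integral>z. ?n z * M (a + s * z) \<partial>lborel)"
      by (rule integral_gauss) simp
    also have "\<dots> = (\<integral>x. ?n ((x - a) / s) * M x / s \<partial>lborel)"
      using lborel_integral_real_affine[of s "\<lambda>x. ?n ((x - a) / s) * M x / s" a] s by simp
    finally show "(\<integral>z. M (a + s * z) \<partial>gauss) = (\<integral>x. ?n ((x - a) / s) * M x / s \<partial>lborel)" .
    show "integrable lborel (\<lambda>x. ?n ((x - a) / s) * M x / s)"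
      using int[of a] lborel_integrable_real_affine_iff[of s "\<lambda>x. ?n ((x - a) / s) * M x / s" a] s
      by (simp add: integrable_gauss_iff)
  qed
  have "(\<integral>z. M (R + s * z) \<partial>gauss) = (\<integral>z. M (R + s * (- z)) \<partial>gauss)"
    using gauss_reflect[of "\<lambda>z. M (R + s * z)"] by simp
  also have "\<dots> = (\<integral>z. - M (- R + s * z) \<partial>gauss)"
    by (intro Bochner_Integration.integral_cong refl) (simp add: odd[symmetric])
  finally have "2 * (\<integral>z. M (R + s * z) \<partial>gauss) = (\<integral>z. M (R + s * z) \<partial>gauss) - (\<integral>z. M (- R + s * z) \<partial>gauss)"
    by simp
  also have "\<dots> = (\<integral>x. ?n ((x - R) / s) * M x / s - ?n ((x - - R) / s) * M x / s \<partial>lborel)"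
    unfolding shift by (rule Bochner_Integration.integral_diff[OF shifti shifti, symmetric])
  also have "\<dots> \<le> (\<integral>x. 0 \<partial>(lborel :: real measure))"
  proof (rule Bochner_Integration.integral_mono[OF Bochner_Integration.integrable_diff[OF shifti shifti] integrable_zero])
    fix x :: real
    have "(?n ((x - R) / s) - ?n ((x + R) / s)) * M x \<le> 0"
    proof (cases "0 \<le> x")
      case True
      then have "(x - R)\<^sup>2 \<le> (x + R)\<^sup>2" using R by (intro abs_le_square_iff[THEN iffD1]) auto
      then have "?n ((x + R) / s) \<le> ?n ((x - R) / s)"
        using s by (simp add: std_normal_density_def power_divide divide_right_mono)
      then show ?thesis using neg[OF True] by (intro mult_nonneg_nonpos) auto
    next
      case False
      then have "(x + R)\<^sup>2 \<le> (x - R)\<^sup>2" using R by (intro abs_le_square_iff[THEN iffD1]) auto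
      then have "?n ((x - R) / s) \<le> ?n ((x + R) / s)"
        using s by (simp add: std_normal_density_def power_divide divide_right_mono)
      moreover have "0 \<le> M x" using neg[of "- x"] odd[of x] False by simp
      ultimately show ?thesis by (intro mult_nonpos_nonneg) auto
    qed
    then have "((?n ((x - R) / s) - ?n ((x + R) / s)) * M x) / s \<le> 0"
      using s by (simp add: divide_le_0_iff)
    then show "?n ((x - R) / s) * M x / s - ?n ((x - - R) / s) * M x / s \<le> 0"
      by (simp add: left_diff_distrib diff_divide_distrib)
  qed
  finally show ?thesis by simp
qed


lemma even_derivative_odd:
  fixes f f' :: "real \<Rightarrow> real"
  assumes "\<And>x. (f has_real_derivative f' x) (at x)" "\<And>x. f (- x) = f x"
  shows "f' (- x) = - f' x"
proof -
  have "((\<lambda>x. f (- x)) has_real_derivative f' (- x) * (- 1)) (at x)"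
    by (rule DERIV_chain2[OF assms(1)]) (auto intro!: derivative_eq_intros)
  then have "(f has_real_derivative - f' (- x)) (at x)" by (simp add: assms(2))
  from DERIV_unique[OF this assms(1)[of x]] show ?thesis by simp
qed

lemma odd_derivative_even:
  fixes f f' :: "real \<Rightarrow> real"
  assumes "\<And>x. (f has_real_derivative f' x) (at x)" "\<And>x. f (- x) = - f x"
  shows "f' (- x) = f' x"
proof -
  have "((\<lambda>x. f (- x)) has_real_derivative f' (- x) * (- 1)) (at x)"
    by (rule DERIV_chain2[OF assms(1)]) (auto intro!: derivative_eq_intros)
  then have "((\<lambda>x. - f x) has_real_derivative - f' (- x)) (at x)" by (simp add: assms(2))
  from DERIV_unique[OF this DERIV_minus[OF assms(1)[of x]]] show ?thesis by simp
qed

lemma zero_of_zero_derivative: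
  fixes f :: "real \<Rightarrow> real"
  assumes "\<And>x. (f has_real_derivative 0) (at x)"
  shows "f x = f y"
  using DERIV_const_ratio_const[of x y f 0] DERIV_isconst_all assms by blast

lemma even_antiderivative_odd:
  fixes F f :: "real \<Rightarrow> real"
  assumes der: "\<And>x. (F has_real_derivative f x) (at x)" and "F 0 = 0" and ev: "\<And>x. f (- x) = f x"
  shows "F (- x) = - F x"
proof -
  have "((\<lambda>x. F x + F (- x)) has_real_derivative 0) (at x)" for x
  proof -
    have "((\<lambda>x. F (- x)) has_real_derivative f (- x) * (- 1)) (at x)"
      by (rule DERIV_chain2[OF der]) (auto intro!: derivative_eq_intros)
    from DERIV_add[OF der[of x] this] show ?thesis by (simp add: ev)
  qed
  from zero_of_zero_derivative[OF this, of x 0] assms(2) show ?thesis by simp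
qed

lemma odd_antiderivative_even:
  fixes F f :: "real \<Rightarrow> real"
  assumes der: "\<And>x. (F has_real_derivative f x) (at x)" and od: "\<And>x. f (- x) = - f x"
  shows "F (- x) = F x"
proof -
  have "((\<lambda>x. F x - F (- x)) has_real_derivative 0) (at x)" for x
  proof -
    have "((\<lambda>x. F (- x)) has_real_derivative f (- x) * (- 1)) (at x)"
      by (rule DERIV_chain2[OF der]) (auto intro!: derivative_eq_intros)
    from DERIV_diff[OF der[of x] this] show ?thesis by (simp add: od)
  qed
  from zero_of_zero_derivative[OF this, of x 0] show ?thesis by simp
qed

text \<open>The discriminant of a quadratic form without positive values. The leading coefficient \<open>c\<close> may vanish,
  in which case the linear term has to vanish as well.\<close>
lemma square_le_of_quadratic_nonpos:
  fixes a b c :: real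
  assumes "\<And>t. a + 2 * t * b + t\<^sup>2 * c \<le> 0"
  shows "b\<^sup>2 \<le> a * c"
proof (cases "c = 0")
  case True
  have "b = 0"
  proof (rule ccontr)
    assume "b \<noteq> 0"
    then show False using assms[of "(1 - a) / (2 * b)"] True by (simp add: left_diff_distrib diff_divide_distrib)
  qed
  then show ?thesis using True by simp
next
  case False
  have "c < 0"
  proof (rule ccontr)
    assume "\<not> c < 0"
    then have c: "c > 0" using False by simp
    \<comment> \<open>Large enough for the quadratic term to exceed the absolute values of the other two.\<close>
    define t where "t = (\<bar>a\<bar> + 1 + 2 * \<bar>b\<bar>) / c + 1"
    have t1: "t \<ge> 1" using c by (simp add: t_def)
    have "t * c = \<bar>a\<bar> + 1 + 2 * \<bar>b\<bar> + c" using c by (simp add: t_def field_simps)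
    then have "t * (t * c + 2 * b) \<ge> 1 * (\<bar>a\<bar> + 1)"
      using c t1 by (intro mult_mono) auto
    then have "a + 2 * t * b + t\<^sup>2 * c > 0" by (simp add: power2_eq_square algebra_simps)
    with assms[of t] show False by simp
  qed
  have "a + 2 * (- b / c) * b + (- b / c)\<^sup>2 * c \<le> 0" by (rule assms)
  then have "a - b\<^sup>2 / c \<le> 0"
    using False by (simp add: power2_eq_square)
  then show ?thesis using \<open>c < 0\<close> by (simp add: field_simps)
qed

section \<open>The Gaussian kernel inequality\<close>

lemma borel_measurable_comp2:
  fixes f :: "real \<Rightarrow> real \<Rightarrow> real"
  assumes "(\<lambda>p. f (fst p) (snd p)) \<in> borel_measurable (borel \<Otimes>\<^sub>M borel)"
    and "g \<in> borel_measurable N" "h \<in> borel_measurable N"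
  shows "(\<lambda>q. f (g q) (h q)) \<in> borel_measurable N"
  using measurable_compose[OF measurable_Pair[OF assms(2,3)] assms(1)] by simp

text \<open>The heart of the proof. Put \<open>\<omega> = u / \<phi>\<close>, \<open>G = \<phi>'' / \<phi>\<close>, and let \<open>C\<close> be an antiderivative of
  \<open>c = - Y / \<phi>\<^sup>2\<close>. The hypothesis says that \<open>- C + 2 t \<omega> + t\<^sup>2 G\<close> is nonincreasing on the positive half-line
  for every \<open>t\<close>; comparing two points and taking the discriminant in \<open>t\<close> gives
    \<open>(\<omega>(x) - \<omega>(x'))\<^sup>2 \<le> (C(x') - C(x)) (G(x) - G(x'))\<close>,
  which extends to all \<open>x\<close> and \<open>x'\<close> because \<open>\<omega>\<close>, \<open>G\<close> and \<open>C\<close> are even.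
  With \<open>W(x, x') = \<phi>(x) \<phi>(x') (C(x') - C(x))\<close> this is the pointwise inequality
    \<open>\<phi>(x) y(x') + y(x) \<phi>(x') - 2 u(x) u(x') \<le> (\<partial>\<^sub>1\<^sup>2 - \<partial>\<^sub>2\<^sup>2) W(x, x')\<close>.
  Let \<open>P\<close> be convolution with the law of \<open>\<surd>2 s Z\<close>. The left-hand side, averaged over two independent
  Gaussian displacements of one point, is \<open>2 (P\<phi> Py - (Pu)\<^sup>2)\<close>. In the rotated coordinates
  \<open>x = a + b\<close>, \<open>x' = a - b\<close> the operator on the right is \<open>\<partial>\<^sub>a \<partial>\<^sub>b\<close>, so integrating the centre over \<open>[0, R]\<close>
  and integrating by parts in \<open>b\<close> bounds the integral of \<open>P\<phi> Py - (Pu)\<^sup>2\<close> by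
    \<open>(1 / (2 s)) E [U (R + s Z, s Z') Z']\<close>, where \<open>U(a, b) = W(a + b, a - b)\<close>.
  Since \<open>C\<close> is even and increasing in \<open>|x|\<close>, the sign of \<open>U(a, b)\<close> is opposite to that of \<open>a b\<close>.
  Hence \<open>E [U(a, s Z') Z']\<close> is odd in \<open>a\<close> and nonpositive for \<open>a \<ge> 0\<close>, and its average around
  \<open>R \<ge> 0\<close> is nonpositive by \<open>gauss_mean_odd_le_0\<close>.\<close>
lemma gaussian_kernel_inequality:
  fixes \<phi> \<phi>1 \<phi>2 \<phi>3 u u1 y Y Z :: "real \<Rightarrow> real"
  assumes d\<phi>: "\<And>x. (\<phi> has_real_derivative \<phi>1 x) (at x)"
    and d\<phi>1: "\<And>x. (\<phi>1 has_real_derivative \<phi>2 x) (at x)"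
    and d\<phi>2: "\<And>x. (\<phi>2 has_real_derivative \<phi>3 x) (at x)"
    and du: "\<And>x. (u has_real_derivative u1 x) (at x)"
    and cy: "continuous_on UNIV y"
    and dY: "\<And>x. (Y has_real_derivative \<phi> x * y x - (u x)\<^sup>2) (at x)" and Y0: "Y 0 = 0"
    and even: "\<And>x. \<phi> (- x) = \<phi> x" "\<And>x. u (- x) = u x" "\<And>x. y (- x) = y x"
    and bnd: "expbd \<phi>" "expbd \<phi>1" "expbd \<phi>2" "expbd u" "expbd y"
    and ge1: "\<And>x. 1 \<le> \<phi> x"
    and hyp: "\<And>x t. 0 \<le> x \<Longrightarrow>
        Y x + 2 * t * (\<phi> x * u1 x - u x * \<phi>1 x) + t\<^sup>2 * (\<phi> x * \<phi>3 x - \<phi>1 x * \<phi>2 x) \<le> 0"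
    and s: "0 < s"
    and dZ: "\<And>x. (Z has_real_derivative
        (\<integral>z. \<phi> (x + sqrt 2 * s * z) \<partial>gauss) * (\<integral>z. y (x + sqrt 2 * s * z) \<partial>gauss)
          - (\<integral>z. u (x + sqrt 2 * s * z) \<partial>gauss)\<^sup>2) (at x)" and Z0: "Z 0 = 0"
    and R: "0 \<le> R"
  shows "Z R \<le> 0"
proof -
  have pos: "0 < \<phi> x" for x using ge1[of x] by simp
  have nz: "\<phi> x \<noteq> 0" for x using pos[of x] by simp
  have c\<phi>: "continuous_on UNIV \<phi>" and c\<phi>1: "continuous_on UNIV \<phi>1" and c\<phi>2: "continuous_on UNIV \<phi>2"
    and cu: "continuous_on UNIV u" and cY: "continuous_on UNIV Y"
    using d\<phi> d\<phi>1 d\<phi>2 du dY by (auto intro!: continuous_at_imp_continuous_on DERIV_isCont)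
  have odd1: "\<phi>1 (- x) = - \<phi>1 x" for x using even_derivative_odd[OF d\<phi> even(1)] .
  have even2: "\<phi>2 (- x) = \<phi>2 x" for x using odd_derivative_even[OF d\<phi>1 odd1] .
  have oddY: "Y (- x) = - Y x" for x using even_antiderivative_odd[OF dY Y0] even by simp
  define c where "c x = - (Y x / (\<phi> x)\<^sup>2)" for x
  define c' where "c' x = 2 * (Y x * \<phi>1 x) / \<phi> x ^ 3 - (\<phi> x * y x - (u x)\<^sup>2) / (\<phi> x)\<^sup>2" for x
  have dc: "(c has_real_derivative c' x) (at x)" for x
    unfolding c_def[abs_def] c'_def
    by (auto intro!: derivative_eq_intros dY d\<phi> simp: nz power2_eq_square power3_eq_cube field_simps)
  have cc: "continuous_on UNIV c" using dc by (auto intro!: continuous_at_imp_continuous_on DERIV_isCont)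
  have cc': "continuous_on UNIV c'" unfolding c'_def
    by (intro continuous_intros cY c\<phi> c\<phi>1 cy cu) (auto simp: nz)
  obtain C where dC: "\<And>x. (C has_real_derivative c x) (at x)" and C0: "C 0 = 0"
    using antiderivative_exists[OF cc] by blast
  have cC: "continuous_on UNIV C" using dC by (auto intro!: continuous_at_imp_continuous_on DERIV_isCont)
  have oddc: "c (- x) = - c x" for x unfolding c_def by (simp add: oddY even)
  have evC: "C (- x) = C x" for x using odd_antiderivative_even[OF dC oddc] .
  have Yneg: "Y x \<le> 0" if "0 \<le> x" for x using hyp[OF that, of 0] by simp
  have cpos: "0 \<le> c x" if "0 \<le> x" for x
    using Yneg[OF that] pos[of x] by (simp add: c_def divide_nonpos_nonneg)
  have Cmono: "C x \<le> C x'" if "0 \<le> x" "x \<le> x'" for x x'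
    using that(2) by (rule DERIV_nonneg_imp_nondecreasing) (use dC cpos that in force)
  have Cabs: "C x = C \<bar>x\<bar>" for x by (auto simp: abs_if evC)
  have sq1: "1 \<le> (\<phi> x)\<^sup>2" for x using ge1[of x] by (simp add: one_le_power)
  have cube1: "1 \<le> (\<phi> x) ^ 3" for x using ge1[of x] by (simp add: one_le_power)
  have bY: "expbd Y"
    by (rule expbd_antiderivative[OF dY Y0])
      (simp add: power2_eq_square, intro expbd_diff expbd_mult bnd)
  have bc: "expbd c" unfolding c_def by (intro expbd_uminus expbd_divide_ge1 bY sq1)
  have bC: "expbd C" by (rule expbd_antiderivative[OF dC C0 bc])
  have bc': "expbd c'" unfolding c'_def
    by (intro expbd_diff expbd_divide_ge1 expbd_mult expbd_const bY bnd sq1 cube1)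
      (simp add: power2_eq_square, intro expbd_diff expbd_mult bnd)
  define om where "om x = u x / \<phi> x" for x
  define G where "G x = \<phi>2 x / \<phi> x" for x
  have dom: "(om has_real_derivative (\<phi> x * u1 x - u x * \<phi>1 x) / (\<phi> x)\<^sup>2) (at x)" for x
    unfolding om_def[abs_def] by (auto intro!: derivative_eq_intros du d\<phi> simp: nz power2_eq_square)
  have dG: "(G has_real_derivative (\<phi> x * \<phi>3 x - \<phi>1 x * \<phi>2 x) / (\<phi> x)\<^sup>2) (at x)" for x
    unfolding G_def[abs_def] by (auto intro!: derivative_eq_intros d\<phi>2 d\<phi> simp: nz power2_eq_square)
  have cs0: "(om x' - om x)\<^sup>2 \<le> (C x' - C x) * (G x - G x')" if "0 \<le> x" "x \<le> x'" for x x'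
  proof -
    have "(om x' - om x)\<^sup>2 \<le> (- (C x' - C x)) * (G x' - G x)"
    proof (rule square_le_of_quadratic_nonpos)
      fix t :: real
      let ?h = "\<lambda>x. - C x + 2 * t * om x + t\<^sup>2 * G x"
      have dh: "(?h has_real_derivative (Y x + 2 * t * (\<phi> x * u1 x - u x * \<phi>1 x)
            + t\<^sup>2 * (\<phi> x * \<phi>3 x - \<phi>1 x * \<phi>2 x)) / (\<phi> x)\<^sup>2) (at x)" for x
        by (rule derivative_eq_intros dC dom dG refl)+ (simp add: c_def add_divide_distrib mult.commute)
      have "?h x' \<le> ?h x"
        using that(2)
      proof (rule DERIV_nonpos_imp_nonincreasing)
        fix w assume w: "x \<le> w" "w \<le> x'"
        show "\<exists>D. (?h has_real_derivative D) (at w) \<and> D \<le> 0"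
          by (intro exI conjI, rule dh, intro divide_nonpos_nonneg hyp) (use w that(1) in auto)
      qed
      then show "- (C x' - C x) + 2 * t * (om x' - om x) + t\<^sup>2 * (G x' - G x) \<le> 0"
        by (simp add: algebra_simps)
    qed
    then show ?thesis by (simp add: algebra_simps)
  qed
  have abse: "om x = om \<bar>x\<bar>" "G x = G \<bar>x\<bar>" for x
    by (auto simp: om_def G_def abs_if even even2)
  have cs: "(om x - om x')\<^sup>2 \<le> (C x' - C x) * (G x - G x')" for x x'
  proof (cases "\<bar>x\<bar> \<le> \<bar>x'\<bar>")
    case True
    then show ?thesis
      using cs0[of "\<bar>x\<bar>" "\<bar>x'\<bar>"] by (simp add: abse[symmetric] Cabs[symmetric] power2_commute)
  next
    case False
    then show ?thesis
      using cs0[of "\<bar>x'\<bar>" "\<bar>x\<bar>"] by (simp add: abse[symmetric] Cabs[symmetric] algebra_simps)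
  qed
  define A where "A x x' = \<phi> x * y x' + y x * \<phi> x' - 2 * (u x * u x')" for x x'
  \<comment> \<open>\<open>Wa\<close> is \<open>(\<partial>\<^sub>1 + \<partial>\<^sub>2) W\<close> and \<open>Wab\<close> is \<open>(\<partial>\<^sub>1\<^sup>2 - \<partial>\<^sub>2\<^sup>2) W\<close>, that is,
  the derivatives of \<open>W(a + b, a - b)\<close> in \<open>a\<close>, and in \<open>a\<close> and \<open>b\<close>.\<close>
  define W where "W x x' = \<phi> x * \<phi> x' * (C x' - C x)" for x x'
  define Wa where "Wa x x' = (\<phi>1 x * \<phi> x' + \<phi> x * \<phi>1 x') * (C x' - C x) + \<phi> x * \<phi> x' * (c x' - c x)" for x x'
  define Wab where "Wab x x' = (\<phi>2 x * \<phi> x' - \<phi> x * \<phi>2 x') * (C x' - C x)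
      - 2 * (\<phi>1 x * \<phi> x' * c x) - 2 * (\<phi> x * \<phi>1 x' * c x') - \<phi> x * \<phi> x' * (c' x + c' x')" for x x'
  have A_le: "A x x' \<le> Wab x x'" for x x'
  proof -
    have y_eq: "y x = - \<phi> x * c' x - 2 * \<phi>1 x * c x + \<phi> x * (om x)\<^sup>2" for x
      unfolding c'_def c_def om_def using nz[of x]
      by (simp add: power2_eq_square power3_eq_cube field_simps)
    have "A x x' = \<phi> x * \<phi> x' * (om x - om x')\<^sup>2 - 2 * (\<phi>1 x * \<phi> x' * c x) - 2 * (\<phi> x * \<phi>1 x' * c x')
        - \<phi> x * \<phi> x' * (c' x + c' x')"
    proof -
      have "u x = \<phi> x * om x" "u x' = \<phi> x' * om x'" using nz by (auto simp: om_def)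
      then show ?thesis unfolding A_def y_eq[of x] y_eq[of x'] by (simp add: power2_eq_square algebra_simps)
    qed
    moreover have "\<phi> x * \<phi> x' * (om x - om x')\<^sup>2 \<le> \<phi> x * \<phi> x' * ((C x' - C x) * (G x - G x'))"
      using pos[of x] pos[of x'] cs[of x x'] by (intro mult_left_mono) auto
    moreover have "\<phi> x * \<phi> x' * ((C x' - C x) * (G x - G x')) = (\<phi>2 x * \<phi> x' - \<phi> x * \<phi>2 x') * (C x' - C x)"
      using nz by (simp add: G_def field_simps)
    ultimately show ?thesis by (simp add: Wab_def)
  qed
  define U where "U a b = W (a + b) (a - b)" for a b
  define Ua where "Ua a b = Wa (a + b) (a - b)" for a b
  define Uab where "Uab a b = Wab (a + b) (a - b)" for a b
  have chain: "((\<lambda>a. f (a + b)) has_real_derivative f' (a + b)) (at a)"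
    "((\<lambda>a. f (a - b)) has_real_derivative f' (a - b)) (at a)"
    "((\<lambda>b. f (a + b)) has_real_derivative f' (a + b)) (at b)"
    "((\<lambda>b. f (a - b)) has_real_derivative - f' (a - b)) (at b)"
    if "\<And>x. (f has_real_derivative f' x) (at x)" for f f' :: "real \<Rightarrow> real" and a b
    by (rule DERIV_cong[OF DERIV_chain2[OF that]], (rule derivative_eq_intros refl)+, simp)+
  note ch = chain[OF d\<phi>] chain[OF d\<phi>1] chain[OF dC] chain[OF dc]
  have dU: "((\<lambda>a. U a b) has_real_derivative Ua a b) (at a)" for a b
    unfolding U_def Ua_def W_def Wa_def
    by (rule derivative_eq_intros ch refl)+ (simp add: algebra_simps)
  have dUa: "((\<lambda>b. Ua a b) has_real_derivative Uab a b) (at b)" for a b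
    unfolding Ua_def Uab_def Wa_def Wab_def
    by (rule derivative_eq_intros ch refl)+ (simp add: algebra_simps)
  have sh: "expbd2 (\<lambda>a b. f (a + b))" "expbd2 (\<lambda>a b. f (a - b))" if "expbd f" for f
    using expbd2_affine[OF that, of 0 1 1] expbd2_affine[OF that, of 0 1 "-1"] by simp_all
  have bU: "expbd2 U" unfolding U_def W_def
    by (intro expbd2_mult expbd2_diff sh bnd bC)
  have bUa: "expbd2 Ua" unfolding Ua_def Wa_def
    by (intro expbd2_mult expbd2_diff expbd2_add sh bnd bC bc)
  have bUab: "expbd2 Uab" unfolding Uab_def Wab_def
    by (intro expbd2_mult expbd2_diff expbd2_add expbd2_const sh bnd bC bc bc')
  have [measurable]: "\<phi> \<in> borel_measurable borel" "\<phi>1 \<in> borel_measurable borel" "\<phi>2 \<in> borel_measurable borel"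
     "u \<in> borel_measurable borel" "y \<in> borel_measurable borel" "c \<in> borel_measurable borel"
     "c' \<in> borel_measurable borel" "C \<in> borel_measurable borel"
    using c\<phi> c\<phi>1 c\<phi>2 cu cy cc cc' cC by (auto intro: borel_measurable_continuous_onI)
  have mU: "(\<lambda>p. U (fst p) (snd p)) \<in> borel_measurable (borel \<Otimes>\<^sub>M borel)"
    unfolding U_def W_def by measurable
  have mUa: "(\<lambda>p. Ua (fst p) (snd p)) \<in> borel_measurable (borel \<Otimes>\<^sub>M borel)"
    unfolding Ua_def Wa_def by measurable
  have mUab: "(\<lambda>p. Uab (fst p) (snd p)) \<in> borel_measurable (borel \<Otimes>\<^sub>M borel)"
    unfolding Uab_def Wab_def by measurable
  have scl: "expbd2 (\<lambda>a b. f a (s * b))" if "expbd2 f" for f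
  proof -
    from that obtain K k where *: "0 \<le> K" "0 \<le> k" "\<And>x y. \<bar>f x y\<bar> \<le> K * exp (k * (\<bar>x\<bar> + \<bar>y\<bar>))"
      unfolding expbd2_def by blast
    have "\<bar>f x (s * z)\<bar> \<le> K * exp ((k * max 1 s) * (\<bar>x\<bar> + \<bar>z\<bar>))" for x z
    proof -
      have "\<bar>x\<bar> + \<bar>s * z\<bar> \<le> max 1 s * (\<bar>x\<bar> + \<bar>z\<bar>)"
        unfolding distrib_left using s
        by (intro add_mono) (auto simp: abs_mult intro!: mult_right_mono mult_le_cancel_right1[THEN iffD2])
      then have "K * exp (k * (\<bar>x\<bar> + \<bar>s * z\<bar>)) \<le> K * exp ((k * max 1 s) * (\<bar>x\<bar> + \<bar>z\<bar>))"
        using * by (intro mult_left_mono) (auto simp: mult.assoc intro: mult_left_mono)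
      then show ?thesis using *(3)[of x "s * z"] by linarith
    qed
    then show ?thesis unfolding expbd2_def using *
      by (intro exI[of _ K] exI[of _ "k * max 1 s"]) auto
  qed
  have proj2: "expbd2 (\<lambda>a b. b)" using expbd2_affine[OF expbd_ident, of 0 0 1] by simp
  define M where "M a = (\<integral>z. U a (s * z) * z \<partial>gauss)" for a
  define D where "D a = (\<integral>z. Uab a (s * z) \<partial>gauss)" for a
  have bM: "expbd M" unfolding M_def
    by (intro expbd_gauss_integral expbd2_mult scl[OF bU] proj2 borel_measurable_times
        borel_measurable_comp2[OF mU]) simp_all
  have bD: "expbd D" unfolding D_def
    by (intro expbd_gauss_integral scl[OF bUab] borel_measurable_comp2[OF mUab]) simp_all
  have mM [measurable]: "M \<in> borel_measurable borel" unfolding M_def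
    by (intro gauss.borel_measurable_lebesgue_integral)
      (unfold split_beta, intro borel_measurable_times borel_measurable_comp2[OF mU]; measurable)
  have mD [measurable]: "D \<in> borel_measurable borel" unfolding D_def
    by (intro gauss.borel_measurable_lebesgue_integral)
      (unfold split_beta, intro borel_measurable_comp2[OF mUab]; measurable)
  have dM: "(M has_real_derivative s * D a) (at a)" for a
  proof -
    have "(M has_real_derivative (\<integral>z. Ua a (s * z) * z \<partial>gauss)) (at a)"
      unfolding M_def
    proof (rule has_real_derivative_gauss_integral)
      show "((\<lambda>x. U x (s * z) * z) has_real_derivative Ua x (s * z) * z) (at x)" for x z
        by (rule DERIV_cmult_right[OF dU])
    qed (auto intro!: expbd2_mult scl[OF bU] scl[OF bUa] proj2 borel_measurable_times
        borel_measurable_comp2[OF mU] borel_measurable_comp2[OF mUa])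
    moreover have "(\<integral>z. Ua a (s * z) * z \<partial>gauss) = (\<integral>z. s * Uab a (s * z) \<partial>gauss)"
    proof (rule gaussian_integration_by_parts_expbd)
      show "((\<lambda>z. Ua a (s * z)) has_real_derivative s * Uab a (s * z)) (at z)" for z
        by (rule DERIV_cong[OF DERIV_chain2[OF dUa]]) (auto intro!: derivative_eq_intros)
      show "continuous_on UNIV (\<lambda>z. s * Uab a (s * z))"
        unfolding Uab_def Wab_def
        by (intro continuous_intros continuous_on_compose2[OF c\<phi>] continuous_on_compose2[OF c\<phi>1]
            continuous_on_compose2[OF c\<phi>2] continuous_on_compose2[OF cC] continuous_on_compose2[OF cc]
            continuous_on_compose2[OF cc']) auto
    qed (intro expbd_mult expbd_const expbd_section[OF scl[OF bUa]] expbd_section[OF scl[OF bUab]])+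
    ultimately show ?thesis by (simp add: D_def)
  qed
  define H where "H x = (\<integral>z. M (x + s * z) \<partial>gauss)" for x
  have aff: "expbd2 (\<lambda>x z. f (x + s * z))" if "expbd f" for f
    using expbd2_affine[OF that, of 0 1 s] by simp
  have dH: "(H has_real_derivative s * (\<integral>z. D (x + s * z) \<partial>gauss)) (at x)" for x
  proof -
    have "(H has_real_derivative (\<integral>z. s * D (x + s * z) \<partial>gauss)) (at x)"
      unfolding H_def
    proof (rule has_real_derivative_gauss_integral)
      show "((\<lambda>x. M (x + s * z)) has_real_derivative s * D (x + s * z)) (at x)" for x z
        using chain(1)[OF dM] .
    qed (auto intro!: aff bM expbd2_mult[OF expbd2_const aff[OF bD]])
    then show ?thesis by simp
  qed
  have oddM: "M (- a) = - M a" for a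
  proof -
    have "U (- a) b = - U a b" for b
    proof -
      have "U (- a) b = W (- (a - b)) (- (a + b))" by (simp add: U_def algebra_simps)
      also have "\<dots> = - U a b"
        unfolding W_def U_def even evC by (simp add: algebra_simps)
      finally show ?thesis .
    qed
    then show ?thesis by (simp add: M_def)
  qed
  have negM: "M a \<le> 0" if a: "0 \<le> a" for a
  proof -
    have sgn: "U a b * b \<le> 0" for b
    proof (cases "0 \<le> b")
      case True
      then have "C (a - b) \<le> C (a + b)"
        using a Cmono[OF abs_ge_zero, of "a - b" "\<bar>a + b\<bar>"] unfolding Cabs[symmetric] by linarith
      then have "U a b \<le> 0" unfolding U_def W_def using pos by (intro mult_nonneg_nonpos) (auto simp: less_imp_le)
      then show ?thesis using True by (rule mult_nonpos_nonneg)
    next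
      case False
      then have "C (a + b) \<le> C (a - b)"
        using a Cmono[OF abs_ge_zero, of "a + b" "\<bar>a - b\<bar>"] unfolding Cabs[symmetric] by linarith
      then have "U a b \<ge> 0" unfolding U_def W_def using pos by (intro mult_nonneg_nonneg) (auto simp: less_imp_le)
      then show ?thesis using False by (intro mult_nonneg_nonpos) auto
    qed
    have "U a (s * z) * z \<le> 0" for z
    proof -
      have "s * (U a (s * z) * z) \<le> 0" using sgn[of "s * z"] by (simp add: mult_ac)
      then show ?thesis using s by (simp add: mult_le_0_iff)
    qed
    then have "0 \<le> (\<integral>z. - (U a (s * z) * z) \<partial>gauss)"
      by (intro Bochner_Integration.integral_nonneg) auto
    then show ?thesis by (simp add: M_def)
  qed
  have HR: "H R \<le> 0"
    unfolding H_def by (rule gauss_mean_odd_le_0[OF mM bM oddM negM s R])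
  have H0: "H 0 = 0"
    using gauss_reflect[of "\<lambda>z. M (s * z)"] oddM by (simp add: H_def)
  have key: "(\<integral>z. \<phi> (x + sqrt 2 * s * z) \<partial>gauss) * (\<integral>z. y (x + sqrt 2 * s * z) \<partial>gauss)
          - (\<integral>z. u (x + sqrt 2 * s * z) \<partial>gauss)\<^sup>2 \<le> (1 / 2) * (\<integral>z. D (x + s * z) \<partial>gauss)" for x
  proof -
    let ?r = "sqrt 2 * s"
    have bA: "expbd2 (\<lambda>z z'. A (x + ?r * z) (x + ?r * z'))"
      unfolding A_def
      using expbd2_affine[of _ x ?r 0] expbd2_affine[of _ x 0 ?r]
      by (intro expbd2_diff expbd2_add expbd2_mult expbd2_const) (auto simp: bnd)
    then obtain K k where K: "\<And>z z'. \<bar>A (x + ?r * z) (x + ?r * z')\<bar> \<le> K * exp (k * (\<bar>z\<bar> + \<bar>z'\<bar>))"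
      unfolding expbd2_def by blast
    have i: "integrable gauss (\<lambda>z. f (x + ?r * z))" if "expbd f" "f \<in> borel_measurable borel" for f
      using expbd_section[OF expbd2_affine[OF that(1), of x 0 ?r], of 0] that(2)
      by (intro integrable_gauss_expbd) simp_all
    note ii = i[OF bnd(1)] i[OF bnd(4)] i[OF bnd(5)]
    have "2 * ((\<integral>z. \<phi> (x + ?r * z) \<partial>gauss) * (\<integral>z. y (x + ?r * z) \<partial>gauss) - (\<integral>z. u (x + ?r * z) \<partial>gauss)\<^sup>2)
        = (\<integral>z. (\<integral>z'. A (x + ?r * z) (x + ?r * z') \<partial>gauss) \<partial>gauss)"
      unfolding A_def using ii by (simp add: power2_eq_square mult.commute)
    also have "\<dots> = (\<integral>z. (\<integral>z'. A (x + ?r * ((z + z') / sqrt 2)) (x + ?r * ((z - z') / sqrt 2)) \<partial>gauss) \<partial>gauss)"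
    proof (rule gauss_rotation[OF _ K])
      show "continuous_on UNIV (\<lambda>p. A (x + ?r * fst p) (x + ?r * snd p))"
        unfolding A_def
        by (intro continuous_intros continuous_on_compose2[OF c\<phi>] continuous_on_compose2[OF cy]
              continuous_on_compose2[OF cu]) auto
    qed
    also have "\<dots> = (\<integral>z. (\<integral>z'. A ((x + s * z) + s * z') ((x + s * z) - s * z') \<partial>gauss) \<partial>gauss)"
    proof -
      have "x + ?r * ((z + z') / sqrt 2) = (x + s * z) + s * z'"
        "x + ?r * ((z - z') / sqrt 2) = (x + s * z) - s * z'" for z z' :: real
        by (simp_all add: field_simps)
      then show ?thesis by (simp only:)
    qed
    also have "\<dots> \<le> (\<integral>z. (\<integral>z'. Uab (x + s * z) (s * z') \<partial>gauss) \<partial>gauss)"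
    proof (rule Bochner_Integration.integral_mono)
      have bA2: "expbd2 (\<lambda>z z'. A ((x + s * z) + s * z') ((x + s * z) - s * z'))"
        unfolding A_def
        using expbd2_affine[of _ x s s] expbd2_affine[of _ x s "- s"]
        by (intro expbd2_diff expbd2_add expbd2_mult expbd2_const) (auto simp: bnd)
      have mA: "(\<lambda>p. A ((x + s * fst p) + s * snd p) ((x + s * fst p) - s * snd p)) \<in> borel_measurable (borel \<Otimes>\<^sub>M borel)"
        unfolding A_def by measurable
      show "integrable gauss (\<lambda>z. \<integral>z'. A ((x + s * z) + s * z') ((x + s * z) - s * z') \<partial>gauss)"
        using mA
        by (intro integrable_gauss_expbd expbd_gauss_integral bA2) (simp_all add: A_def)
      have bx: "expbd (\<lambda>z. D (x + s * z))"
        using expbd_section[OF expbd2_affine[OF bD, of x 0 s], of 0] by simp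
      then show "integrable gauss (\<lambda>z. \<integral>z'. Uab (x + s * z) (s * z') \<partial>gauss)"
        unfolding D_def[symmetric] by (intro integrable_gauss_expbd) simp_all
      fix z
      show "(\<integral>z'. A ((x + s * z) + s * z') ((x + s * z) - s * z') \<partial>gauss) \<le> (\<integral>z'. Uab (x + s * z) (s * z') \<partial>gauss)"
      proof (rule Bochner_Integration.integral_mono)
        show "integrable gauss (\<lambda>z'. A ((x + s * z) + s * z') ((x + s * z) - s * z'))"
          by (intro integrable_gauss_expbd expbd_section[OF bA2]) (simp add: A_def)
        show "integrable gauss (\<lambda>z'. Uab (x + s * z) (s * z'))"
          by (intro integrable_gauss_expbd expbd_section[OF scl[OF bUab]]
              borel_measurable_comp2[OF mUab]) simp_all
      qed (simp add: Uab_def A_le)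
    qed
    finally show ?thesis by (simp add: D_def)
  qed
  \<comment> \<open>The derivative of \<open>Z\<close> is at most that of \<open>H / (2 s)\<close>, by \<open>key\<close>, and both functions vanish at \<open>0\<close>.\<close>
  have "Z R - H R / (2 * s) \<le> Z 0 - H 0 / (2 * s)"
    using R
  proof (rule DERIV_nonpos_imp_nonincreasing)
    fix x
    have "((\<lambda>x. Z x - H x / (2 * s)) has_real_derivative
       (\<integral>z. \<phi> (x + sqrt 2 * s * z) \<partial>gauss) * (\<integral>z. y (x + sqrt 2 * s * z) \<partial>gauss)
          - (\<integral>z. u (x + sqrt 2 * s * z) \<partial>gauss)\<^sup>2 - (1 / 2) * (\<integral>z. D (x + s * z) \<partial>gauss)) (at x)"
      using s by (auto intro!: derivative_eq_intros dZ dH)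
    then show "\<exists>d. ((\<lambda>x. Z x - H x / (2 * s)) has_real_derivative d) (at x) \<and> d \<le> 0"
      using key[of x] by (intro exI conjI) auto
  qed
  moreover have "H R / (2 * s) \<le> 0" using HR s by (simp add: divide_nonpos_pos)
  ultimately show ?thesis using Z0 H0 by simp
qed

section \<open>Smooth families of functions and the heat semigroup\<close>

definition dx :: "(real \<Rightarrow> real \<Rightarrow> real) \<Rightarrow> real \<Rightarrow> real \<Rightarrow> real" where
  "dx f x t = deriv (\<lambda>x. f x t) x"

definition dt :: "(real \<Rightarrow> real \<Rightarrow> real) \<Rightarrow> real \<Rightarrow> real \<Rightarrow> real" where
  "dt f x t = deriv (\<lambda>t. f x t) t"

definition ubd :: "real set \<Rightarrow> (real \<Rightarrow> real \<Rightarrow> real) \<Rightarrow> bool" where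
  "ubd I f \<longleftrightarrow> (\<exists>K k. 0 \<le> K \<and> 0 \<le> k \<and> (\<forall>t\<in>I. \<forall>x. \<bar>f x t\<bar> \<le> K * exp (k * \<bar>x\<bar>)))"

definition has_partials ::
    "(real \<Rightarrow> real \<Rightarrow> real) \<Rightarrow> (real \<Rightarrow> real \<Rightarrow> real) \<Rightarrow> (real \<Rightarrow> real \<Rightarrow> real) \<Rightarrow> real set \<Rightarrow> bool" where
  "has_partials f fx ft I \<longleftrightarrow> (\<forall>x. \<forall>t\<in>I.
     ((\<lambda>p. f (fst p) (snd p)) has_derivative (\<lambda>h. fx x t * fst h + ft x t * snd h)) (at (x, t)))"

text \<open>All partial derivatives up to order \<open>n\<close> exist in the sense of Frechet and are bounded by an exponential
  of \<open>|x|\<close>, uniformly in the parameter. Counting the order explicitly makes the closure properties plain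
  inductions on \<open>n\<close>.\<close>
fun smooth :: "real set \<Rightarrow> nat \<Rightarrow> (real \<Rightarrow> real \<Rightarrow> real) \<Rightarrow> bool" where
  "smooth I 0 f = ubd I f"
| "smooth I (Suc n) f =
     (ubd I f \<and> has_partials f (dx f) (dt f) I \<and> smooth I n (dx f) \<and> smooth I n (dt f))"

definition Smooth :: "real set \<Rightarrow> (real \<Rightarrow> real \<Rightarrow> real) \<Rightarrow> bool" where
  "Smooth I f \<longleftrightarrow> (\<forall>n. smooth I n f)"

lemma ubdE:
  assumes "ubd I f"
  obtains K k where "0 \<le> K" "0 \<le> k" "\<forall>t\<in>I. \<forall>x. \<bar>f x t\<bar> \<le> K * exp (k * \<bar>x\<bar>)"
  using assms unfolding ubd_def by blast

lemma ubd_mono: "ubd I g \<Longrightarrow> (\<And>x t. t \<in> I \<Longrightarrow> \<bar>f x t\<bar> \<le> \<bar>g x t\<bar>) \<Longrightarrow> ubd I f"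
  unfolding ubd_def by (meson order_trans)

lemma ubd_const: "ubd I (\<lambda>x t. c)"
  unfolding ubd_def by (intro exI[of _ "\<bar>c\<bar>"] exI[of _ 0]) auto

lemma ubd_add: assumes "ubd I f" "ubd I g" shows "ubd I (\<lambda>x t. f x t + g x t)"
proof -
  obtain K k where 1: "0 \<le> K" "0 \<le> k" "\<forall>t\<in>I. \<forall>x. \<bar>f x t\<bar> \<le> K * exp (k * \<bar>x\<bar>)"
    using assms(1) by (rule ubdE)
  obtain L l where 2: "0 \<le> L" "0 \<le> l" "\<forall>t\<in>I. \<forall>x. \<bar>g x t\<bar> \<le> L * exp (l * \<bar>x\<bar>)"
    using assms(2) by (rule ubdE)
  have "\<forall>t\<in>I. \<forall>x. \<bar>f x t + g x t\<bar> \<le> (K + L) * exp (max k l * \<bar>x\<bar>)"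
    using 1 2 by (intro ballI allI exp_bound_add) auto
  then show ?thesis unfolding ubd_def
    using 1 2 by (intro exI[of _ "K + L"] exI[of _ "max k l"]) auto
qed

lemma ubd_mult: assumes "ubd I f" "ubd I g" shows "ubd I (\<lambda>x t. f x t * g x t)"
proof -
  obtain K k where 1: "0 \<le> K" "0 \<le> k" "\<forall>t\<in>I. \<forall>x. \<bar>f x t\<bar> \<le> K * exp (k * \<bar>x\<bar>)"
    using assms(1) by (rule ubdE)
  obtain L l where 2: "0 \<le> L" "0 \<le> l" "\<forall>t\<in>I. \<forall>x. \<bar>g x t\<bar> \<le> L * exp (l * \<bar>x\<bar>)"
    using assms(2) by (rule ubdE)
  have "\<forall>t\<in>I. \<forall>x. \<bar>f x t * g x t\<bar> \<le> (K * L) * exp ((k + l) * \<bar>x\<bar>)"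
    using 1 2 by (intro ballI allI exp_bound_mult) auto
  then show ?thesis unfolding ubd_def
    using 1 2 by (intro exI[of _ "K * L"] exI[of _ "k + l"]) auto
qed

lemma has_partials_x:
  assumes "has_partials f fx ft I" "t \<in> I"
  shows "((\<lambda>x. f x t) has_real_derivative fx x t) (at x)"
proof -
  have "((\<lambda>x. (x, t)) has_derivative (\<lambda>h. (h, 0))) (at x)"
    by (auto intro!: derivative_eq_intros)
  moreover have "((\<lambda>p. f (fst p) (snd p)) has_derivative (\<lambda>h. fx x t * fst h + ft x t * snd h)) (at (x, t))"
    using assms by (simp add: has_partials_def)
  ultimately have "((\<lambda>x. (\<lambda>p. f (fst p) (snd p)) (x, t)) has_derivative
      (\<lambda>h. (\<lambda>h. fx x t * fst h + ft x t * snd h) (h, 0))) (at x)"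
    using has_derivative_compose by fast
  then show ?thesis by (simp add: has_field_derivative_def)
qed

lemma has_partials_t:
  assumes "has_partials f fx ft I" "t \<in> I"
  shows "((\<lambda>t. f x t) has_real_derivative ft x t) (at t)"
proof -
  have "((\<lambda>t. (x, t)) has_derivative (\<lambda>h. (0, h))) (at t)"
    by (auto intro!: derivative_eq_intros)
  moreover have "((\<lambda>p. f (fst p) (snd p)) has_derivative (\<lambda>h. fx x t * fst h + ft x t * snd h)) (at (x, t))"
    using assms by (simp add: has_partials_def)
  ultimately have "((\<lambda>t. (\<lambda>p. f (fst p) (snd p)) (x, t)) has_derivative
      (\<lambda>h. (\<lambda>h. fx x t * fst h + ft x t * snd h) (0, h))) (at t)"
    using has_derivative_compose by fast
  then show ?thesis by (simp add: has_field_derivative_def)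
qed

lemma has_partials_dx: "has_partials f fx ft I \<Longrightarrow> t \<in> I \<Longrightarrow> dx f x t = fx x t"
  unfolding dx_def by (rule DERIV_imp_deriv) (rule has_partials_x)

lemma has_partials_dt: "has_partials f fx ft I \<Longrightarrow> t \<in> I \<Longrightarrow> dt f x t = ft x t"
  unfolding dt_def by (rule DERIV_imp_deriv) (rule has_partials_t)

lemma has_partials_cong:
  assumes I: "open I" and eq: "\<And>x t. t \<in> I \<Longrightarrow> f x t = g x t"
    "\<And>x t. t \<in> I \<Longrightarrow> fx x t = gx x t" "\<And>x t. t \<in> I \<Longrightarrow> ft x t = gt x t"
    and "has_partials f fx ft I"
  shows "has_partials g gx gt I"
  unfolding has_partials_def
proof (intro allI ballI)
  fix x t assume t: "t \<in> I"
  have "((\<lambda>p. f (fst p) (snd p)) has_derivative (\<lambda>h. gx x t * fst h + gt x t * snd h)) (at (x, t))"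
    using assms(5) t eq by (simp add: has_partials_def)
  then show "((\<lambda>p. g (fst p) (snd p)) has_derivative (\<lambda>h. gx x t * fst h + gt x t * snd h)) (at (x, t))"
    by (rule has_derivative_transform_within_open[of _ _ _ _ "UNIV \<times> I"])
      (use I t eq in \<open>auto intro: open_Times\<close>)
qed

lemma smooth_ubd: "smooth I n f \<Longrightarrow> ubd I f"
  by (cases n) auto

lemma smooth_SucD: "smooth I (Suc n) f \<Longrightarrow> smooth I n f"
proof (induction n arbitrary: f)
  case (Suc n)
  then show ?case by (metis smooth.simps(2))
qed simp

lemma smooth_cong:
  assumes I: "open I"
  shows "(\<And>x t. t \<in> I \<Longrightarrow> f x t = g x t) \<Longrightarrow> smooth I n f \<Longrightarrow> smooth I n g"
proof (induction n arbitrary: f g)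
  case 0
  then show ?case by (auto intro: ubd_mono)
next
  case (Suc n)
  have hp: "has_partials g (dx f) (dt f) I"
    by (rule has_partials_cong[OF I, where f = f and fx = "dx f" and ft = "dt f"]) (use Suc.prems in auto)
  have eq: "dx f x t = dx g x t" "dt f x t = dt g x t" if "t \<in> I" for x t
    using has_partials_dx[OF hp that] has_partials_dt[OF hp that] by simp_all
  have "has_partials g (dx g) (dt g) I"
    by (rule has_partials_cong[OF I _ _ _ hp]) (use eq in auto)
  moreover have "ubd I g" using Suc.prems by (auto intro: ubd_mono)
  moreover have "smooth I n (dx g)" "smooth I n (dt g)"
    using Suc.IH[of "dx f" "dx g"] Suc.IH[of "dt f" "dt g"] eq Suc.prems(2) by auto
  ultimately show ?case by simp
qed

lemma smooth_SucI:
  assumes I: "open I" and "ubd I f" "has_partials f fx ft I" "smooth I n fx" "smooth I n ft"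
  shows "smooth I (Suc n) f"
proof -
  have eq: "fx x t = dx f x t" "ft x t = dt f x t" if "t \<in> I" for x t
    using has_partials_dx[OF assms(3) that] has_partials_dt[OF assms(3) that] by simp_all
  have "has_partials f (dx f) (dt f) I"
    by (rule has_partials_cong[OF I _ _ _ assms(3)]) (use eq in auto)
  then show ?thesis
    using assms eq smooth_cong[OF I, of fx "dx f" n] smooth_cong[OF I, of ft "dt f" n] by auto
qed

lemma has_partials_const: "has_partials (\<lambda>x t. c) (\<lambda>x t. 0) (\<lambda>x t. 0) I"
  unfolding has_partials_def by simp

lemma has_partials_add:
  "has_partials f fx ft I \<Longrightarrow> has_partials g gx gt I \<Longrightarrow>
   has_partials (\<lambda>x t. f x t + g x t) (\<lambda>x t. fx x t + gx x t) (\<lambda>x t. ft x t + gt x t) I"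
proof -
  assume f: "has_partials f fx ft I" and g: "has_partials g gx gt I"
  show ?thesis
    unfolding has_partials_def
  proof (intro allI ballI)
    fix x t assume t: "t \<in> I"
    have "((\<lambda>p. f (fst p) (snd p)) has_derivative (\<lambda>h. fx x t * fst h + ft x t * snd h)) (at (x, t))"
      "((\<lambda>p. g (fst p) (snd p)) has_derivative (\<lambda>h. gx x t * fst h + gt x t * snd h)) (at (x, t))"
      using f g t by (simp_all add: has_partials_def)
    from has_derivative_add[OF this]
    show "((\<lambda>p. f (fst p) (snd p) + g (fst p) (snd p)) has_derivative
        (\<lambda>h. (fx x t + gx x t) * fst h + (ft x t + gt x t) * snd h)) (at (x, t))"
      by (simp add: algebra_simps)
  qed
qed

lemma has_partials_mult:
  "has_partials f fx ft I \<Longrightarrow> has_partials g gx gt I \<Longrightarrow>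
   has_partials (\<lambda>x t. f x t * g x t) (\<lambda>x t. f x t * gx x t + fx x t * g x t)
     (\<lambda>x t. f x t * gt x t + ft x t * g x t) I"
proof -
  assume f: "has_partials f fx ft I" and g: "has_partials g gx gt I"
  show ?thesis
    unfolding has_partials_def
  proof (intro allI ballI)
    fix x t assume t: "t \<in> I"
    have "((\<lambda>p. f (fst p) (snd p)) has_derivative (\<lambda>h. fx x t * fst h + ft x t * snd h)) (at (x, t))"
      "((\<lambda>p. g (fst p) (snd p)) has_derivative (\<lambda>h. gx x t * fst h + gt x t * snd h)) (at (x, t))"
      using f g t by (simp_all add: has_partials_def)
    from has_derivative_mult[OF this]
    show "((\<lambda>p. f (fst p) (snd p) * g (fst p) (snd p)) has_derivative
        (\<lambda>h. (f x t * gx x t + fx x t * g x t) * fst h + (f x t * gt x t + ft x t * g x t) * snd h)) (at (x, t))"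
      by (simp add: algebra_simps)
  qed
qed

lemma has_partials_comp:
  assumes "has_partials f fx ft I" "\<And>x t. t \<in> I \<Longrightarrow> (h has_real_derivative h' x t) (at (f x t))"
  shows "has_partials (\<lambda>x t. h (f x t)) (\<lambda>x t. h' x t * fx x t) (\<lambda>x t. h' x t * ft x t) I"
  unfolding has_partials_def
proof (intro allI ballI)
  fix x t assume t: "t \<in> I"
  have "(h has_derivative (*) (h' x t)) (at (f (fst (x, t)) (snd (x, t))))"
    using assms(2)[OF t] by (simp add: has_field_derivative_def)
  moreover have "((\<lambda>p. f (fst p) (snd p)) has_derivative (\<lambda>h. fx x t * fst h + ft x t * snd h)) (at (x, t))"
    using assms(1) t by (simp add: has_partials_def)
  ultimately have "((\<lambda>p. h (f (fst p) (snd p))) has_derivative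
      (\<lambda>k. h' x t * (fx x t * fst k + ft x t * snd k))) (at (x, t))"
    by (rule has_derivative_compose[rotated])
  then show "((\<lambda>p. h (f (fst p) (snd p))) has_derivative
      (\<lambda>k. h' x t * fx x t * fst k + h' x t * ft x t * snd k)) (at (x, t))"
    by (simp add: algebra_simps)
qed

lemma smooth_const: "open I \<Longrightarrow> smooth I n (\<lambda>x t. c)"
proof (induction n arbitrary: c)
  case (Suc n)
  show ?case
    by (rule smooth_SucI[OF _ ubd_const has_partials_const]) (use Suc in auto)
qed (simp add: ubd_const)

lemma smooth_add: "open I \<Longrightarrow> smooth I n f \<Longrightarrow> smooth I n g \<Longrightarrow> smooth I n (\<lambda>x t. f x t + g x t)"
proof (induction n arbitrary: f g)
  case (Suc n)
  then show ?case
    by (intro smooth_SucI[OF _ ubd_add has_partials_add[where fx = "dx f" and ft = "dt f" and gx = "dx g" and gt = "dt g"]]) auto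
qed (simp add: ubd_add)

lemma smooth_mult: "open I \<Longrightarrow> smooth I n f \<Longrightarrow> smooth I n g \<Longrightarrow> smooth I n (\<lambda>x t. f x t * g x t)"
proof (induction n arbitrary: f g)
  case (Suc n)
  have "smooth I n f" "smooth I n g" using Suc.prems smooth_SucD by blast+
  then show ?case using Suc
    by (intro smooth_SucI[OF _ ubd_mult has_partials_mult[where fx = "dx f" and ft = "dt f" and gx = "dx g" and gt = "dt g"]])
      (auto intro!: smooth_add)
qed (simp add: ubd_mult)

lemma smooth_exp:
  "open I \<Longrightarrow> smooth I n f \<Longrightarrow> ubd I (\<lambda>x t. exp (f x t)) \<Longrightarrow> smooth I n (\<lambda>x t. exp (f x t))"
proof (induction n)
  case (Suc n)
  then have *: "smooth I n (\<lambda>x t. exp (f x t))" using smooth_SucD by blast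
  have "has_partials (\<lambda>x t. exp (f x t)) (\<lambda>x t. exp (f x t) * dx f x t) (\<lambda>x t. exp (f x t) * dt f x t) I"
    using Suc.prems by (intro has_partials_comp) auto
  then show ?case
    by (rule smooth_SucI[OF Suc.prems(1,3)]) (use * Suc.prems in \<open>auto intro!: smooth_mult\<close>)
qed simp

lemma smooth_inverse:
  "open I \<Longrightarrow> smooth I n f \<Longrightarrow> (\<And>x t. t \<in> I \<Longrightarrow> 1 \<le> f x t) \<Longrightarrow> smooth I n (\<lambda>x t. inverse (f x t))"
proof (induction n)
  case 0
  have "ubd I (\<lambda>x t. inverse (f x t))"
    by (rule ubd_mono[OF ubd_const[of I 1]]) (use 0(3) in \<open>simp add: inverse_le_1_iff abs_of_pos less_le_trans[OF zero_less_one]\<close>)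
  then show ?case by simp
next
  case (Suc n)
  then have *: "smooth I n (\<lambda>x t. inverse (f x t))" using smooth_SucD by blast
  have nz: "f x t \<noteq> 0" if "t \<in> I" for x t using Suc.prems(3)[OF that, of x] by auto
  have "has_partials (\<lambda>x t. inverse (f x t))
     (\<lambda>x t. - (inverse (f x t) * inverse (f x t)) * dx f x t)
     (\<lambda>x t. - (inverse (f x t) * inverse (f x t)) * dt f x t) I"
    using Suc.prems nz
    by (intro has_partials_comp) (auto intro!: derivative_eq_intros simp: power2_eq_square)
  then have hp: "has_partials (\<lambda>x t. inverse (f x t))
     (\<lambda>x t. (- 1) * ((inverse (f x t) * inverse (f x t)) * dx f x t))
     (\<lambda>x t. (- 1) * ((inverse (f x t) * inverse (f x t)) * dt f x t)) I"
    by simp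
  have "ubd I (\<lambda>x t. inverse (f x t))" using * by (rule smooth_ubd)
  with hp * Suc.prems show ?case
    by (intro smooth_SucI[OF _ _ hp] smooth_mult smooth_const) auto
qed

lemma Smooth_const: "open I \<Longrightarrow> Smooth I (\<lambda>x t. c)"
  and Smooth_add: "open I \<Longrightarrow> Smooth I f \<Longrightarrow> Smooth I g \<Longrightarrow> Smooth I (\<lambda>x t. f x t + g x t)"
  and Smooth_mult: "open I \<Longrightarrow> Smooth I f \<Longrightarrow> Smooth I g \<Longrightarrow> Smooth I (\<lambda>x t. f x t * g x t)"
  and Smooth_exp: "open I \<Longrightarrow> Smooth I f \<Longrightarrow> ubd I (\<lambda>x t. exp (f x t)) \<Longrightarrow> Smooth I (\<lambda>x t. exp (f x t))"
  and Smooth_inverse: "open I \<Longrightarrow> Smooth I f \<Longrightarrow> (\<And>x t. t \<in> I \<Longrightarrow> 1 \<le> f x t) \<Longrightarrow> Smooth I (\<lambda>x t. inverse (f x t))"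
  unfolding Smooth_def by (simp_all add: smooth_const smooth_add smooth_mult smooth_exp smooth_inverse)

lemma Smooth_dx: "Smooth I f \<Longrightarrow> Smooth I (dx f)"
  and Smooth_dt: "Smooth I f \<Longrightarrow> Smooth I (dt f)"
  and Smooth_partials: "Smooth I f \<Longrightarrow> has_partials f (dx f) (dt f) I"
  and Smooth_ubd: "Smooth I f \<Longrightarrow> ubd I f"
  unfolding Smooth_def using smooth.simps(2)[of I] smooth_ubd by blast+

lemma Smooth_DERIV_x: "Smooth I f \<Longrightarrow> t \<in> I \<Longrightarrow> ((\<lambda>x. f x t) has_real_derivative dx f x t) (at x)"
  by (rule has_partials_x[OF Smooth_partials])

lemma Smooth_DERIV_t: "Smooth I f \<Longrightarrow> t \<in> I \<Longrightarrow> ((\<lambda>t. f x t) has_real_derivative dt f x t) (at t)"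
  by (rule has_partials_t[OF Smooth_partials])

lemma Smooth_continuous: "Smooth I f \<Longrightarrow> t \<in> I \<Longrightarrow> continuous_on UNIV (\<lambda>x. f x t)"
  by (rule continuous_at_imp_continuous_on) (blast intro: DERIV_isCont Smooth_DERIV_x)

lemma Smooth_expbd: "Smooth I f \<Longrightarrow> t \<in> I \<Longrightarrow> expbd (\<lambda>x. f x t)"
  using Smooth_ubd[of I f] unfolding ubd_def expbd_def by blast

lemma SmoothI:
  assumes "open I" "ubd I f" "has_partials f fx ft I" "Smooth I fx" "Smooth I ft"
  shows "Smooth I f"
  unfolding Smooth_def
proof
  fix n show "smooth I n f"
    using assms smooth_SucI[OF assms(1-3)] by (cases n) (auto simp: Smooth_def simp del: smooth.simps(2))
qed

lemma Smooth_isCont: "Smooth I f \<Longrightarrow> t \<in> I \<Longrightarrow> isCont (\<lambda>p. f (fst p) (snd p)) (x, t)"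
  using Smooth_partials[of I f] unfolding has_partials_def by (meson has_derivative_continuous)

text \<open>The second difference over a square of side \<open>h\<close> is \<open>h\<^sup>2\<close> times a value of either mixed derivative
  inside the square, by two applications of the mean value theorem. If the two derivatives differed at
  \<open>(x, t)\<close>, continuity would contradict this for small \<open>h\<close>.\<close>
lemma mixed_partials:
  assumes I: "open I" and f: "Smooth I f" and t: "t \<in> I"
  shows "dx (dt f) x t = dt (dx f) x t"
proof (rule ccontr)
  assume ne: "dx (dt f) x t \<noteq> dt (dx f) x t"
  define e where "e = \<bar>dx (dt f) x t - dt (dx f) x t\<bar> / 2"
  have e: "0 < e" using ne by (simp add: e_def)
  obtain r where r: "0 < r" "ball t r \<subseteq> I" using I t open_contains_ball by blast
  have cont: "\<exists>d>0. \<forall>p. dist p (x, t) < d \<longrightarrow> dist (g (fst p) (snd p)) (g x t) < e" if "Smooth I g" for g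
    using Smooth_isCont[OF that t, of x] e unfolding continuous_at_eps_delta by fastforce
  obtain d1 where d1: "0 < d1" "\<And>p. dist p (x, t) < d1 \<Longrightarrow> dist (dx (dt f) (fst p) (snd p)) (dx (dt f) x t) < e"
    using cont[OF Smooth_dx[OF Smooth_dt[OF f]]] by blast
  obtain d2 where d2: "0 < d2" "\<And>p. dist p (x, t) < d2 \<Longrightarrow> dist (dt (dx f) (fst p) (snd p)) (dt (dx f) x t) < e"
    using cont[OF Smooth_dt[OF Smooth_dx[OF f]]] by blast
  define h where "h = min r (min d1 d2) / 3"
  have h: "0 < h" "h < r" "2 * h < d1" "2 * h < d2" using r d1 d2 by (auto simp: h_def)
  have inI: "s \<in> I" if "t \<le> s" "s \<le> t + h" for s
    using that h r(2) by (auto simp: subset_iff dist_real_def)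
  have near: "dist (a, s) (x, t) < d1" "dist (a, s) (x, t) < d2"
    if "x < a" "a < x + h" "t < s" "s < t + h" for a s
  proof -
    have "dist (a, s) (x, t) \<le> dist a x + dist s t"
      unfolding dist_prod_def by (simp add: sqrt_sum_squares_le_sum)
    also have "\<dots> < 2 * h" using that by (simp add: dist_real_def)
    finally show "dist (a, s) (x, t) < d1" "dist (a, s) (x, t) < d2" using h by auto
  qed
  define Q where "Q = f (x + h) (t + h) - f (x + h) t - f x (t + h) + f x t"
  have "\<exists>s>t. s < t + h \<and> (f (x + h) (t + h) - f x (t + h)) - (f (x + h) t - f x t)
      = (t + h - t) * (dt f (x + h) s - dt f x s)"
    by (rule MVT2) (use h inI in \<open>auto intro!: DERIV_diff Smooth_DERIV_t[OF f]\<close>)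
  then obtain s where s: "t < s" "s < t + h" "Q = h * (dt f (x + h) s - dt f x s)"
    by (auto simp: Q_def algebra_simps)
  have "\<exists>a>x. a < x + h \<and> dt f (x + h) s - dt f x s = (x + h - x) * dx (dt f) a s"
    by (rule MVT2) (use h s inI in \<open>auto intro!: Smooth_DERIV_x[OF Smooth_dt[OF f]]\<close>)
  then obtain a where a: "x < a" "a < x + h" "Q = h * (h * dx (dt f) a s)"
    using s by auto
  have "\<exists>b>x. b < x + h \<and> (f (x + h) (t + h) - f (x + h) t) - (f x (t + h) - f x t)
      = (x + h - x) * (dx f b (t + h) - dx f b t)"
    by (rule MVT2) (use h inI in \<open>auto intro!: DERIV_diff Smooth_DERIV_x[OF f]\<close>)
  then obtain b where b: "x < b" "b < x + h" "Q = h * (dx f b (t + h) - dx f b t)"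
    by (auto simp: Q_def algebra_simps)
  have "\<exists>s>t. s < t + h \<and> dx f b (t + h) - dx f b t = (t + h - t) * dt (dx f) b s"
    by (rule MVT2) (use h inI in \<open>auto intro!: Smooth_DERIV_t[OF Smooth_dx[OF f]]\<close>)
  then obtain s' where s': "t < s'" "s' < t + h" "Q = h * (h * dt (dx f) b s')"
    using b by auto
  have "dx (dt f) a s = dt (dx f) b s'" using a(3) s'(3) h by simp
  moreover have "dist (dx (dt f) a s) (dx (dt f) x t) < e"
    using d1(2)[OF near(1)[OF a(1,2) s(1,2)]] by simp
  moreover have "dist (dt (dx f) b s') (dt (dx f) x t) < e"
    using d2(2)[OF near(2)[OF b(1,2) s'(1,2)]] by simp
  moreover have "\<bar>X - Y\<bar> \<le> \<bar>A - X\<bar> + \<bar>A - Y\<bar>" for A X Y :: real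
    by linarith
  note this[of "dx (dt f) x t" "dt (dx f) x t" "dx (dt f) a s"]
  ultimately show False unfolding dist_real_def e_def by simp
qed

text \<open>The heat semigroup with generator \<open>\<partial>\<^sub>x\<^sup>2\<close>, run for the time \<open>d t\<close>, which itself depends on the parameter.\<close>
definition heat :: "(real \<Rightarrow> real) \<Rightarrow> (real \<Rightarrow> real \<Rightarrow> real) \<Rightarrow> real \<Rightarrow> real \<Rightarrow> real" where
  "heat d f x t = (\<integral>z. f (x + sqrt (2 * d t) * z) t \<partial>gauss)"


lemma heat_ubd:
  assumes f: "Smooth I f" and d: "\<And>t. t \<in> I \<Longrightarrow> 0 < d t" "\<And>t. t \<in> I \<Longrightarrow> d t \<le> D"
  shows "ubd I (heat d f)"
proof -
  obtain K k where *: "0 \<le> K" "0 \<le> k" "\<forall>t\<in>I. \<forall>x. \<bar>f x t\<bar> \<le> K * exp (k * \<bar>x\<bar>)"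
    using Smooth_ubd[OF f] by (rule ubdE)
  define E where "E = (\<integral>z. exp (k * sqrt (2 * D) * \<bar>z\<bar>) \<partial>gauss)"
  have "\<bar>heat d f x t\<bar> \<le> (K * E) * exp (k * \<bar>x\<bar>)" if t: "t \<in> I" for x t
  proof -
    have le: "\<bar>f (x + sqrt (2 * d t) * z) t\<bar> \<le> K * exp (k * \<bar>x\<bar>) * exp (k * sqrt (2 * D) * \<bar>z\<bar>)" for z
    proof -
      have "sqrt (2 * d t) * \<bar>z\<bar> \<le> sqrt (2 * D) * \<bar>z\<bar>"
        using d[OF t] by (intro mult_right_mono) auto
      then have "\<bar>x + sqrt (2 * d t) * z\<bar> \<le> \<bar>x\<bar> + sqrt (2 * D) * \<bar>z\<bar>"
        using abs_triangle_ineq[of x "sqrt (2 * d t) * z"] d(1)[OF t] by (simp add: abs_mult)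
      then have "k * \<bar>x + sqrt (2 * d t) * z\<bar> \<le> k * \<bar>x\<bar> + k * sqrt (2 * D) * \<bar>z\<bar>"
        using mult_left_mono[OF _ *(2)] by (fastforce simp: algebra_simps)
      then have "K * exp (k * \<bar>x + sqrt (2 * d t) * z\<bar>) \<le> K * exp (k * \<bar>x\<bar> + k * sqrt (2 * D) * \<bar>z\<bar>)"
        using *(1) by (intro mult_left_mono) auto
      then show ?thesis
        using *(3) t by (simp add: exp_add mult.assoc) (meson order_trans)
    qed
    have [measurable]: "(\<lambda>x. f x t) \<in> borel_measurable borel"
      by (intro borel_measurable_continuous_onI Smooth_continuous[OF f t])
    have "norm (heat d f x t) \<le> (\<integral>z. K * exp (k * \<bar>x\<bar>) * exp (k * sqrt (2 * D) * \<bar>z\<bar>) \<partial>gauss)"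
      unfolding heat_def
    proof (rule Bochner_Integration.integral_norm_bound_integral)
      show "integrable gauss (\<lambda>z. f (x + sqrt (2 * d t) * z) t)"
        by (rule integrable_gauss_bound[OF _ le]) measurable
    qed (use le integrable_gauss_exp_abs in simp_all)
    then show ?thesis by (simp add: E_def mult_ac)
  qed
  moreover have "0 \<le> E" unfolding E_def by (intro Bochner_Integration.integral_nonneg) simp
  ultimately show ?thesis unfolding ubd_def using *
    by (intro exI[of _ "K * E"] exI[of _ k]) auto
qed

text \<open>Differentiating \<open>sqrt (2 * d t) * z\<close> in \<open>t\<close> produces the factor \<open>b z / sqrt (2 * d t)\<close>; Gaussian
  integration by parts trades it for \<open>b\<close> times a second space derivative. So a change of \<open>t\<close> acts through
  the operator \<open>\<partial>\<^sub>t + b \<partial>\<^sub>x\<^sup>2\<close> before averaging.\<close>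
lemma has_partials_heat:
  assumes I: "open I" and f: "Smooth I f"
    and d: "\<And>t. d t = a + b * t" "\<And>t. t \<in> I \<Longrightarrow> 0 < d t" "\<And>t. t \<in> I \<Longrightarrow> d t \<le> D"
  shows "has_partials (heat d f) (heat d (dx f)) (heat d (\<lambda>x t. dt f x t + b * dx (dx f) x t)) I"
  unfolding has_partials_def
proof (intro allI ballI)
  fix x0 t0 :: real assume t0: "t0 \<in> I"
  note f' = Smooth_dx[OF f] Smooth_dt[OF f] Smooth_dx[OF Smooth_dx[OF f]]
  obtain K k where K: "0 \<le> K" "0 \<le> k" "\<forall>t\<in>I. \<forall>x. \<bar>dx f x t\<bar> \<le> K * exp (k * \<bar>x\<bar>)"
    using Smooth_ubd[OF f'(1)] by (rule ubdE)
  obtain L l where L: "0 \<le> L" "0 \<le> l" "\<forall>t\<in>I. \<forall>x. \<bar>dt f x t\<bar> \<le> L * exp (l * \<bar>x\<bar>)"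
    using Smooth_ubd[OF f'(2)] by (rule ubdE)
  \<comment> \<open>Near \<open>t0\<close> the heat time stays above \<open>d0\<close>, which keeps the derivative of the square root bounded.\<close>
  define d0 where "d0 = d t0 / 2"
  have d0: "0 < d0" using d(2)[OF t0] by (simp add: d0_def)
  have "open (I \<inter> {t. d0 < d t})"
    unfolding d(1) using I by (intro open_Int open_Collect_less continuous_intros)
  moreover have "t0 \<in> I \<inter> {t. d0 < d t}" using t0 d0 by (simp add: d0_def)
  ultimately obtain e0 where e0: "0 < e0" "ball t0 e0 \<subseteq> I \<inter> {t. d0 < d t}"
    using open_contains_ball by blast
  define e where "e = min e0 1"
  have e: "0 < e" "e \<le> 1" using e0 by (auto simp: e_def)
  have nbh: "snd p \<in> I" "d0 < d (snd p)" "\<bar>fst p\<bar> \<le> \<bar>x0\<bar> + 1" if "p \<in> ball (x0, t0) e" for p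
  proof -
    have "dist t0 (snd p) < e" "dist x0 (fst p) < e"
      using that dist_snd_le[of "(x0, t0)" p] dist_fst_le[of "(x0, t0)" p] by auto
    then show "snd p \<in> I" "d0 < d (snd p)" "\<bar>fst p\<bar> \<le> \<bar>x0\<bar> + 1"
      using e0(2) e unfolding e_def dist_real_def by (auto simp: subset_iff dist_real_def)
  qed
  define r where "r t = sqrt (2 * d t)" for t
  define R where "R = sqrt (2 * D)"
  have rR: "r t \<le> R" if "t \<in> I" for t using d(3)[OF that] by (simp add: r_def R_def)
  have dr: "(r has_real_derivative b / r t) (at t)" if "0 < d t" for t
    unfolding r_def[abs_def] using that unfolding d(1)
    by (auto intro!: derivative_eq_intros simp: field_simps)
  define h where "h p z = f (fst p + r (snd p) * z) (snd p)" for p z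
  define X where "X p z = fst p + r (snd p) * z" for p z
  define h' where "h' p z v = dx f (X p z) (snd p) * (fst v + b / r (snd p) * snd v * z) + dt f (X p z) (snd p) * snd v"
    for p z and v :: "real \<times> real"
  have R0: "0 \<le> R" using d(2,3)[OF t0] by (simp add: R_def)
  define q where "q = sqrt d0"
  have q: "0 < q" "\<And>t. d0 < d t \<Longrightarrow> q \<le> r t" using d0 by (auto simp: q_def r_def)
  define B where "B z = K * exp (k * (\<bar>x0\<bar> + 1) + k * R * \<bar>z\<bar>) * (1 + \<bar>b\<bar> / q * \<bar>z\<bar>)
     + L * exp (l * (\<bar>x0\<bar> + 1) + l * R * \<bar>z\<bar>)" for z
  have Xb: "\<bar>X p z\<bar> \<le> \<bar>x0\<bar> + 1 + R * \<bar>z\<bar>" if "p \<in> ball (x0, t0) e" for p z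
  proof -
    have "\<bar>X p z\<bar> \<le> \<bar>fst p\<bar> + r (snd p) * \<bar>z\<bar>"
      unfolding X_def using abs_triangle_ineq[of "fst p" "r (snd p) * z"] nbh[OF that] d0
      by (simp add: abs_mult r_def)
    moreover have "r (snd p) * \<bar>z\<bar> \<le> R * \<bar>z\<bar>" using rR nbh[OF that] by (intro mult_right_mono) auto
    ultimately show ?thesis using nbh(3)[OF that] by linarith
  qed
  have gb: "\<bar>g (X p z) (snd p)\<bar> \<le> C * exp (c * (\<bar>x0\<bar> + 1) + c * R * \<bar>z\<bar>)"
    if "p \<in> ball (x0, t0) e" "0 \<le> C" "0 \<le> c" "\<forall>t\<in>I. \<forall>x. \<bar>g x t\<bar> \<le> C * exp (c * \<bar>x\<bar>)" for g p z C c
  proof -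
    have "c * \<bar>X p z\<bar> \<le> c * (\<bar>x0\<bar> + 1) + c * R * \<bar>z\<bar>"
      using mult_left_mono[OF Xb[OF that(1), of z] that(3)] by (simp add: algebra_simps)
    then have "C * exp (c * \<bar>X p z\<bar>) \<le> C * exp (c * (\<bar>x0\<bar> + 1) + c * R * \<bar>z\<bar>)"
      using that by (intro mult_left_mono) auto
    then show ?thesis using that(4) nbh(1)[OF that(1)] by (meson order_trans)
  qed
  have meas: "(\<lambda>z. g (X p z) (snd p)) \<in> borel_measurable borel" if "Smooth I g" "snd p \<in> I" for g p
  proof -
    have [measurable]: "(\<lambda>x. g x (snd p)) \<in> borel_measurable borel"
      by (intro borel_measurable_continuous_onI Smooth_continuous[OF that])
    show ?thesis unfolding X_def by measurable
  qed
  have p0: "(x0, t0) \<in> ball (x0, t0) e" using e by simp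
  have "((\<lambda>p. \<integral>z. h p z \<partial>gauss) has_derivative (\<lambda>v. \<integral>z. h' (x0, t0) z v \<partial>gauss)) (at (x0, t0))"
  proof (rule has_derivative_gauss_integral[OF e(1)])
    fix p z assume p: "p \<in> ball (x0, t0) e"
    have dp: "0 < d (snd p)" using nbh[OF p] d0 by simp
    have "((\<lambda>p. r (snd p)) has_derivative (\<lambda>v. b / r (snd p) * snd v)) (at p)"
      using has_derivative_compose[OF has_derivative_snd[OF has_derivative_ident] dr[OF dp, unfolded has_field_derivative_def]]
      by simp
    then have "((\<lambda>p. (X p z, snd p)) has_derivative (\<lambda>v. (fst v + b / r (snd p) * snd v * z, snd v))) (at p)"
      unfolding X_def by (auto intro!: derivative_eq_intros)
    moreover have "((\<lambda>p. f (fst p) (snd p)) has_derivative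
        (\<lambda>v. dx f (X p z) (snd p) * fst v + dt f (X p z) (snd p) * snd v)) (at (X p z, snd p))"
      using Smooth_partials[OF f] nbh(1)[OF p] by (simp add: has_partials_def)
    ultimately have "((\<lambda>p. (\<lambda>p. f (fst p) (snd p)) (X p z, snd p)) has_derivative
       (\<lambda>v. (\<lambda>v. dx f (X p z) (snd p) * fst v + dt f (X p z) (snd p) * snd v)
          (fst v + b / r (snd p) * snd v * z, snd v))) (at p)"
      using has_derivative_compose by fast
    then show "((\<lambda>p. h p z) has_derivative h' p z) (at p)"
      by (simp add: h_def[abs_def] X_def[symmetric] h'_def[abs_def])
  next
    fix p assume "p \<in> ball (x0, t0) e"
    then show "h p \<in> borel_measurable borel"
      unfolding h_def[abs_def] X_def[symmetric] by (intro meas f nbh)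
  next
    show "(\<lambda>z. h' (x0, t0) z v) \<in> borel_measurable borel" for v
      unfolding h'_def using meas[OF f'(1), of "(x0, t0)"] meas[OF f'(2), of "(x0, t0)"] t0 by simp
  next
    have "expbd (\<lambda>z. f (x0 + r t0 * z) t0)"
      using expbd_section[OF expbd2_affine[OF Smooth_expbd[OF f t0], of x0 0 "r t0"], of 0] by simp
    then show "integrable gauss (h (x0, t0))"
      using meas[OF f, of "(x0, t0)"] t0
      by (intro integrable_gauss_expbd) (simp_all add: h_def[abs_def] X_def)
  next
    fix p z and v :: "real \<times> real" assume p: "p \<in> ball (x0, t0) e"
    have v: "\<bar>fst v\<bar> \<le> norm v" "\<bar>snd v\<bar> \<le> norm v"
      using dist_fst_le[of v 0] dist_snd_le[of v 0] by (simp_all add: dist_norm)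
    have "\<bar>b / r (snd p) * snd v * z\<bar> \<le> \<bar>b\<bar> / q * norm v * \<bar>z\<bar>"
    proof -
      have "\<bar>b / r (snd p)\<bar> \<le> \<bar>b\<bar> / q"
      proof -
        have "q \<le> r (snd p)" using q(2) nbh[OF p] by blast
        then show ?thesis using q(1) by (simp add: abs_divide divide_left_mono)
      qed
      then show ?thesis unfolding abs_mult
        using v q by (intro mult_mono) auto
    qed
    then have "\<bar>fst v + b / r (snd p) * snd v * z\<bar> \<le> (1 + \<bar>b\<bar> / q * \<bar>z\<bar>) * norm v"
      using v(1) abs_triangle_ineq[of "fst v" "b / r (snd p) * snd v * z"]
      unfolding distrib_right by (simp only: mult_1 mult.commute mult.left_commute mult.assoc)
    then have "\<bar>dx f (X p z) (snd p) * (fst v + b / r (snd p) * snd v * z)\<bar>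
       \<le> (K * exp (k * (\<bar>x0\<bar> + 1) + k * R * \<bar>z\<bar>)) * ((1 + \<bar>b\<bar> / q * \<bar>z\<bar>) * norm v)"
      unfolding abs_mult using K by (intro mult_mono gb[OF p]) auto
    moreover have "\<bar>dt f (X p z) (snd p) * snd v\<bar> \<le> (L * exp (l * (\<bar>x0\<bar> + 1) + l * R * \<bar>z\<bar>)) * norm v"
      unfolding abs_mult using L v by (intro mult_mono gb[OF p]) auto
    ultimately show "\<bar>h' p z v\<bar> \<le> B z * norm v"
    proof -
      have eq: "B z * norm v = (K * exp (k * (\<bar>x0\<bar> + 1) + k * R * \<bar>z\<bar>)) * ((1 + \<bar>b\<bar> / q * \<bar>z\<bar>) * norm v)
          + (L * exp (l * (\<bar>x0\<bar> + 1) + l * R * \<bar>z\<bar>)) * norm v"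
        unfolding B_def by (rule trans[OF distrib_right]) (simp only: mult.assoc)
      assume "\<bar>dx f (X p z) (snd p) * (fst v + b / r (snd p) * snd v * z)\<bar>
         \<le> (K * exp (k * (\<bar>x0\<bar> + 1) + k * R * \<bar>z\<bar>)) * ((1 + \<bar>b\<bar> / q * \<bar>z\<bar>) * norm v)"
        "\<bar>dt f (X p z) (snd p) * snd v\<bar> \<le> (L * exp (l * (\<bar>x0\<bar> + 1) + l * R * \<bar>z\<bar>)) * norm v"
      then show ?thesis
        unfolding h'_def eq by (rule order_trans[OF abs_triangle_ineq add_mono])
    qed
  next
    have ex: "expbd (\<lambda>z. exp (c + c' * \<bar>z\<bar>))" if "0 \<le> c'" for c c'
      unfolding expbd_def using that by (intro exI[of _ "exp c"] exI[of _ c']) (auto simp: exp_add)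
    have ab: "expbd (\<lambda>z. \<bar>z\<bar>)" by (rule expbd_mono[OF expbd_ident]) simp
    have "expbd B" unfolding B_def
      using K L R0 by (intro expbd_add expbd_mult expbd_const ex ab) auto
    then show "integrable gauss B"
      by (rule integrable_gauss_expbd[rotated]) (simp add: B_def[abs_def])
  qed
  moreover have "(\<lambda>v. \<integral>z. h' (x0, t0) z v \<partial>gauss) =
      (\<lambda>v. heat d (dx f) x0 t0 * fst v + heat d (\<lambda>x t. dt f x t + b * dx (dx f) x t) x0 t0 * snd v)"
  proof
    fix v :: "real \<times> real"
    let ?X = "\<lambda>z. x0 + r t0 * z"
    have r0: "0 < r t0" using d(2)[OF t0] by (simp add: r_def)
    have m: "(\<lambda>z. g (?X z) t0) \<in> borel_measurable borel" if "Smooth I g" for g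
      using meas[OF that, of "(x0, t0)"] t0 by (simp add: X_def)
    have eb: "expbd (\<lambda>z. g (?X z) t0)" if "Smooth I g" for g
      using expbd_section[OF expbd2_affine[OF Smooth_expbd[OF that t0], of x0 0 "r t0"], of 0] by simp
    have i: "integrable gauss (\<lambda>z. g (?X z) t0)" if "Smooth I g" for g
      by (rule integrable_gauss_expbd[OF m[OF that] eb[OF that]])
    have iz: "integrable gauss (\<lambda>z. dx f (?X z) t0 * z)"
      by (rule integrable_gauss_expbd[OF borel_measurable_times[OF m[OF f'(1)]] expbd_mult[OF eb[OF f'(1)] expbd_ident]]) simp
    have stein: "(\<integral>z. dx f (?X z) t0 * z \<partial>gauss) = (\<integral>z. r t0 * dx (dx f) (?X z) t0 \<partial>gauss)"
    proof (rule gaussian_integration_by_parts_expbd)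
      show "((\<lambda>z. dx f (?X z) t0) has_real_derivative r t0 * dx (dx f) (?X z) t0) (at z)" for z
        by (rule DERIV_cong[OF DERIV_chain2[OF Smooth_DERIV_x[OF f'(1) t0]]])
          (auto intro!: derivative_eq_intros)
      show "continuous_on UNIV (\<lambda>z. r t0 * dx (dx f) (?X z) t0)"
        by (intro continuous_intros continuous_on_compose2[OF Smooth_continuous[OF f'(3) t0]]) auto
    qed (intro expbd_mult expbd_const eb f')+
    have "(\<integral>z. h' (x0, t0) z v \<partial>gauss) = (\<integral>z. fst v * dx f (?X z) t0 + (b / r t0 * snd v) * (dx f (?X z) t0 * z)
        + snd v * dt f (?X z) t0 \<partial>gauss)"
      by (intro Bochner_Integration.integral_cong refl) (simp add: h'_def X_def algebra_simps)
    also have "\<dots> = fst v * (\<integral>z. dx f (?X z) t0 \<partial>gauss) + (b / r t0 * snd v) * (\<integral>z. dx f (?X z) t0 * z \<partial>gauss)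
        + snd v * (\<integral>z. dt f (?X z) t0 \<partial>gauss)"
      using i[OF f'(1)] i[OF f'(2)] iz by simp
    also have "\<dots> = (\<integral>z. dx f (?X z) t0 \<partial>gauss) * fst v
        + ((\<integral>z. dt f (?X z) t0 \<partial>gauss) + b * (\<integral>z. dx (dx f) (?X z) t0 \<partial>gauss)) * snd v"
      unfolding stein using r0 by (simp add: field_simps)
    also have "\<dots> = heat d (dx f) x0 t0 * fst v + heat d (\<lambda>x t. dt f x t + b * dx (dx f) x t) x0 t0 * snd v"
      using i[OF f'(2)] i[OF f'(3)] by (simp add: heat_def r_def)
    finally show "(\<integral>z. h' (x0, t0) z v \<partial>gauss) = \<dots>" .
  qed
  ultimately show "((\<lambda>p. heat d f (fst p) (snd p)) has_derivative
     (\<lambda>v. heat d (dx f) x0 t0 * fst v + heat d (\<lambda>x t. dt f x t + b * dx (dx f) x t) x0 t0 * snd v)) (at (x0, t0))"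
    by (simp add: heat_def[abs_def] h_def r_def)
qed

lemma Smooth_heat:
  assumes I: "open I" and f: "Smooth I f"
    and d: "\<And>t. d t = a + b * t" "\<And>t. t \<in> I \<Longrightarrow> 0 < d t" "\<And>t. t \<in> I \<Longrightarrow> d t \<le> D"
  shows "Smooth I (heat d f)"
proof -
  have "smooth I n (heat d f)" if "Smooth I f" for n f
    using that
  proof (induction n arbitrary: f)
    case 0
    then show ?case using heat_ubd[OF 0 d(2,3)] by simp
  next
    case (Suc n)
    have "Smooth I (\<lambda>x t. dt f x t + b * dx (dx f) x t)"
      using Suc.prems I by (intro Smooth_add Smooth_mult Smooth_const Smooth_dt Smooth_dx) auto
    with Suc show ?case
      by (intro smooth_SucI[OF I heat_ubd[OF Suc.prems d(2,3)] has_partials_heat[OF I Suc.prems d]])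
        (auto intro: Smooth_dx)
  qed
  with f show ?thesis by (simp add: Smooth_def)
qed

section \<open>Propagation of integrated concavity by the heat semigroup\<close>

lemma dx_eq: "(\<And>x. f x t = g x t) \<Longrightarrow> dx f x t = dx g x t"
  unfolding dx_def by simp

lemma dt_eq:
  assumes "open I" "t \<in> I" "\<And>s. s \<in> I \<Longrightarrow> f x s = g y s"
  shows "dt f x t = dt g y t"
  unfolding dt_def
proof (rule deriv_cong_ev)
  show "eventually (\<lambda>s. f x s = g y s) (nhds t)"
    using eventually_nhds_in_open[OF assms(1,2)] by eventually_elim (rule assms(3))
qed simp

lemma dxI: "((\<lambda>x. f x t) has_real_derivative D) (at x) \<Longrightarrow> dx f x t = D"
  unfolding dx_def by (rule DERIV_imp_deriv)

lemma dtI: "((\<lambda>t. f x t) has_real_derivative D) (at t) \<Longrightarrow> dt f x t = D"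
  unfolding dt_def by (rule DERIV_imp_deriv)

lemma dt_even:
  assumes "open I" "t \<in> I" "\<And>x s. s \<in> I \<Longrightarrow> f (- x) s = f x s"
  shows "dt f (- x) t = dt f x t"
  by (rule dt_eq[OF assms(1,2)]) (use assms(3) in auto)

lemma dx_odd:
  assumes "Smooth I f" "t \<in> I" "\<And>x. f (- x) t = f x t"
  shows "dx f (- x) t = - dx f x t"
  by (rule even_derivative_odd[of "\<lambda>x. f x t" "\<lambda>x. dx f x t"])
    (use Smooth_DERIV_x[OF assms(1,2)] assms(3) in auto)

lemma dx_even:
  assumes "Smooth I f" "t \<in> I" "\<And>x. f (- x) t = - f x t"
  shows "dx f (- x) t = dx f x t"
  by (rule odd_derivative_even[of "\<lambda>x. f x t" "\<lambda>x. dx f x t"])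
    (use Smooth_DERIV_x[OF assms(1,2)] assms(3) in auto)

lemma dt_dx_dx:
  assumes "open I" "Smooth I f" "t \<in> I"
  shows "dt (dx (dx f)) x t = dx (dx (dt f)) x t"
proof -
  have "dt (dx (dx f)) x t = dx (dt (dx f)) x t"
    using mixed_partials[OF assms(1) Smooth_dx[OF assms(2)] assms(3)] by simp
  also have "\<dots> = dx (dx (dt f)) x t"
    by (rule dx_eq) (use mixed_partials[OF assms] in simp)
  finally show ?thesis .
qed

lemma heat_measurable:
  assumes "Smooth I f" "t \<in> I"
  shows "(\<lambda>z. f (x + r * z) t) \<in> borel_measurable borel"
proof -
  have [measurable]: "(\<lambda>x. f x t) \<in> borel_measurable borel"
    by (intro borel_measurable_continuous_onI Smooth_continuous[OF assms])
  show ?thesis by measurable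
qed

lemma heat_integrable:
  assumes "Smooth I f" "t \<in> I"
  shows "integrable gauss (\<lambda>z. f (x + r * z) t)"
  using expbd_section[OF expbd2_affine[OF Smooth_expbd[OF assms], of x 0 r], of 0]
  by (intro integrable_gauss_expbd heat_measurable[OF assms]) simp

lemma heat_add:
  assumes "Smooth I f" "Smooth I g" "t \<in> I"
  shows "heat d (\<lambda>x t. f x t + g x t) x t = heat d f x t + heat d g x t"
  unfolding heat_def using assms by (intro Bochner_Integration.integral_add heat_integrable)

lemma heat_cmult: "heat d (\<lambda>x t. c * f x t) x t = c * heat d f x t"
  unfolding heat_def by simp

lemma heat_mono:
  assumes "Smooth I f" "Smooth I g" "t \<in> I" "\<And>x. f x t \<le> g x t"
  shows "heat d f x t \<le> heat d g x t"
  unfolding heat_def using assms by (intro Bochner_Integration.integral_mono heat_integrable)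

lemma heat_const: "heat d (\<lambda>x t. c) x t = c"
  unfolding heat_def using gauss.prob_space by simp

lemma heat_cong: "(\<And>x. f x t = g x t) \<Longrightarrow> heat d f x t = heat d g x t"
  unfolding heat_def by simp

lemma heat_even:
  assumes "Smooth I f" "t \<in> I" "\<And>x. f (- x) t = f x t"
  shows "heat d f (- x) t = heat d f x t"
proof -
  have "heat d f x t = (\<integral>z. f (x + sqrt (2 * d t) * (- z)) t \<partial>gauss)"
    unfolding heat_def by (rule gauss_reflect[symmetric]) (rule heat_measurable[OF assms(1,2)])
  also have "\<dots> = heat d f (- x) t"
    unfolding heat_def
  proof (rule Bochner_Integration.integral_cong[OF refl])
    fix z
    have "f (x + sqrt (2 * d t) * (- z)) t = f (- (x + sqrt (2 * d t) * (- z))) t"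
      by (rule assms(3)[symmetric])
    then show "f (x + sqrt (2 * d t) * (- z)) t = f (- x + sqrt (2 * d t) * z) t" by simp
  qed
  finally show ?thesis by simp
qed

text \<open>With \<open>D = \<partial>\<^sub>t + \<beta> \<partial>\<^sub>x\<^sup>2\<close> the left-hand side of the inequality is the integral over \<open>[0, x]\<close> of
  \<open>\<phi> D\<^sup>2\<phi> - (D\<phi>)\<^sup>2\<close> (lemma \<open>heat_concave_quadratic\<close>). The coefficients of \<open>\<beta>\<close> and \<open>\<beta>\<^sup>2\<close> are written
  as the boundary terms that integration leaves; there is no contribution at \<open>0\<close> because \<open>\<phi>\<close> is even.\<close>
definition heat_concave :: "real set \<Rightarrow> (real \<Rightarrow> real \<Rightarrow> real) \<Rightarrow> bool" where
  "heat_concave I \<phi> \<longleftrightarrow> (\<forall>t\<in>I. \<exists>Y. Y 0 = 0 \<and>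
     (\<forall>x. (Y has_real_derivative \<phi> x t * dt (dt \<phi>) x t - (dt \<phi> x t)\<^sup>2) (at x)) \<and>
     (\<forall>x\<ge>0. \<forall>\<beta>. Y x + 2 * \<beta> * (\<phi> x t * dx (dt \<phi>) x t - dt \<phi> x t * dx \<phi> x t)
         + \<beta>\<^sup>2 * (\<phi> x t * dx (dx (dx \<phi>)) x t - dx \<phi> x t * dx (dx \<phi>) x t) \<le> 0))"

lemma heat_concave_quadratic:
  fixes Y :: "real \<Rightarrow> real"
  assumes I: "open I" and \<phi>: "Smooth I \<phi>" and t: "t \<in> I"
    and even: "\<And>x s. s \<in> I \<Longrightarrow> \<phi> (- x) s = \<phi> x s"
    and Y: "Y 0 = 0" "\<And>x. (Y has_real_derivative \<phi> x t * dt (dt \<phi>) x t - (dt \<phi> x t)\<^sup>2) (at x)"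
  defines "Q \<equiv> \<lambda>\<beta> x. Y x + 2 * \<beta> * (\<phi> x t * dx (dt \<phi>) x t - dt \<phi> x t * dx \<phi> x t)
         + \<beta>\<^sup>2 * (\<phi> x t * dx (dx (dx \<phi>)) x t - dx \<phi> x t * dx (dx \<phi>) x t)"
  shows "Q \<beta> 0 = 0"
    and "(Q \<beta> has_real_derivative
      \<phi> x t * (dt (dt \<phi>) x t + 2 * \<beta> * dx (dx (dt \<phi>)) x t + \<beta>\<^sup>2 * dx (dx (dx (dx \<phi>))) x t)
       - (dt \<phi> x t + \<beta> * dx (dx \<phi>) x t)\<^sup>2) (at x)"
proof -
  note S = \<phi> Smooth_dx[OF \<phi>] Smooth_dx[OF Smooth_dx[OF \<phi>]] Smooth_dx[OF Smooth_dx[OF Smooth_dx[OF \<phi>]]]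
    Smooth_dt[OF \<phi>] Smooth_dx[OF Smooth_dt[OF \<phi>]]
  have o1: "dx \<phi> (- x) t = - dx \<phi> x t" for x by (rule dx_odd[OF S(1) t even[OF t]])
  have e2: "dx (dx \<phi>) (- x) t = dx (dx \<phi>) x t" for x by (rule dx_even[OF S(2) t o1])
  have o3: "dx (dx (dx \<phi>)) (- x) t = - dx (dx (dx \<phi>)) x t" for x by (rule dx_odd[OF S(3) t e2])
  have ot: "dx (dt \<phi>) (- x) t = - dx (dt \<phi>) x t" for x
    by (rule dx_odd[OF S(5) t], rule dt_even[OF I t], rule even)
  have "dx \<phi> 0 t = 0" "dx (dx (dx \<phi>)) 0 t = 0" "dx (dt \<phi>) 0 t = 0"
    using o1[of 0] o3[of 0] ot[of 0] by simp_all
  then show "Q \<beta> 0 = 0" using Y(1) by (simp add: Q_def)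
  show "(Q \<beta> has_real_derivative
      \<phi> x t * (dt (dt \<phi>) x t + 2 * \<beta> * dx (dx (dt \<phi>)) x t + \<beta>\<^sup>2 * dx (dx (dx (dx \<phi>))) x t)
       - (dt \<phi> x t + \<beta> * dx (dx \<phi>) x t)\<^sup>2) (at x)"
    unfolding Q_def
    by (rule derivative_eq_intros Y(2) Smooth_DERIV_x[OF S(1) t] Smooth_DERIV_x[OF S(2) t]
        Smooth_DERIV_x[OF S(3) t] Smooth_DERIV_x[OF S(4) t] Smooth_DERIV_x[OF S(5) t]
        Smooth_DERIV_x[OF S(6) t] refl)+ (simp add: power2_eq_square algebra_simps)
qed

context
  fixes I :: "real set" and d :: "real \<Rightarrow> real" and a b D :: real
  assumes I: "open I"
    and d: "\<And>t. d t = a + b * t" "\<And>t. t \<in> I \<Longrightarrow> 0 < d t" "\<And>t. t \<in> I \<Longrightarrow> d t \<le> D"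
begin

lemma Smooth_heat_step: "Smooth I f \<Longrightarrow> Smooth I (heat d f)"
  by (rule Smooth_heat[OF I _ d])

lemma dx_heat: "Smooth I f \<Longrightarrow> t \<in> I \<Longrightarrow> dx (heat d f) x t = heat d (dx f) x t"
  by (rule has_partials_dx[OF has_partials_heat[OF I _ d]])

lemma Smooth_generator: "Smooth I f \<Longrightarrow> Smooth I (\<lambda>x t. dt f x t + c * dx (dx f) x t)"
  using I by (intro Smooth_add Smooth_mult Smooth_const Smooth_dt Smooth_dx)

lemma dt_heat: "Smooth I f \<Longrightarrow> t \<in> I \<Longrightarrow>
    dt (heat d f) x t = heat d (\<lambda>x t. dt f x t + b * dx (dx f) x t) x t"
  by (rule has_partials_dt[OF has_partials_heat[OF I _ d]])

lemma dx_dx_heat: "Smooth I f \<Longrightarrow> t \<in> I \<Longrightarrow> dx (dx (heat d f)) x t = heat d (dx (dx f)) x t"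
  using dx_eq[of "dx (heat d f)" t "heat d (dx f)"] dx_heat Smooth_dx by metis

lemma dx_dx_dt_heat:
  assumes "Smooth I f" "t \<in> I"
  shows "dx (dx (dt (heat d f))) x t = heat d (\<lambda>x t. dx (dx (dt f)) x t + b * dx (dx (dx (dx f))) x t) x t"
proof -
  have "dx (dx (dt (heat d f))) x t = dx (dx (heat d (\<lambda>x t. dt f x t + b * dx (dx f) x t))) x t"
    by (intro dx_eq dt_heat assms)
  also have "\<dots> = heat d (dx (dx (\<lambda>x t. dt f x t + b * dx (dx f) x t))) x t"
    by (intro dx_dx_heat Smooth_generator assms)
  also have "\<dots> = heat d (\<lambda>x t. dx (dx (dt f)) x t + b * dx (dx (dx (dx f))) x t) x t"
  proof (rule heat_cong)
    fix x
    have 1: "dx (\<lambda>x t. dt f x t + b * dx (dx f) x t) x t = dx (dt f) x t + b * dx (dx (dx f)) x t" for x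
      by (intro dxI DERIV_add DERIV_cmult Smooth_DERIV_x[OF _ assms(2)] Smooth_dx Smooth_dt assms)
    have "dx (dx (\<lambda>x t. dt f x t + b * dx (dx f) x t)) x t = dx (\<lambda>x t. dx (dt f) x t + b * dx (dx (dx f)) x t) x t"
      by (rule dx_eq) (rule 1)
    also have "\<dots> = dx (dx (dt f)) x t + b * dx (dx (dx (dx f))) x t"
      by (intro dxI DERIV_add DERIV_cmult Smooth_DERIV_x[OF _ assms(2)] Smooth_dx Smooth_dt assms)
    finally show "dx (dx (\<lambda>x t. dt f x t + b * dx (dx f) x t)) x t = \<dots>" .
  qed
  finally show ?thesis .
qed

lemma dt_dt_heat:
  assumes "Smooth I f" "t \<in> I"
  shows "dt (dt (heat d f)) x t
    = heat d (\<lambda>x t. dt (dt f) x t + 2 * b * dx (dx (dt f)) x t + b\<^sup>2 * dx (dx (dx (dx f))) x t) x t"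
proof -
  let ?g = "\<lambda>x t. dt f x t + b * dx (dx f) x t"
  have "dt (dt (heat d f)) x t = dt (heat d ?g) x t"
    by (rule dt_eq[OF I assms(2)]) (rule dt_heat[OF assms(1)])
  also have "\<dots> = heat d (\<lambda>x t. dt ?g x t + b * dx (dx ?g) x t) x t"
    by (intro dt_heat Smooth_generator assms)
  also have "\<dots> = heat d (\<lambda>x t. dt (dt f) x t + 2 * b * dx (dx (dt f)) x t + b\<^sup>2 * dx (dx (dx (dx f))) x t) x t"
  proof (rule heat_cong)
    fix x
    have "dt ?g x t = dt (dt f) x t + b * dt (dx (dx f)) x t"
      by (intro dtI DERIV_add DERIV_cmult Smooth_DERIV_t[OF _ assms(2)] Smooth_dx Smooth_dt assms)
    also have "dt (dx (dx f)) x t = dx (dx (dt f)) x t" by (rule dt_dx_dx[OF I assms])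
    finally have t1: "dt ?g x t = dt (dt f) x t + b * dx (dx (dt f)) x t" .
    have 1: "dx ?g x t = dx (dt f) x t + b * dx (dx (dx f)) x t" for x
      by (intro dxI DERIV_add DERIV_cmult Smooth_DERIV_x[OF _ assms(2)] Smooth_dx Smooth_dt assms)
    have "dx (dx ?g) x t = dx (\<lambda>x t. dx (dt f) x t + b * dx (dx (dx f)) x t) x t"
      by (rule dx_eq) (rule 1)
    also have "\<dots> = dx (dx (dt f)) x t + b * dx (dx (dx (dx f))) x t"
      by (intro dxI DERIV_add DERIV_cmult Smooth_DERIV_x[OF _ assms(2)] Smooth_dx Smooth_dt assms)
    finally show "dt ?g x t + b * dx (dx ?g) x t
      = dt (dt f) x t + 2 * b * dx (dx (dt f)) x t + b\<^sup>2 * dx (dx (dx (dx f))) x t"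
      unfolding t1 by (simp add: power2_eq_square algebra_simps)
  qed
  finally show ?thesis .
qed

text \<open>A parameter direction \<open>\<partial>\<^sub>t + \<beta> \<partial>\<^sub>x\<^sup>2\<close> after the heat flow is the direction \<open>\<partial>\<^sub>t + (b + \<beta>) \<partial>\<^sub>x\<^sup>2\<close> before it.
  As the condition is imposed for all \<open>\<beta>\<close>, the shift by \<open>b\<close> is harmless, and the claim for each \<open>\<beta>\<close> is
  an instance of the Gaussian kernel inequality.\<close>
lemma heat_concave_heat:
  assumes \<phi>: "Smooth I \<phi>" and even: "\<And>x s. s \<in> I \<Longrightarrow> \<phi> (- x) s = \<phi> x s"
    and ge1: "\<And>x s. s \<in> I \<Longrightarrow> 1 \<le> \<phi> x s" and conc: "heat_concave I \<phi>"
  shows "heat_concave I (heat d \<phi>)"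
  unfolding heat_concave_def
proof
  fix t assume t: "t \<in> I"
  let ?h = "heat d \<phi>"
  note S = \<phi> Smooth_dx[OF \<phi>] Smooth_dx[OF Smooth_dx[OF \<phi>]] Smooth_dx[OF Smooth_dx[OF Smooth_dx[OF \<phi>]]]
    Smooth_dt[OF \<phi>] Smooth_dx[OF Smooth_dt[OF \<phi>]]
  note hS = Smooth_heat_step[OF \<phi>]
  have heven: "?h (- x) s = ?h x s" if "s \<in> I" for x s by (rule heat_even[OF \<phi> that even[OF that]])
  obtain Y where Y: "Y 0 = 0" "\<And>x. (Y has_real_derivative \<phi> x t * dt (dt \<phi>) x t - (dt \<phi> x t)\<^sup>2) (at x)"
    and Yneg: "\<And>x \<beta>. 0 \<le> x \<Longrightarrow> Y x + 2 * \<beta> * (\<phi> x t * dx (dt \<phi>) x t - dt \<phi> x t * dx \<phi> x t)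
         + \<beta>\<^sup>2 * (\<phi> x t * dx (dx (dx \<phi>)) x t - dx \<phi> x t * dx (dx \<phi>) x t) \<le> 0"
    using conc t unfolding heat_concave_def by blast
  have "continuous_on UNIV (\<lambda>x. ?h x t * dt (dt ?h) x t - (dt ?h x t)\<^sup>2)"
    by (intro continuous_intros Smooth_continuous[OF _ t] hS Smooth_dt)
  then obtain Z where Z: "\<And>x. (Z has_real_derivative ?h x t * dt (dt ?h) x t - (dt ?h x t)\<^sup>2) (at x)" "Z 0 = 0"
    using antiderivative_exists by blast
  have "Z x + 2 * \<beta> * (?h x t * dx (dt ?h) x t - dt ?h x t * dx ?h x t)
         + \<beta>\<^sup>2 * (?h x t * dx (dx (dx ?h)) x t - dx ?h x t * dx (dx ?h) x t) \<le> 0" if x: "0 \<le> x" for x \<beta>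
  proof -
    \<comment> \<open>The direction before the step that corresponds to \<open>\<beta>\<close> after it.\<close>
    define B where "B = b + \<beta>"
    define u where "u x = dt \<phi> x t + B * dx (dx \<phi>) x t" for x
    define u1 where "u1 x = dx (dt \<phi>) x t + B * dx (dx (dx \<phi>)) x t" for x
    define y where "y x = dt (dt \<phi>) x t + 2 * B * dx (dx (dt \<phi>)) x t + B\<^sup>2 * dx (dx (dx (dx \<phi>))) x t" for x
    define YB where "YB x = Y x + 2 * B * (\<phi> x t * dx (dt \<phi>) x t - dt \<phi> x t * dx \<phi> x t)
         + B\<^sup>2 * (\<phi> x t * dx (dx (dx \<phi>)) x t - dx \<phi> x t * dx (dx \<phi>) x t)" for x
    define ZB where "ZB x = Z x + 2 * \<beta> * (?h x t * dx (dt ?h) x t - dt ?h x t * dx ?h x t)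
         + \<beta>\<^sup>2 * (?h x t * dx (dx (dx ?h)) x t - dx ?h x t * dx (dx ?h) x t)" for x
    have "ZB x \<le> 0"
    proof (rule gaussian_kernel_inequality[of "\<lambda>x. \<phi> x t" "\<lambda>x. dx \<phi> x t" "\<lambda>x. dx (dx \<phi>) x t"
          "\<lambda>x. dx (dx (dx \<phi>)) x t" u u1 y YB "sqrt (d t)" ZB x])
      show "(u has_real_derivative u1 x) (at x)" for x
        unfolding u_def[abs_def] u1_def
        by (intro DERIV_add DERIV_cmult Smooth_DERIV_x[OF _ t] S)
      show "continuous_on UNIV y"
        unfolding y_def by (intro continuous_intros Smooth_continuous[OF _ t] Smooth_dx Smooth_dt \<phi>)
      show "(YB has_real_derivative \<phi> x t * y x - (u x)\<^sup>2) (at x)" "YB 0 = 0" for x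
        using heat_concave_quadratic[OF I \<phi> t even Y, of B] unfolding YB_def[abs_def] y_def u_def by blast+
      have et: "dt \<phi> (- x) s = dt \<phi> x s" if "s \<in> I" for x s by (rule dt_even[OF I that], rule even)
      have ett: "dt (dt \<phi>) (- x) t = dt (dt \<phi>) x t" for x by (rule dt_even[OF I t], rule et)
      have e2: "dx (dx f) (- x) t = dx (dx f) x t" if "Smooth I f" "\<And>x. f (- x) t = f x t" for f x
        by (rule dx_even[OF Smooth_dx[OF that(1)] t dx_odd[OF that(1) t that(2)]])
      show "u (- x) = u x" "y (- x) = y x" for x
        unfolding u_def y_def
        by (simp_all add: et[OF t] ett e2[OF \<phi> even[OF t]] e2[OF S(5) et[OF t]] e2[OF S(3) e2[OF \<phi> even[OF t]]])
      show "expbd u" unfolding u_def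
        by (intro expbd_add expbd_mult expbd_const Smooth_expbd[OF _ t] S)
      show "expbd y" unfolding y_def
        by (intro expbd_add expbd_mult expbd_const Smooth_expbd[OF _ t] Smooth_dx Smooth_dt \<phi>)
      show "YB x + 2 * \<gamma> * (\<phi> x t * u1 x - u x * dx \<phi> x t)
          + \<gamma>\<^sup>2 * (\<phi> x t * dx (dx (dx \<phi>)) x t - dx \<phi> x t * dx (dx \<phi>) x t) \<le> 0" if "0 \<le> x" for x \<gamma>
        using Yneg[OF that, of "B + \<gamma>"] unfolding YB_def u_def u1_def
        by (simp add: power2_eq_square algebra_simps)
      show "(ZB has_real_derivative
          (\<integral>z. \<phi> (x + sqrt 2 * sqrt (d t) * z) t \<partial>gauss) * (\<integral>z. y (x + sqrt 2 * sqrt (d t) * z) \<partial>gauss)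
          - (\<integral>z. u (x + sqrt 2 * sqrt (d t) * z) \<partial>gauss)\<^sup>2) (at x)" for x
      proof -
        have sq: "sqrt 2 * sqrt (d t) = sqrt (2 * d t)" by (simp add: real_sqrt_mult)
        have 1: "(\<integral>z. \<phi> (x + sqrt (2 * d t) * z) t \<partial>gauss) = ?h x t" by (simp add: heat_def)
        have 2: "(\<integral>z. u (x + sqrt (2 * d t) * z) \<partial>gauss) = dt ?h x t + \<beta> * dx (dx ?h) x t"
        proof -
          have "(\<integral>z. u (x + sqrt (2 * d t) * z) \<partial>gauss) = heat d (\<lambda>x t. dt \<phi> x t + B * dx (dx \<phi>) x t) x t"
            by (simp add: heat_def u_def)
          also have "\<dots> = heat d (\<lambda>x t. (dt \<phi> x t + b * dx (dx \<phi>) x t) + \<beta> * dx (dx \<phi>) x t) x t"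
            by (rule heat_cong) (simp add: B_def algebra_simps)
          also have "\<dots> = heat d (\<lambda>x t. dt \<phi> x t + b * dx (dx \<phi>) x t) x t + \<beta> * heat d (dx (dx \<phi>)) x t"
            using heat_add[OF Smooth_generator[OF \<phi>, of b] Smooth_mult[OF I Smooth_const[OF I] S(3)] t, of d \<beta> x]
              heat_cmult[of d \<beta> "dx (dx \<phi>)" x t] by simp
          finally show ?thesis
            using dt_heat[OF \<phi> t] dx_dx_heat[OF \<phi> t] by simp
        qed
        have 3: "(\<integral>z. y (x + sqrt (2 * d t) * z) \<partial>gauss)
           = dt (dt ?h) x t + 2 * \<beta> * dx (dx (dt ?h)) x t + \<beta>\<^sup>2 * dx (dx (dx (dx ?h))) x t"
        proof -
          let ?x4 = "dx (dx (dx (dx \<phi>)))" and ?xxt = "dx (dx (dt \<phi>))"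
          have s4: "Smooth I ?x4" "Smooth I ?xxt" "Smooth I (dt (dt \<phi>))"
            by (intro Smooth_dx Smooth_dt \<phi>)+
          have s5: "Smooth I (\<lambda>x t. c * f x t)" if "Smooth I f" for c f
            using I that by (intro Smooth_mult Smooth_const)
          have h4: "dx (dx (dx (dx ?h))) x t = heat d ?x4 x t" for x
          proof -
            have "dx (dx (dx (dx ?h))) x t = dx (dx (heat d (dx (dx \<phi>)))) x t"
              by (intro dx_eq dx_dx_heat[OF \<phi> t])
            also have "\<dots> = heat d ?x4 x t" by (rule dx_dx_heat[OF S(3) t])
            finally show ?thesis .
          qed
          have "(\<integral>z. y (x + sqrt (2 * d t) * z) \<partial>gauss)
            = heat d (\<lambda>x t. (dt (dt \<phi>) x t + 2 * b * ?xxt x t + b\<^sup>2 * ?x4 x t)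
                + (2 * \<beta> * (?xxt x t + b * ?x4 x t) + \<beta>\<^sup>2 * ?x4 x t)) x t"
            unfolding heat_def
            by (intro Bochner_Integration.integral_cong refl)
              (simp add: y_def B_def power2_eq_square algebra_simps)
          also have "\<dots> = heat d (\<lambda>x t. dt (dt \<phi>) x t + 2 * b * ?xxt x t + b\<^sup>2 * ?x4 x t) x t
              + (2 * \<beta> * heat d (\<lambda>x t. ?xxt x t + b * ?x4 x t) x t + \<beta>\<^sup>2 * heat d ?x4 x t)"
          proof -
            have g: "Smooth I (\<lambda>x t. dt (dt \<phi>) x t + 2 * b * ?xxt x t + b\<^sup>2 * ?x4 x t)"
              "Smooth I (\<lambda>x t. ?xxt x t + b * ?x4 x t)"
              by (intro Smooth_add[OF I] s4 s5)+
            have g2: "Smooth I (\<lambda>x t. 2 * \<beta> * (?xxt x t + b * ?x4 x t))" "Smooth I (\<lambda>x t. \<beta>\<^sup>2 * ?x4 x t)"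
              using s5[OF g(2), of "2 * \<beta>"] s5[OF s4(1), of "\<beta>\<^sup>2"] .
            show ?thesis
              unfolding heat_add[OF g(1) Smooth_add[OF I g2] t] heat_add[OF g2 t]
              using heat_cmult[of d "2 * \<beta>" "\<lambda>x t. ?xxt x t + b * ?x4 x t" x t]
                heat_cmult[of d "\<beta>\<^sup>2" ?x4 x t] by simp
          qed
          finally show ?thesis
            unfolding dt_dt_heat[OF \<phi> t] dx_dx_dt_heat[OF \<phi> t] h4 by simp
        qed
        show ?thesis
          unfolding sq 1 2 3 ZB_def[abs_def]
          using heat_concave_quadratic(2)[OF I hS t heven Z(2) Z(1), of \<beta> x] .
      qed
      show "ZB 0 = 0"
        unfolding ZB_def using heat_concave_quadratic(1)[OF I hS t heven Z(2) Z(1), of \<beta>] .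
    qed (use x d(2)[OF t] even[OF t] ge1[OF t] in \<open>auto intro!: Smooth_DERIV_x[OF _ t] Smooth_expbd[OF _ t] S\<close>)
    then show ?thesis by (simp add: ZB_def)
  qed
  with Z show "\<exists>Y. Y 0 = 0 \<and>
      (\<forall>x. (Y has_real_derivative ?h x t * dt (dt ?h) x t - (dt ?h x t)\<^sup>2) (at x)) \<and>
      (\<forall>x\<ge>0. \<forall>\<beta>. Y x + 2 * \<beta> * (?h x t * dx (dt ?h) x t - dt ?h x t * dx ?h x t)
         + \<beta>\<^sup>2 * (?h x t * dx (dx (dx ?h)) x t - dx ?h x t * dx (dx ?h) x t) \<le> 0)"
    by (intro exI[of _ Z]) auto
qed

end

section \<open>One step of the recursion\<close>

definition tame :: "real set \<Rightarrow> (real \<Rightarrow> real \<Rightarrow> real) \<Rightarrow> bool" where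
  "tame I V \<longleftrightarrow> Smooth I V \<and> (\<forall>t\<in>I. \<forall>x. V (- x) t = V x t \<and> 0 \<le> V x t \<and>
     \<bar>dx V x t\<bar> \<le> 1 \<and> 0 \<le> dx (dx V) x t)"

text \<open>The generator of the flow of \<open>T\<^sub>m\<close>: it is the derivative of \<open>T\<^sub>m\<^sub>,\<^sub>s V\<close> in \<open>s\<close> at \<open>s = 0\<close>.\<close>
definition curv :: "real \<Rightarrow> (real \<Rightarrow> real \<Rightarrow> real) \<Rightarrow> real \<Rightarrow> real \<Rightarrow> real" where
  "curv m V x t = dx (dx V) x t + m * (dx V x t)\<^sup>2"

text \<open>The condition \<open>heat_concave\<close> for \<open>exp (m V)\<close>, divided by \<open>m\<close> and expressed through \<open>V\<close>. In this form it
  makes sense for \<open>m = 0\<close> and different \<open>m\<close> can be compared.\<close>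
definition tilt_concave :: "real set \<Rightarrow> real \<Rightarrow> (real \<Rightarrow> real \<Rightarrow> real) \<Rightarrow> bool" where
  "tilt_concave I m V \<longleftrightarrow> (\<forall>t\<in>I. \<exists>Y. Y 0 = 0 \<and>
     (\<forall>x. (Y has_real_derivative exp (2 * m * V x t) * dt (dt V) x t) (at x)) \<and>
     (\<forall>x\<ge>0. \<forall>\<beta>. Y x + exp (2 * m * V x t) * (2 * \<beta> * dx (dt V) x t
         + \<beta>\<^sup>2 * (dx (dx (dx V)) x t + 2 * m * (dx V x t * dx (dx V) x t))) \<le> 0))"

text \<open>Along a segment of paths with direction \<open>w\<close>, the parameter \<open>e\<close> is the value of \<open>w\<close> on the cell to the
  left of the current breakpoint and \<open>c\<close> is its value on the last cell. Adding \<open>e curv m V\<close> undoes the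
  effect on \<open>V\<^sub>t\<close> of moving the time at which \<open>V\<close> starts, so that only the weighted size of
  \<open>w\<close> to the right of the breakpoint remains in the bound \<open>L\<close>.\<close>
definition slope_bound :: "real set \<Rightarrow> real \<Rightarrow> real \<Rightarrow> real \<Rightarrow> real \<Rightarrow> (real \<Rightarrow> real \<Rightarrow> real) \<Rightarrow> bool" where
  "slope_bound I m e c L V \<longleftrightarrow> (\<forall>t\<in>I. \<forall>x. \<bar>dt V x t + e * curv m V x t - c\<bar> \<le> L)"

lemma tameD:
  assumes "tame I V"
  shows "Smooth I V" "t \<in> I \<Longrightarrow> V (- x) t = V x t" "t \<in> I \<Longrightarrow> 0 \<le> V x t"
    "t \<in> I \<Longrightarrow> \<bar>dx V x t\<bar> \<le> 1" "t \<in> I \<Longrightarrow> 0 \<le> dx (dx V) x t"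
  using assms unfolding tame_def by auto

lemma tame_le_abs:
  assumes "tame I V" "t \<in> I"
  shows "V x t \<le> V 0 t + \<bar>x\<bar>"
proof -
  have "norm (V x t - V 0 t) \<le> 1 * norm (x - 0)"
    by (rule field_differentiable_bound[of UNIV "\<lambda>x. V x t" "\<lambda>x. dx V x t"])
      (use tameD[OF assms(1)] assms(2) in \<open>auto intro!: Smooth_DERIV_x\<close>)
  then show ?thesis by simp
qed

lemma tame_dx_nonneg:
  assumes "tame I V" "t \<in> I" "0 \<le> x"
  shows "0 \<le> dx V x t"
proof -
  have "dx V 0 t = 0"
    using dx_odd[OF tameD(1)[OF assms(1)] assms(2), of 0] tameD(2)[OF assms(1,2)] by simp
  moreover have "dx V 0 t \<le> dx V x t"
    using assms(3)
    by (rule DERIV_nonneg_imp_nondecreasing)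
      (use Smooth_DERIV_x[OF Smooth_dx[OF tameD(1)[OF assms(1)]] assms(2)] tameD(5)[OF assms(1,2)] in blast)
  ultimately show ?thesis by simp
qed

lemma Smooth_exp_tame:
  assumes I: "open I" and V: "tame I V" and m: "0 \<le> m"
  shows "Smooth I (\<lambda>x t. exp (m * V x t))"
proof (rule Smooth_exp[OF I])
  show "Smooth I (\<lambda>x t. m * V x t)"
    by (intro Smooth_mult Smooth_const I tameD[OF V])
  obtain K k where K: "0 \<le> K" "0 \<le> k" "\<forall>t\<in>I. \<forall>x. \<bar>V x t\<bar> \<le> K * exp (k * \<bar>x\<bar>)"
    using Smooth_ubd[OF tameD(1)[OF V]] by (rule ubdE)
  have "\<bar>exp (m * V x t)\<bar> \<le> exp (m * K) * exp (m * \<bar>x\<bar>)" if t: "t \<in> I" for x t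
  proof -
    have "\<bar>V 0 t\<bar> \<le> K" using K(3)[rule_format, OF t, of 0] by simp
    then have "V x t \<le> K + \<bar>x\<bar>"
      using tame_le_abs[OF V t, of x] by linarith
    from mult_left_mono[OF this m] show ?thesis by (simp add: distrib_left flip: exp_add)
  qed
  then show "ubd I (\<lambda>x t. exp (m * V x t))"
    unfolding ubd_def using m by (intro exI[of _ "exp (m * K)"] exI[of _ m]) auto
qed

lemma exp_derivatives:
  fixes V :: "real \<Rightarrow> real \<Rightarrow> real" and m :: real
  assumes I: "open I" and V: "Smooth I V" and t: "t \<in> I"
  defines "\<phi> \<equiv> \<lambda>x t. exp (m * V x t)"
  shows "dx \<phi> x t = \<phi> x t * (m * dx V x t)"
    and "dx (dx \<phi>) x t = \<phi> x t * (m * curv m V x t)"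
    and "dx (dx (dx \<phi>)) x t = \<phi> x t * (m * dx (dx (dx V)) x t + 3 * m\<^sup>2 * (dx V x t * dx (dx V) x t)
        + m ^ 3 * dx V x t ^ 3)"
    and "dt \<phi> x t = \<phi> x t * (m * dt V x t)"
    and "dx (dt \<phi>) x t = \<phi> x t * (m * dx (dt V) x t + m\<^sup>2 * (dx V x t * dt V x t))"
    and "dt (dt \<phi>) x t = \<phi> x t * (m * dt (dt V) x t + m\<^sup>2 * (dt V x t)\<^sup>2)"
proof -
  have Dx: "((\<lambda>x. \<phi> x t) has_real_derivative \<phi> x t * (m * dx V x t)) (at x)" for x
    unfolding \<phi>_def by (rule derivative_eq_intros Smooth_DERIV_x[OF V t] refl)+ simp
  have Dt: "((\<lambda>t. \<phi> x t) has_real_derivative \<phi> x t * (m * dt V x t)) (at t)" if "t \<in> I" for x t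
    unfolding \<phi>_def by (rule derivative_eq_intros Smooth_DERIV_t[OF V that] refl)+ simp
  show x1: "dx \<phi> x t = \<phi> x t * (m * dx V x t)" for x by (rule dxI) (rule Dx)
  show t1: "dt \<phi> x t = \<phi> x t * (m * dt V x t)" for x by (rule dtI) (rule Dt[OF t])
  have t1': "dt \<phi> x s = \<phi> x s * (m * dt V x s)" if "s \<in> I" for x s by (rule dtI) (rule Dt[OF that])
  have V1: "((\<lambda>x. dx V x t) has_real_derivative dx (dx V) x t) (at x)"
    "((\<lambda>x. dx (dx V) x t) has_real_derivative dx (dx (dx V)) x t) (at x)"
    "((\<lambda>x. dt V x t) has_real_derivative dx (dt V) x t) (at x)" for x
    by (intro Smooth_DERIV_x[OF _ t] Smooth_dx Smooth_dt V)+
  show x2: "dx (dx \<phi>) x t = \<phi> x t * (m * curv m V x t)" for x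
  proof -
    have "dx (dx \<phi>) x t = dx (\<lambda>x t. \<phi> x t * (m * dx V x t)) x t" by (rule dx_eq) (rule x1)
    also have "\<dots> = \<phi> x t * (m * curv m V x t)"
      by (rule dxI, (rule derivative_eq_intros Dx V1 refl)+) (simp add: curv_def power2_eq_square algebra_simps)
    finally show ?thesis .
  qed
  show "dx (dx (dx \<phi>)) x t = \<phi> x t * (m * dx (dx (dx V)) x t + 3 * m\<^sup>2 * (dx V x t * dx (dx V) x t)
        + m ^ 3 * dx V x t ^ 3)"
  proof -
    have "dx (dx (dx \<phi>)) x t = dx (\<lambda>x t. \<phi> x t * (m * (dx (dx V) x t + m * (dx V x t)\<^sup>2))) x t"
      by (rule dx_eq) (simp add: x2 curv_def)
    also have "\<dots> = \<phi> x t * (m * dx (dx (dx V)) x t + 3 * m\<^sup>2 * (dx V x t * dx (dx V) x t)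
        + m ^ 3 * dx V x t ^ 3)"
      by (rule dxI, (rule derivative_eq_intros Dx V1 refl)+)
        (simp add: power2_eq_square power3_eq_cube algebra_simps)
    finally show ?thesis .
  qed
  show "dx (dt \<phi>) x t = \<phi> x t * (m * dx (dt V) x t + m\<^sup>2 * (dx V x t * dt V x t))"
  proof -
    have "dx (dt \<phi>) x t = dx (\<lambda>x t. \<phi> x t * (m * dt V x t)) x t" by (rule dx_eq) (rule t1)
    also have "\<dots> = \<phi> x t * (m * dx (dt V) x t + m\<^sup>2 * (dx V x t * dt V x t))"
      by (rule dxI, (rule derivative_eq_intros Dx V1 refl)+) (simp add: power2_eq_square algebra_simps)
    finally show ?thesis .
  qed
  show "dt (dt \<phi>) x t = \<phi> x t * (m * dt (dt V) x t + m\<^sup>2 * (dt V x t)\<^sup>2)"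
  proof -
    have "dt (dt \<phi>) x t = dt (\<lambda>x t. \<phi> x t * (m * dt V x t)) x t"
      by (rule dt_eq[OF I t]) (rule t1')
    also have "\<dots> = \<phi> x t * (m * dt (dt V) x t + m\<^sup>2 * (dt V x t)\<^sup>2)"
      by (rule dtI, (rule derivative_eq_intros Dt[OF t] Smooth_DERIV_t[OF Smooth_dt[OF V] t] refl)+)
        (simp add: power2_eq_square algebra_simps)
    finally show ?thesis .
  qed
qed

lemma heat_concave_exp_iff:
  assumes I: "open I" and V: "Smooth I V" and m: "0 < m"
  shows "heat_concave I (\<lambda>x t. exp (m * V x t)) \<longleftrightarrow> tilt_concave I m V"
proof -
  let ?\<phi> = "\<lambda>x t. exp (m * V x t)"
  have sq: "exp (2 * m * V x t) = ?\<phi> x t * ?\<phi> x t" for x t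
  proof -
    have "2 * m * V x t = m * V x t + m * V x t" by simp
    then show ?thesis by (simp only: exp_add)
  qed
  have e1: "?\<phi> x t * dt (dt ?\<phi>) x t - (dt ?\<phi> x t)\<^sup>2 = m * (exp (2 * m * V x t) * dt (dt V) x t)"
    and e2: "2 * \<beta> * (?\<phi> x t * dx (dt ?\<phi>) x t - dt ?\<phi> x t * dx ?\<phi> x t)
         + \<beta>\<^sup>2 * (?\<phi> x t * dx (dx (dx ?\<phi>)) x t - dx ?\<phi> x t * dx (dx ?\<phi>) x t)
       = m * (exp (2 * m * V x t) * (2 * \<beta> * dx (dt V) x t
         + \<beta>\<^sup>2 * (dx (dx (dx V)) x t + 2 * m * (dx V x t * dx (dx V) x t))))"
    if "t \<in> I" for x t \<beta>
    unfolding exp_derivatives[OF I V that, of m] sq curv_def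
    by (simp_all add: power2_eq_square power3_eq_cube algebra_simps)
  have eq: "(\<exists>Y. Y 0 = 0 \<and>
     (\<forall>x. (Y has_real_derivative ?\<phi> x t * dt (dt ?\<phi>) x t - (dt ?\<phi> x t)\<^sup>2) (at x)) \<and>
     (\<forall>x\<ge>0. \<forall>\<beta>. Y x + 2 * \<beta> * (?\<phi> x t * dx (dt ?\<phi>) x t - dt ?\<phi> x t * dx ?\<phi> x t)
         + \<beta>\<^sup>2 * (?\<phi> x t * dx (dx (dx ?\<phi>)) x t - dx ?\<phi> x t * dx (dx ?\<phi>) x t) \<le> 0)) \<longleftrightarrow>
    (\<exists>Y. Y 0 = 0 \<and>
     (\<forall>x. (Y has_real_derivative exp (2 * m * V x t) * dt (dt V) x t) (at x)) \<and>
     (\<forall>x\<ge>0. \<forall>\<beta>. Y x + exp (2 * m * V x t) * (2 * \<beta> * dx (dt V) x t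
         + \<beta>\<^sup>2 * (dx (dx (dx V)) x t + 2 * m * (dx V x t * dx (dx V) x t))) \<le> 0))"
    (is "(\<exists>Y. ?P Y) \<longleftrightarrow> (\<exists>Y. ?Q Y)") if t: "t \<in> I" for t
  proof -
    have PQ: "?P (\<lambda>x. m * Y x) \<longleftrightarrow> ?Q Y" for Y
    proof -
      have d: "((\<lambda>x. m * Y x) has_real_derivative m * D) (at x) \<longleftrightarrow> (Y has_real_derivative D) (at x)" for x D
      proof
        assume "((\<lambda>x. m * Y x) has_real_derivative m * D) (at x)"
        from DERIV_cmult[OF this, of "1 / m"] show "(Y has_real_derivative D) (at x)" using m by simp
      qed (rule DERIV_cmult)
      have l: "m * Y x + 2 * \<beta> * (?\<phi> x t * dx (dt ?\<phi>) x t - dt ?\<phi> x t * dx ?\<phi> x t)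
         + \<beta>\<^sup>2 * (?\<phi> x t * dx (dx (dx ?\<phi>)) x t - dx ?\<phi> x t * dx (dx ?\<phi>) x t) \<le> 0 \<longleftrightarrow>
         Y x + exp (2 * m * V x t) * (2 * \<beta> * dx (dt V) x t
         + \<beta>\<^sup>2 * (dx (dx (dx V)) x t + 2 * m * (dx V x t * dx (dx V) x t))) \<le> 0" for x \<beta>
        unfolding add.assoc e2[OF t] distrib_left[symmetric] using m by (simp add: mult_le_0_iff)
      have z: "m * Y 0 = 0 \<longleftrightarrow> Y 0 = 0" using m by simp
      show ?thesis unfolding e1[OF t] d l z ..
    qed
    show ?thesis
    proof
      assume "\<exists>Y. ?P Y"
      then obtain Y where "?P Y" by (rule exE)
      note PY = this
      define Z where "Z x = Y x / m" for x
      have YZ: "Y = (\<lambda>x. m * Z x)" using m by (auto simp: Z_def)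
      from PY have "?P (\<lambda>x. m * Z x)" unfolding YZ .
      then have "?Q Z" unfolding PQ[of Z] .
      then show "\<exists>Y. ?Q Y" by (rule exI[of _ Z])
    next
      assume "\<exists>Y. ?Q Y"
      then obtain Y where "?Q Y" by (rule exE)
      then have "?P (\<lambda>x. m * Y x)" unfolding PQ[of Y] .
      then show "\<exists>Y. ?P Y" by (rule exI[of _ "\<lambda>x. m * Y x"])
    qed
  qed
  show ?thesis
    unfolding heat_concave_def tilt_concave_def by (rule ball_cong[OF refl]) (rule eq)
qed

text \<open>Replacing the weight \<open>exp (2 m V)\<close> by the smaller exponent multiplies it by a nonincreasing
  function of \<open>x \<ge> 0\<close>, which preserves the sign of the integrals; and the
  coefficient of \<open>\<beta>\<^sup>2\<close> decreases because \<open>V\<^sub>x V\<^sub>x\<^sub>x \<ge> 0\<close>.\<close>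
lemma tilt_concave_mono:
  assumes I: "open I" and V: "tame I V" and le: "m' \<le> m" and conc: "tilt_concave I m V"
  shows "tilt_concave I m' V"
  unfolding tilt_concave_def
proof
  fix t assume t: "t \<in> I"
  note S = tameD(1)[OF V]
  obtain Y where Y: "Y 0 = 0" "\<And>x. (Y has_real_derivative exp (2 * m * V x t) * dt (dt V) x t) (at x)"
    and neg: "\<And>x \<beta>. 0 \<le> x \<Longrightarrow> Y x + exp (2 * m * V x t) * (2 * \<beta> * dx (dt V) x t
         + \<beta>\<^sup>2 * (dx (dx (dx V)) x t + 2 * m * (dx V x t * dx (dx V) x t))) \<le> 0"
    using conc t unfolding tilt_concave_def by blast
  have "continuous_on UNIV (\<lambda>x. exp (2 * m' * V x t) * dt (dt V) x t)"
    by (intro continuous_intros Smooth_continuous[OF _ t] S Smooth_dt)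
  then obtain Z where Z: "\<And>x. (Z has_real_derivative exp (2 * m' * V x t) * dt (dt V) x t) (at x)" "Z 0 = 0"
    using antiderivative_exists by blast
  \<comment> \<open>The ratio of the two weights; nonincreasing for \<open>x \<ge> 0\<close>.\<close>
  define E where "E x = exp (2 * (m' - m) * V x t)" for x
  have Ee: "E x * exp (2 * m * V x t) = exp (2 * m' * V x t)" for x
    unfolding E_def by (simp add: algebra_simps flip: exp_add)
  have dE: "(E has_real_derivative E x * (2 * (m' - m) * dx V x t)) (at x)" for x
    unfolding E_def by (rule derivative_eq_intros Smooth_DERIV_x[OF S t] refl)+ simp
  have "Z x \<le> E x * Y x" if x: "0 \<le> x" for x
  proof -
    have "Z x - E x * Y x \<le> Z 0 - E 0 * Y 0"
      using x
    proof (rule DERIV_nonpos_imp_nonincreasing)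
      fix y :: real assume "0 \<le> y"
      have "((\<lambda>x. Z x - E x * Y x) has_real_derivative 2 * (m - m') * (dx V y t * (E y * Y y))) (at y)"
        by (rule derivative_eq_intros Z(1) dE Y(2) refl)+ (simp only: Ee[symmetric], simp add: algebra_simps)
      moreover have "2 * (m - m') * (dx V y t * (E y * Y y)) \<le> 0"
        using le tame_dx_nonneg[OF V t \<open>0 \<le> y\<close>] neg[OF \<open>0 \<le> y\<close>, of 0]
        by (intro mult_nonneg_nonpos) (auto simp: E_def)
      ultimately show "\<exists>d. ((\<lambda>x. Z x - E x * Y x) has_real_derivative d) (at y) \<and> d \<le> 0" by blast
    qed
    then show ?thesis using Y Z by simp
  qed
  moreover have "E x * Y x + exp (2 * m' * V x t) * (2 * \<beta> * dx (dt V) x t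
         + \<beta>\<^sup>2 * (dx (dx (dx V)) x t + 2 * m' * (dx V x t * dx (dx V) x t))) \<le> 0" if x: "0 \<le> x" for x \<beta>
  proof -
    have "E x * (Y x + exp (2 * m * V x t) * (2 * \<beta> * dx (dt V) x t
         + \<beta>\<^sup>2 * (dx (dx (dx V)) x t + 2 * m * (dx V x t * dx (dx V) x t)))) \<le> 0"
      using neg[OF x] by (intro mult_nonneg_nonpos) (auto simp: E_def)
    then have 1: "E x * Y x + exp (2 * m' * V x t) * (2 * \<beta> * dx (dt V) x t
         + \<beta>\<^sup>2 * (dx (dx (dx V)) x t + 2 * m * (dx V x t * dx (dx V) x t))) \<le> 0"
      by (simp add: distrib_left[of "E x"] mult.assoc[symmetric] Ee)
    have "m' * (dx V x t * dx (dx V) x t) \<le> m * (dx V x t * dx (dx V) x t)"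
      using le tame_dx_nonneg[OF V t x] tameD(5)[OF V t, of x] by (intro mult_right_mono) auto
    then have "exp (2 * m' * V x t) * (2 * \<beta> * dx (dt V) x t
         + \<beta>\<^sup>2 * (dx (dx (dx V)) x t + 2 * m' * (dx V x t * dx (dx V) x t)))
       \<le> exp (2 * m' * V x t) * (2 * \<beta> * dx (dt V) x t
         + \<beta>\<^sup>2 * (dx (dx (dx V)) x t + 2 * m * (dx V x t * dx (dx V) x t)))"
      by (intro mult_left_mono add_left_mono) auto
    with 1 show ?thesis by linarith
  qed
  ultimately show "\<exists>Y. Y 0 = 0 \<and>
     (\<forall>x. (Y has_real_derivative exp (2 * m' * V x t) * dt (dt V) x t) (at x)) \<and>
     (\<forall>x\<ge>0. \<forall>\<beta>. Y x + exp (2 * m' * V x t) * (2 * \<beta> * dx (dt V) x t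
         + \<beta>\<^sup>2 * (dx (dx (dx V)) x t + 2 * m' * (dx V x t * dx (dx V) x t))) \<le> 0)"
    using Z by (intro exI[of _ Z]) (auto intro: order_trans[OF add_right_mono])
qed

text \<open>Lowering \<open>m\<close> changes \<open>curv\<close> by \<open>(m - m') V\<^sub>x\<^sup>2\<close>, and \<open>V\<close> is 1-Lipschitz.\<close>
lemma slope_bound_mono:
  assumes V: "tame I V" and le: "m' \<le> m" and sb: "slope_bound I m e c L V"
  shows "slope_bound I m' e c (L + (m - m') * \<bar>e\<bar>) V"
  unfolding slope_bound_def
proof (intro ballI allI)
  fix t x assume t: "t \<in> I"
  have sq: "(dx V x t)\<^sup>2 \<le> 1"
    using tameD(4)[OF V t, of x] by (simp add: abs_square_le_1)
  have "dt V x t + e * curv m' V x t - c = (dt V x t + e * curv m V x t - c) - (m - m') * (dx V x t)\<^sup>2 * e"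
    by (simp add: curv_def algebra_simps)
  moreover have "\<bar>(m - m') * (dx V x t)\<^sup>2 * e\<bar> \<le> (m - m') * 1 * \<bar>e\<bar>"
    unfolding abs_mult using le sq by (intro mult_mono) auto
  moreover have "\<bar>dt V x t + e * curv m V x t - c\<bar> \<le> L"
    using sb t unfolding slope_bound_def by blast
  ultimately show "\<bar>dt V x t + e * curv m' V x t - c\<bar> \<le> L + (m - m') * \<bar>e\<bar>"
    by linarith
qed

text \<open>For \<open>V = log cosh\<close> the generator at \<open>m = 1\<close> is constant, \<open>V\<^sub>x\<^sub>x + V\<^sub>x\<^sup>2 = 1\<close>, and nothing depends on
  \<open>t\<close>. This is where the special form of the terminal function enters.\<close>
lemma terminal_invariants:
  assumes I: "open I"
  defines "V \<equiv> \<lambda>x (t::real). ln (cosh x)"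
  shows "tame I V" "tilt_concave I 1 V" "slope_bound I 1 e e 0 V"
proof -
  have hp: "has_partials (\<lambda>x t. g x) (\<lambda>x t. g' x) (\<lambda>x t. 0) J"
    if "\<And>x. (g has_real_derivative g' x) (at x)" for g g' :: "real \<Rightarrow> real" and J
    unfolding has_partials_def
  proof (intro allI ballI)
    fix x t :: real
    have A: "(fst has_derivative fst) (at (x, t))"
      by (rule has_derivative_fst[OF has_derivative_ident])
    have B: "(g has_derivative (*) (g' x)) (at (fst (x, t)))"
      using that[of x] by (simp add: has_field_derivative_def)
    from has_derivative_compose[OF A B]
    have "((\<lambda>p. g (fst p)) has_derivative (\<lambda>h. g' x * fst h)) (at (x, t))" .
    then show "((\<lambda>p. g (fst p)) has_derivative (\<lambda>h. g' x * fst h + 0 * snd h)) (at (x, t))" by simp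
  qed
  have dtanh: "(tanh has_real_derivative 1 - (tanh x)\<^sup>2) (at x)" for x :: real
    by (rule DERIV_cong[OF has_field_derivative_tanh[OF _ DERIV_ident]]) simp_all
  have dlc: "((\<lambda>x. ln (cosh x)) has_real_derivative tanh x) (at x)" for x :: real
    using cosh_real_pos[of x] by (auto intro!: derivative_eq_intros simp: tanh_def)
  have tanh_abs: "\<bar>tanh x\<bar> \<le> 1" for x :: real
    using tanh_real_lt_1[of x] tanh_real_gt_neg1[of x] by linarith
  have ubt: "ubd I (\<lambda>x t. tanh x)"
    by (rule ubd_mono[OF ubd_const[of I 1]]) (use tanh_abs in simp)
  have st: "smooth I n (\<lambda>x t. tanh x)" for n
  proof (induction n)
    case (Suc n)
    have "smooth I n (\<lambda>x t. 1 + (- 1) * (tanh x * tanh x))"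
      by (intro smooth_add smooth_mult smooth_const Suc I)
    then have "smooth I n (\<lambda>x t. 1 - (tanh x)\<^sup>2)" by (simp add: power2_eq_square)
    then show ?case
      by (intro smooth_SucI[OF I ubt hp[OF dtanh]] smooth_const I)
  qed (use ubt in simp)
  have lc: "0 \<le> ln (cosh x)" "ln (cosh x) \<le> \<bar>x\<bar>" for x :: real
  proof -
    show "0 \<le> ln (cosh x)" using cosh_real_ge_1[of x] by simp
    have "cosh x \<le> exp \<bar>x\<bar>"
      by (cases "x \<ge> 0") (auto simp: cosh_def)
    then have "ln (cosh x) \<le> ln (exp \<bar>x\<bar>)"
      using cosh_real_pos[of x] by (subst ln_le_cancel_iff) auto
    then show "ln (cosh x) \<le> \<bar>x\<bar>" by simp
  qed
  have "\<bar>ln (cosh x)\<bar> \<le> exp \<bar>x\<bar>" for x :: real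
    using lc[of x] exp_ge_add_one_self[of "\<bar>x\<bar>"] by linarith
  then have ubV: "ubd I V" unfolding V_def ubd_def
    by (intro exI[of _ 1]) auto
  have SV: "Smooth I V"
    unfolding V_def
    by (rule SmoothI[OF I ubV[unfolded V_def] hp[OF dlc]])
      (use st smooth_const[OF I] in \<open>auto simp: Smooth_def\<close>)
  have x1: "dx V x t = tanh x" for x t unfolding V_def by (rule dxI) (rule dlc)
  have x2: "dx (dx V) x t = 1 - (tanh x)\<^sup>2" for x t
    by (rule dxI) (use dtanh x1 in \<open>simp add: x1[abs_def]\<close>)
  have x3: "dx (dx (dx V)) x t = - 2 * (tanh x * (1 - (tanh x)\<^sup>2))" for x t
  proof (rule dxI)
    have "((\<lambda>x. 1 - (tanh x)\<^sup>2) has_real_derivative - 2 * (tanh x * (1 - (tanh x)\<^sup>2))) (at x)"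
      by (rule derivative_eq_intros dtanh refl)+ simp
    then show "((\<lambda>x. dx (dx V) x t) has_real_derivative - 2 * (tanh x * (1 - (tanh x)\<^sup>2))) (at x)"
      by (simp add: x2)
  qed
  have t1: "dt V x t = 0" for x t unfolding V_def by (rule dtI) simp
  have t2: "dx (dt V) x t = 0" "dt (dt V) x t = 0" for x t
    by (rule dxI dtI, simp add: t1[abs_def])+
  have sq: "(tanh x)\<^sup>2 \<le> 1" for x :: real
    using tanh_abs[of x] by (simp add: abs_square_le_1)
  have Vx: "V x t = ln (cosh x)" for x t by (simp add: V_def)
  show "tame I V" unfolding tame_def
    using SV lc(1) sq tanh_abs Vx by (simp add: x1 x2)
  show "tilt_concave I 1 V" unfolding tilt_concave_def
    by (intro ballI exI[of _ "\<lambda>_. 0"]) (simp add: x1 x2 x3 t2 algebra_simps)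
  show "slope_bound I 1 e e 0 V" unfolding slope_bound_def
    by (simp add: curv_def x1 x2 t1)
qed


lemma heat_concave_cong:
  assumes I: "open I" and eq: "\<And>x t. t \<in> I \<Longrightarrow> f x t = g x t" and conc: "heat_concave I f"
  shows "heat_concave I g"
proof -
  have ex: "dx u x t = dx v x t" if "\<And>x t. t \<in> I \<Longrightarrow> u x t = v x t" "t \<in> I" for u v x t
    by (rule dx_eq) (use that in blast)
  have et: "dt u x t = dt v x t" if "\<And>x t. t \<in> I \<Longrightarrow> u x t = v x t" "t \<in> I" for u v x t
    by (rule dt_eq[OF I that(2)]) (use that in blast)
  note e1 = ex[of f g, OF eq] et[of f g, OF eq]
  note e2 = ex[of "dx f" "dx g", OF e1(1)] ex[of "dt f" "dt g", OF e1(2)] et[of "dt f" "dt g", OF e1(2)]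
  note e3 = ex[of "dx (dx f)" "dx (dx g)", OF e2(1)]
  show ?thesis
    using conc unfolding heat_concave_def by (simp add: eq e1 e2 e3)
qed

context
  fixes I :: "real set" and d :: "real \<Rightarrow> real" and a b D :: real
  assumes I: "open I"
    and d: "\<And>t. d t = a + b * t" "\<And>t. t \<in> I \<Longrightarrow> 0 < d t" "\<And>t. t \<in> I \<Longrightarrow> d t \<le> D"
begin

text \<open>The substitution \<open>\<phi> = exp (m V)\<close> linearises the step. Convexity in \<open>x\<close> and the Lipschitz bound survive
  because they are linear inequalities for \<open>\<phi>\<close>: \<open>\<phi>\<^sub>x\<^sub>x + 2 \<gamma> \<phi>\<^sub>x + \<gamma>\<^sup>2 \<phi> \<ge> 0\<close> for all \<open>\<gamma>\<close>, and
  \<open>|\<phi>\<^sub>x| \<le> m \<phi>\<close>. Likewise the bound on the slope is a bound of \<open>\<phi>\<^sub>t + e \<phi>\<^sub>x\<^sub>x - m c \<phi>\<close> by \<open>m L \<phi>\<close>.\<close>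
lemma hopf_cole_step:
  fixes V :: "real \<Rightarrow> real \<Rightarrow> real" and m :: real
  assumes m: "0 < m" and V: "tame I V" and conc: "tilt_concave I m V" and sb: "slope_bound I m e c L V"
  defines "W \<equiv> \<lambda>x t. ln (heat d (\<lambda>x t. exp (m * V x t)) x t) / m"
  shows "tame I W" "tilt_concave I m W" "slope_bound I m (e - b) c L W"
proof -
  define \<phi> where "\<phi> x t = exp (m * V x t)" for x t
  define h where "h = heat d \<phi>"
  have W: "W x t = ln (h x t) / m" for x t by (simp add: W_def h_def \<phi>_def[abs_def])
  have S\<phi>: "Smooth I \<phi>" unfolding \<phi>_def[abs_def] using Smooth_exp_tame[OF I V] m by simp
  have even: "\<phi> (- x) t = \<phi> x t" if "t \<in> I" for x t using tameD(2)[OF V that] by (simp add: \<phi>_def)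
  have ge1: "1 \<le> \<phi> x t" if "t \<in> I" for x t using tameD(3)[OF V that] m by (simp add: \<phi>_def)
  have Sh: "Smooth I h" unfolding h_def by (rule Smooth_heat_step[OF I d S\<phi>])
  have hge1: "1 \<le> h x t" if t: "t \<in> I" for x t
    using heat_mono[OF Smooth_const[OF I] S\<phi> t, of 1 d x] ge1[OF t] by (simp add: h_def heat_const)
  have hpos: "0 < h x t" if "t \<in> I" for x t using hge1[OF that, of x] by simp
  have SW: "Smooth I W"
  proof -
    have hp: "has_partials (\<lambda>x t. ln (h x t) / m) (\<lambda>x t. (inverse (h x t) * (1 / m)) * dx h x t)
        (\<lambda>x t. (inverse (h x t) * (1 / m)) * dt h x t) I"
      by (intro has_partials_comp Smooth_partials Sh)
        (use hpos m in \<open>auto intro!: derivative_eq_intros simp: field_simps\<close>)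
    have ub: "ubd I (\<lambda>x t. ln (h x t) / m)"
    proof (rule ubd_mono)
      show "ubd I (\<lambda>x t. h x t * (1 / m))" by (intro ubd_mult ubd_const Smooth_ubd Sh)
      show "\<bar>ln (h x t) / m\<bar> \<le> \<bar>h x t * (1 / m)\<bar>" if "t \<in> I" for x t
        using hge1[OF that, of x] ln_bound[of "h x t"] ln_ge_zero[of "h x t"] m
        by (simp add: abs_mult abs_divide divide_right_mono)
    qed
    have "Smooth I (\<lambda>x t. ln (h x t) / m)"
      by (rule SmoothI[OF I ub hp]; intro Smooth_mult Smooth_inverse Smooth_const Smooth_dx Smooth_dt I Sh hge1)
    then show ?thesis by (simp add: W[abs_def])
  qed
  have eW: "exp (m * W x t) = h x t" if "t \<in> I" for x t
    using hpos[OF that, of x] m by (simp add: W)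
  have "heat_concave I \<phi>" unfolding \<phi>_def[abs_def]
    using heat_concave_exp_iff[OF I tameD(1)[OF V] m] conc by simp
  then have "heat_concave I h" unfolding h_def
    by (intro heat_concave_heat[OF I d] S\<phi> even ge1)
  then have "heat_concave I (\<lambda>x t. exp (m * W x t))"
    by (rule heat_concave_cong[OF I, rotated]) (simp add: eW)
  then show "tilt_concave I m W"
    using heat_concave_exp_iff[OF I SW m] by simp
  have Vd: "dx \<phi> x t = \<phi> x t * (m * dx V x t)" "dx (dx \<phi>) x t = \<phi> x t * (m * curv m V x t)"
    "dt \<phi> x t = \<phi> x t * (m * dt V x t)" if "t \<in> I" for x t
    unfolding \<phi>_def[abs_def] by (rule exp_derivatives[OF I tameD(1)[OF V] that])+
  have Wd: "dx h x t = h x t * (m * dx W x t)" "dx (dx h) x t = h x t * (m * curv m W x t)"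
    "dt h x t = h x t * (m * dt W x t)" if t: "t \<in> I" for x t
  proof -
    let ?e = "\<lambda>x t. exp (m * W x t)"
    have 1: "dx h x t = dx ?e x t" for x by (rule dx_eq) (simp add: eW[OF t])
    have 2: "dx (dx h) x t = dx (dx ?e) x t" by (rule dx_eq) (rule 1)
    have 3: "dt h x t = dt ?e x t" by (rule dt_eq[OF I t]) (simp add: eW)
    show "dx h x t = h x t * (m * dx W x t)" "dx (dx h) x t = h x t * (m * curv m W x t)"
      "dt h x t = h x t * (m * dt W x t)"
      unfolding 1 2 3 exp_derivatives[OF I SW t] by (simp_all add: eW[OF t])
  qed
  have hx: "dx h x t = heat d (dx \<phi>) x t" "dx (dx h) x t = heat d (dx (dx \<phi>)) x t"
    "dt h x t = heat d (\<lambda>x t. dt \<phi> x t + b * dx (dx \<phi>) x t) x t" if "t \<in> I" for x t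
    unfolding h_def using dx_heat[OF I d S\<phi> that] dx_dx_heat[OF I d S\<phi> that] dt_heat[OF I d S\<phi> that] by auto
  have Sc: "Smooth I (\<lambda>x t. k * f x t)" if "Smooth I f" for k f
    by (intro Smooth_mult Smooth_const I that)
  note Sd = Smooth_dx[OF S\<phi>] Smooth_dx[OF Smooth_dx[OF S\<phi>]] Smooth_dt[OF S\<phi>]
  show "tame I W" unfolding tame_def
  proof (intro conjI ballI allI SW)
    fix t x assume t: "t \<in> I"
    show "W (- x) t = W x t"
      unfolding W h_def using heat_even[OF S\<phi> t even[OF t]] by simp
    show "0 \<le> W x t" unfolding W using hge1[OF t, of x] m by simp
    have b1: "\<bar>dx \<phi> x t\<bar> \<le> m * \<phi> x t" for x
      using tameD(4)[OF V t, of x] m ge1[OF t, of x]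
      by (simp add: Vd[OF t] abs_mult mult_left_le)
    have "heat d (dx \<phi>) x t \<le> heat d (\<lambda>x t. m * \<phi> x t) x t"
      using b1 by (intro heat_mono[OF Sd(1) Sc[OF S\<phi>] t]) (simp add: abs_le_iff)
    moreover have "heat d (\<lambda>x t. (- m) * \<phi> x t) x t \<le> heat d (dx \<phi>) x t"
    proof (rule heat_mono[OF Sc[OF S\<phi>] Sd(1) t])
      show "- m * \<phi> x t \<le> dx \<phi> x t" for x using b1[of x] by (simp add: abs_le_iff)
    qed
    ultimately have "\<bar>dx h x t\<bar> \<le> m * h x t"
      unfolding hx(1)[OF t] heat_cmult h_def[symmetric] by (simp add: abs_le_iff)
    then show "\<bar>dx W x t\<bar> \<le> 1"
      unfolding Wd[OF t] abs_mult using hpos[OF t, of x] m by simp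
    have "(- dx h x t)\<^sup>2 \<le> (- dx (dx h) x t) * (- h x t)"
    proof (rule square_le_of_quadratic_nonpos)
      fix \<gamma> :: real
      have g: "Smooth I (\<lambda>x t. 2 * \<gamma> * dx \<phi> x t + \<gamma>\<^sup>2 * \<phi> x t)"
        by (intro Smooth_add[OF I] Sc S\<phi> Sd)
      have "heat d (\<lambda>x t. 0) x t \<le> heat d (\<lambda>x t. dx (dx \<phi>) x t + (2 * \<gamma> * dx \<phi> x t + \<gamma>\<^sup>2 * \<phi> x t)) x t"
      proof (rule heat_mono[OF Smooth_const[OF I] Smooth_add[OF I Sd(2) g] t])
        fix x
        have "dx (dx \<phi>) x t + (2 * \<gamma> * dx \<phi> x t + \<gamma>\<^sup>2 * \<phi> x t)
            = \<phi> x t * (m * dx (dx V) x t + (m * dx V x t + \<gamma>)\<^sup>2)"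
          by (simp add: Vd[OF t] curv_def power2_eq_square algebra_simps)
        also have "\<dots> \<ge> 0"
          using ge1[OF t, of x] tameD(5)[OF V t, of x] m by (intro mult_nonneg_nonneg add_nonneg_nonneg) auto
        finally show "0 \<le> dx (dx \<phi>) x t + (2 * \<gamma> * dx \<phi> x t + \<gamma>\<^sup>2 * \<phi> x t)" .
      qed
      then show "- dx (dx h) x t + 2 * \<gamma> * - dx h x t + \<gamma>\<^sup>2 * - h x t \<le> 0"
        unfolding heat_add[OF Sd(2) g t] heat_add[OF Sc[OF Sd(1)] Sc[OF S\<phi>] t] heat_cmult heat_const
          hx(1,2)[OF t, symmetric] h_def[symmetric]
        by simp
    qed
    then have "(h x t * h x t * m) * (m * (dx W x t)\<^sup>2) \<le> (h x t * h x t * m) * curv m W x t"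
      unfolding Wd[OF t] by (simp add: power2_eq_square algebra_simps)
    then show "0 \<le> dx (dx W) x t"
      using hpos[OF t, of x] m by (simp add: curv_def)
  qed
  show "slope_bound I m (e - b) c L W" unfolding slope_bound_def
  proof (intro ballI allI)
    fix t x assume t: "t \<in> I"
    let ?u = "\<lambda>x t. dt \<phi> x t + b * dx (dx \<phi>) x t"
    let ?v = "\<lambda>x t. (e - b) * dx (dx \<phi>) x t + (- (m * c)) * \<phi> x t"
    have Su: "Smooth I ?u" by (rule Smooth_generator[OF I d S\<phi>])
    have Sv: "Smooth I ?v" by (intro Smooth_add[OF I] Sc S\<phi> Sd)
    have eq: "heat d (\<lambda>x t. ?u x t + ?v x t) x t = h x t * (m * (dt W x t + (e - b) * curv m W x t - c))"
      unfolding heat_add[OF Su Sv t] heat_add[OF Sc[OF Sd(2)] Sc[OF S\<phi>] t] heat_cmult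
        hx(2,3)[OF t, symmetric] h_def[symmetric] Wd[OF t]
      by (simp add: algebra_simps)
    have bd: "\<bar>?u x t + ?v x t\<bar> \<le> (m * L) * \<phi> x t" for x
    proof -
      have "?u x t + ?v x t = (\<phi> x t * m) * (dt V x t + e * curv m V x t - c)"
        by (simp add: Vd[OF t] algebra_simps)
      moreover have "\<bar>dt V x t + e * curv m V x t - c\<bar> \<le> L"
        using sb t unfolding slope_bound_def by blast
      ultimately show ?thesis
        using ge1[OF t, of x] m by (simp add: abs_mult mult_left_mono mult_ac)
    qed
    have "heat d (\<lambda>x t. ?u x t + ?v x t) x t \<le> heat d (\<lambda>x t. (m * L) * \<phi> x t) x t"
      using bd by (intro heat_mono[OF Smooth_add[OF I Su Sv] Sc[OF S\<phi>] t]) (simp only: abs_le_iff)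
    moreover have "heat d (\<lambda>x t. (- (m * L)) * \<phi> x t) x t \<le> heat d (\<lambda>x t. ?u x t + ?v x t) x t"
    proof (rule heat_mono[OF Sc[OF S\<phi>] Smooth_add[OF I Su Sv] t])
      show "- (m * L) * \<phi> x t \<le> ?u x t + ?v x t" for x
        using bd[of x] by (simp only: abs_le_iff mult_minus_left) linarith
    qed
    moreover have "\<bar>X\<bar> \<le> k * y" if "X \<le> k * y" "- k * y \<le> X" for X k y :: real
      using that by auto
    ultimately have "\<bar>h x t * (m * (dt W x t + (e - b) * curv m W x t - c))\<bar> \<le> (m * L) * h x t"
      unfolding eq heat_cmult h_def[symmetric] by blast
    then have "(h x t * m) * \<bar>dt W x t + (e - b) * curv m W x t - c\<bar> \<le> (h x t * m) * L"
      using hpos[OF t, of x] m by (simp add: abs_mult mult_ac)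
    then show "\<bar>dt W x t + (e - b) * curv m W x t - c\<bar> \<le> L"
      using hpos[OF t, of x] m by simp
  qed
qed

text \<open>The second derivative is the Gaussian average of the derivative of an odd function \<open>K\<close> that is
  nonpositive on the positive half-line; by integration by parts it is a positive multiple of the
  average of \<open>K(r z) z \<le> 0\<close>.\<close>
lemma gaussian_average_concave:
  fixes V :: "real \<Rightarrow> real \<Rightarrow> real"
  assumes V: "tame I V" and conc: "tilt_concave I 0 V" and sb: "slope_bound I 0 b c L V" and t: "t \<in> I"
  shows "((\<lambda>t. heat d V 0 t) has_real_derivative dt (heat d V) 0 t) (at t)"
    and "((\<lambda>t. dt (heat d V) 0 t) has_real_derivative dt (dt (heat d V)) 0 t) (at t)"
    and "dt (dt (heat d V)) 0 t \<le> 0"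
    and "\<bar>dt (heat d V) 0 t - c\<bar> \<le> L"
proof -
  note S = tameD(1)[OF V]
  have Sh: "Smooth I (heat d V)" by (rule Smooth_heat_step[OF I d S])
  show "((\<lambda>t. heat d V 0 t) has_real_derivative dt (heat d V) 0 t) (at t)"
    "((\<lambda>t. dt (heat d V) 0 t) has_real_derivative dt (dt (heat d V)) 0 t) (at t)"
    by (intro Smooth_DERIV_t[OF _ t] Sh Smooth_dt)+
  let ?u = "\<lambda>x t. dt V x t + b * dx (dx V) x t"
  have Su: "Smooth I ?u" by (rule Smooth_generator[OF I d S])
  have bd: "\<bar>?u x t - c\<bar> \<le> L" for x
    using sb t unfolding slope_bound_def curv_def by simp
  have "heat d ?u 0 t \<le> heat d (\<lambda>x t. c + L) 0 t"
  proof (rule heat_mono[OF Su Smooth_const[OF I] t])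
    show "?u x t \<le> c + L" for x using bd[of x] by linarith
  qed
  moreover have "heat d (\<lambda>x t. c - L) 0 t \<le> heat d ?u 0 t"
  proof (rule heat_mono[OF Smooth_const[OF I] Su t])
    show "c - L \<le> ?u x t" for x using bd[of x] by linarith
  qed
  moreover have "dt (heat d V) 0 t = heat d ?u 0 t" by (rule dt_heat[OF I d S t])
  ultimately show "\<bar>dt (heat d V) 0 t - c\<bar> \<le> L"
    unfolding heat_const by linarith
  obtain Y where Y: "Y 0 = 0" "\<And>x. (Y has_real_derivative dt (dt V) x t) (at x)"
    and neg: "\<And>x \<beta>. 0 \<le> x \<Longrightarrow> Y x + (2 * \<beta> * dx (dt V) x t + \<beta>\<^sup>2 * dx (dx (dx V)) x t) \<le> 0"
  proof -
    obtain Y where "Y 0 = 0" "\<And>x. (Y has_real_derivative exp (2 * 0 * V x t) * dt (dt V) x t) (at x)"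
      "\<And>x \<beta>. 0 \<le> x \<Longrightarrow> Y x + exp (2 * 0 * V x t) * (2 * \<beta> * dx (dt V) x t
         + \<beta>\<^sup>2 * (dx (dx (dx V)) x t + 2 * 0 * (dx V x t * dx (dx V) x t))) \<le> 0"
      using conc t unfolding tilt_concave_def by blast
    then show ?thesis by (intro that[of Y]) simp_all
  qed
  define K where "K x = Y x + (2 * b * dx (dt V) x t + b\<^sup>2 * dx (dx (dx V)) x t)" for x
  define k where "k x = dt (dt V) x t + 2 * b * dx (dx (dt V)) x t + b\<^sup>2 * dx (dx (dx (dx V))) x t" for x
  have dK: "(K has_real_derivative k x) (at x)" for x
    unfolding K_def[abs_def] k_def add.assoc
    by (intro DERIV_add DERIV_cmult Y(2) Smooth_DERIV_x[OF _ t] Smooth_dx Smooth_dt S)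
  have ev: "dt (dt V) (- x) t = dt (dt V) x t" for x
    by (rule dt_even[OF I t], rule dt_even[OF I], assumption, rule tameD(2)[OF V])
  have o1: "dx (dt V) (- x) t = - dx (dt V) x t" for x
    by (rule dx_odd[OF Smooth_dt[OF S] t], rule dt_even[OF I t], rule tameD(2)[OF V])
  have o3: "dx (dx (dx V)) (- x) t = - dx (dx (dx V)) x t" for x
    by (rule dx_odd[OF Smooth_dx[OF Smooth_dx[OF S]] t], rule dx_even[OF Smooth_dx[OF S] t],
        rule dx_odd[OF S t], rule tameD(2)[OF V t])
  have oddK: "K (- x) = - K x" for x
    using even_antiderivative_odd[OF Y(2,1) ev] o1 o3 by (simp add: K_def)
  have Kneg: "K x * x \<le> 0" for x
  proof (cases "0 \<le> x")
    case True
    then have "K x \<le> 0" using neg[of x b] by (simp add: K_def)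
    then show ?thesis using True by (rule mult_nonpos_nonneg)
  next
    case False
    then have "K (- x) \<le> 0" using neg[of "- x" b] by (simp add: K_def)
    then have "0 \<le> K x" using oddK by simp
    then show ?thesis using False by (intro mult_nonneg_nonpos) auto
  qed
  define r where "r = sqrt (2 * d t)"
  have r: "0 < r" using d(2)[OF t] by (simp add: r_def)
  have ek: "expbd k" unfolding k_def
    by (intro expbd_add expbd_mult expbd_const Smooth_expbd[OF _ t] Smooth_dx Smooth_dt S)
  have K0: "K 0 = 0" using oddK[of 0] by simp
  have eK: "expbd K" by (rule expbd_antiderivative[OF dK K0 ek])
  have sc: "expbd (\<lambda>z. f (r * z))" if "expbd f" for f
    using expbd_section[OF expbd2_affine[OF that, of 0 0 r], of 0] by simp
  have "(\<integral>z. K (r * z) / r * z \<partial>gauss) = (\<integral>z. k (r * z) \<partial>gauss)"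
  proof (rule gaussian_integration_by_parts_expbd)
    show "((\<lambda>z. K (r * z) / r) has_real_derivative k (r * z)) (at z)" for z
      using r by (intro DERIV_cong[OF DERIV_cdivide[OF DERIV_chain2[OF dK]]]) (auto intro!: derivative_eq_intros)
    have "continuous_on UNIV k"
      unfolding k_def by (intro continuous_intros Smooth_continuous[OF _ t] Smooth_dx Smooth_dt S)
    then show "continuous_on UNIV (\<lambda>z. k (r * z))"
      by (rule continuous_on_compose2) (auto intro!: continuous_intros)
    show "expbd (\<lambda>z. K (r * z) / r)"
      using expbd_mult[OF sc[OF eK] expbd_const[of "1 / r"]] by simp
  qed (rule sc[OF ek])
  moreover have "(\<integral>z. k (r * z) \<partial>gauss) = dt (dt (heat d V)) 0 t"
    by (rule trans[OF _ dt_dt_heat[OF I d S t, symmetric]]) (simp add: heat_def k_def r_def)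
  moreover have "0 \<le> (\<integral>z. - (K (r * z) / r * z) \<partial>gauss)"
  proof (rule Bochner_Integration.integral_nonneg)
    fix z
    have "r * (K (r * z) * z) \<le> 0"
      using Kneg[of "r * z"] by (simp add: mult_ac)
    then have "K (r * z) * z \<le> 0" using r by (simp add: mult_le_0_iff)
    then show "0 \<le> - (K (r * z) / r * z)" using r by (simp add: divide_le_0_iff)
  qed
  ultimately show "dt (dt (heat d V)) 0 t \<le> 0" by simp
qed

end

section \<open>The recursion along a list of breakpoints\<close>

text \<open>The operator \<open>T_op\<close> with the Brownian motion rescaled to a standard Gaussian variable, which covers
  \<open>d = 0\<close> by the same formula and exhibits the heat semigroup.\<close>
definition gauss_T :: "real \<Rightarrow> real \<Rightarrow> (real \<Rightarrow> real) \<Rightarrow> real \<Rightarrow> real" where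
  "gauss_T m d f x =
     (if m = 0 then (\<integral>z. f (x + sqrt (2 * d) * z) \<partial>gauss)
      else ln (\<integral>z. exp (m * f (x + sqrt (2 * d) * z)) \<partial>gauss) / m)"

lemma integral_brownian_law:
  fixes g :: "real \<Rightarrow> real"
  assumes [measurable]: "g \<in> borel_measurable borel" and t: "0 \<le> t"
  shows "(\<integral>b. g b \<partial>brownian_law t) = (\<integral>z. g (sqrt t * z) \<partial>gauss)"
proof (cases "t = 0")
  case True
  then show ?thesis
    using gauss.prob_space by (simp add: brownian_law_def integral_return)
next
  case False
  with t have t: "0 < t" by simp
  define s where "s = sqrt t"
  have s: "0 < s" using t by (simp add: s_def)
  have "(\<integral>b. g b \<partial>brownian_law t) = (\<integral>b. normal_density 0 s b * g b \<partial>lborel)"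
    using False by (simp add: brownian_law_def s_def integral_density)
  also have "\<dots> = (\<integral>z. s * (normal_density 0 s (s * z) * g (s * z)) \<partial>lborel)"
    using lborel_integral_real_affine[of s "\<lambda>b. normal_density 0 s b * g b" 0] s by simp
  also have "\<dots> = (\<integral>z. std_normal_density z * g (s * z) \<partial>lborel)"
  proof (rule Bochner_Integration.integral_cong[OF refl])
    fix z
    have "s * normal_density 0 s (s * z) = std_normal_density z"
      using s by (simp add: normal_density_def real_sqrt_mult power_mult_distrib field_simps)
    then show "s * (normal_density 0 s (s * z) * g (s * z)) = std_normal_density z * g (s * z)"
      by (simp add: mult.assoc[symmetric])
  qed
  also have "\<dots> = (\<integral>z. g (s * z) \<partial>gauss)"
    by (rule integral_gauss[symmetric]) simp
  finally show ?thesis by (simp add: s_def)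
qed

lemma T_op_eq_gauss_T:
  assumes [measurable]: "f \<in> borel_measurable borel" and "0 \<le> d"
  shows "T_op m d f x = gauss_T m d f x"
  unfolding T_op_def gauss_T_def using assms(2) by (subst (1 2) integral_brownian_law) auto

lemma gauss_T_zero_time: "gauss_T m 0 f = f"
  using gauss.prob_space by (auto simp: gauss_T_def)

text \<open>This class is stable under every step of the recursion, also at heat time \<open>0\<close>, where smoothness in
  the parameter may fail.\<close>
definition slow :: "(real \<Rightarrow> real) \<Rightarrow> bool" where
  "slow f \<longleftrightarrow> (\<forall>x. 0 \<le> f x) \<and> (\<forall>x y. \<bar>f x - f y\<bar> \<le> \<bar>x - y\<bar>)"

lemma slow_le: "slow f \<Longrightarrow> f y \<le> f x + \<bar>x - y\<bar>"
  unfolding slow_def by (smt (verit))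

lemma slow_measurable [measurable_dest]:
  assumes "slow f" shows "f \<in> borel_measurable borel"
proof (rule borel_measurable_continuous_onI)
  have "1-lipschitz_on UNIV f"
    by (rule lipschitz_onI) (use assms in \<open>auto simp: slow_def dist_real_def\<close>)
  then show "continuous_on UNIV f" by (rule lipschitz_on_continuous_on)
qed

lemma slow_bounds:
  assumes "slow f"
  shows "\<bar>f (x + r * z)\<bar> \<le> (f 0 + \<bar>x\<bar>) + \<bar>r\<bar> * \<bar>z\<bar>"
  using slow_le[OF assms, of "x + r * z" 0] assms abs_triangle_ineq[of x "r * z"]
  by (auto simp: slow_def abs_mult)

lemma slow_integrable:
  assumes f: "slow f" and m: "0 \<le> m"
  shows "integrable gauss (\<lambda>z. f (x + r * z))" and "integrable gauss (\<lambda>z. exp (m * f (x + r * z)))"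
proof -
  note [measurable] = slow_measurable[OF f]
  have e: "(f 0 + \<bar>x\<bar>) + \<bar>r\<bar> * \<bar>z\<bar> \<le> exp (f 0 + \<bar>x\<bar>) * exp (\<bar>r\<bar> * \<bar>z\<bar>)" for z
    using exp_ge_add_one_self[of "(f 0 + \<bar>x\<bar>) + \<bar>r\<bar> * \<bar>z\<bar>"] unfolding exp_add[symmetric] by linarith
  show "integrable gauss (\<lambda>z. f (x + r * z))"
    by (rule integrable_gauss_bound[OF _ order_trans[OF slow_bounds[OF f] e]]) measurable
  have b: "\<bar>exp (m * f (x + r * z))\<bar> \<le> exp (m * (f 0 + \<bar>x\<bar>)) * exp (m * \<bar>r\<bar> * \<bar>z\<bar>)" for z
  proof -
    have "f (x + r * z) \<le> (f 0 + \<bar>x\<bar>) + \<bar>r\<bar> * \<bar>z\<bar>" using slow_bounds[OF f, of x r z] by linarith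
    from mult_left_mono[OF this m] show ?thesis by (simp add: algebra_simps flip: exp_add)
  qed
  show "integrable gauss (\<lambda>z. exp (m * f (x + r * z)))"
    by (rule integrable_gauss_bound[OF _ b]) measurable
qed

lemma integral_exp_ge_1:
  assumes f: "slow f" and m: "0 \<le> m"
  shows "1 \<le> (\<integral>z. exp (m * f (x + r * z)) \<partial>gauss)"
proof -
  have "(\<integral>z. 1 \<partial>gauss) \<le> (\<integral>z. exp (m * f (x + r * z)) \<partial>gauss)"
    using f m by (intro Bochner_Integration.integral_mono slow_integrable) (auto simp: slow_def)
  then show ?thesis using gauss.prob_space by simp
qed

lemma gauss_T_slow:
  assumes f: "slow f" and m: "0 \<le> m"
  shows "slow (gauss_T m d f)"
proof -
  let ?r = "sqrt (2 * d)"
  have nonneg: "0 \<le> gauss_T m d f x" for x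
    unfolding gauss_T_def using f m integral_exp_ge_1[OF f m]
    by (auto simp: slow_def intro!: Bochner_Integration.integral_nonneg divide_nonneg_nonneg)
  have le: "gauss_T m d f y \<le> gauss_T m d f x + \<bar>x - y\<bar>" for x y
  proof (cases "m = 0")
    case True
    have "(\<integral>z. f (y + ?r * z) \<partial>gauss) \<le> (\<integral>z. f (x + ?r * z) + \<bar>x - y\<bar> \<partial>gauss)"
    proof (rule Bochner_Integration.integral_mono)
      show "f (y + ?r * z) \<le> f (x + ?r * z) + \<bar>x - y\<bar>" for z
        using slow_le[OF f, of "y + ?r * z" "x + ?r * z"] by simp
    qed (use slow_integrable(1)[OF f, of 0] in auto)
    then show ?thesis
      using True slow_integrable(1)[OF f, of 0] gauss.prob_space by (simp add: gauss_T_def)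
  next
    case False
    with m have m0: "0 < m" by simp
    let ?A = "\<lambda>x. \<integral>z. exp (m * f (x + ?r * z)) \<partial>gauss"
    have "?A y \<le> (\<integral>z. exp (m * \<bar>x - y\<bar>) * exp (m * f (x + ?r * z)) \<partial>gauss)"
    proof (rule Bochner_Integration.integral_mono)
      show "exp (m * f (y + ?r * z)) \<le> exp (m * \<bar>x - y\<bar>) * exp (m * f (x + ?r * z))" for z
        using mult_left_mono[OF slow_le[OF f, of "y + ?r * z" "x + ?r * z"] m]
        by (simp add: algebra_simps flip: exp_add)
    qed (use slow_integrable(2)[OF f m] in auto)
    then have "?A y \<le> exp (m * \<bar>x - y\<bar>) * ?A x" by simp
    then have "ln (?A y) \<le> ln (exp (m * \<bar>x - y\<bar>) * ?A x)"
      using integral_exp_ge_1[OF f m, of y ?r] integral_exp_ge_1[OF f m, of x ?r]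
      by (subst ln_le_cancel_iff) auto
    also have "\<dots> = m * \<bar>x - y\<bar> + ln (?A x)"
      using integral_exp_ge_1[OF f m, of x ?r] by (subst ln_mult) auto
    finally show ?thesis using m0 by (simp add: gauss_T_def field_simps)
  qed
  show ?thesis unfolding slow_def
    using nonneg le[of _ _] by (auto simp: abs_le_iff) (metis abs_minus_commute add.commute le diff_le_eq)+
qed

text \<open>Equicontinuity of \<open>1\<close>-Lipschitz functions upgrades pointwise convergence to convergence along moving
  arguments, and boundedness at \<open>0\<close> supplies an exponential dominating function.\<close>
lemma gauss_T_tendsto:
  assumes f: "\<And>n. slow (f n)" "slow g" and lim: "\<And>x. (\<lambda>n. f n x) \<longlonglongrightarrow> g x"
    and m: "0 \<le> m" and d: "(\<lambda>n. d n) \<longlonglongrightarrow> e"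
  shows "(\<lambda>n. gauss_T m (d n) (f n) x) \<longlonglongrightarrow> gauss_T m e g x"
proof -
  note [measurable] = slow_measurable[OF f(1)] slow_measurable[OF f(2)]
  define r where "r n = sqrt (2 * d n)" for n
  define R where "R = sqrt (2 * e)"
  have rR: "r \<longlonglongrightarrow> R" unfolding r_def[abs_def] R_def by (intro tendsto_intros d)
  have pt: "(\<lambda>n. f n (x + r n * z)) \<longlonglongrightarrow> g (x + R * z)" for z
  proof -
    have "(\<lambda>n. f n (x + r n * z) - f n (x + R * z)) \<longlonglongrightarrow> 0"
    proof (rule Lim_null_comparison)
      have "\<bar>f n (x + r n * z) - f n (x + R * z)\<bar> \<le> \<bar>r n * z - R * z\<bar>" for n
        using f(1)[of n] unfolding slow_def by (metis add_diff_cancel_left)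
      then show "eventually (\<lambda>n. norm (f n (x + r n * z) - f n (x + R * z)) \<le> \<bar>r n * z - R * z\<bar>) sequentially"
        by simp
      have "(\<lambda>n. r n * z - R * z) \<longlonglongrightarrow> R * z - R * z" by (intro tendsto_intros rR)
      then show "(\<lambda>n. \<bar>r n * z - R * z\<bar>) \<longlonglongrightarrow> 0" by (simp add: tendsto_rabs_zero)
    qed
    from tendsto_add[OF this lim[of "x + R * z"]] show ?thesis by simp
  qed
  obtain B where B: "\<And>n. \<bar>f n 0\<bar> \<le> B"
    using convergent_imp_Bseq[OF convergentI[OF lim[of 0]]] by (auto simp: Bseq_def)
  obtain Q where Q: "\<And>n. \<bar>r n\<bar> \<le> Q"
    using convergent_imp_Bseq[OF convergentI[OF rR]] by (auto simp: Bseq_def)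
  have bd: "f n (x + r n * z) \<le> (B + \<bar>x\<bar>) + Q * \<bar>z\<bar>" for n z
    using slow_bounds[OF f(1), of n x "r n" z] B[of n] mult_right_mono[OF Q[of n], of "\<bar>z\<bar>"] by linarith
  have Bge: "0 \<le> B" "0 \<le> Q" using B[of 0] Q[of 0] by linarith+
  have nn: "0 \<le> f n y" for n y using f(1)[of n] by (simp add: slow_def)
  show ?thesis
  proof (cases "m = 0")
    case True
    have "(\<lambda>n. \<integral>z. f n (x + r n * z) \<partial>gauss) \<longlonglongrightarrow> (\<integral>z. g (x + R * z) \<partial>gauss)"
    proof (rule integral_dominated_convergence)
      have "(B + \<bar>x\<bar>) + Q * \<bar>z\<bar> \<le> exp (B + \<bar>x\<bar>) * exp (Q * \<bar>z\<bar>)" for z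
        using exp_ge_add_one_self[of "(B + \<bar>x\<bar>) + Q * \<bar>z\<bar>"] unfolding exp_add[symmetric] by linarith
      then show "AE z in gauss. norm (f n (x + r n * z)) \<le> exp (B + \<bar>x\<bar>) * exp (Q * \<bar>z\<bar>)" for n
        using order_trans[OF bd] nn by (intro AE_I2) (simp add: abs_of_nonneg)
      show "integrable gauss (\<lambda>z. exp (B + \<bar>x\<bar>) * exp (Q * \<bar>z\<bar>))"
        using integrable_gauss_exp_abs by simp
    qed (use pt in auto)
    then show ?thesis using True by (simp add: gauss_T_def r_def R_def)
  next
    case False
    have "(\<lambda>n. \<integral>z. exp (m * f n (x + r n * z)) \<partial>gauss) \<longlonglongrightarrow> (\<integral>z. exp (m * g (x + R * z)) \<partial>gauss)"
    proof (rule integral_dominated_convergence)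
      show "AE z in gauss. norm (exp (m * f n (x + r n * z))) \<le> exp (m * (B + \<bar>x\<bar>)) * exp (m * Q * \<bar>z\<bar>)" for n
      proof (intro AE_I2)
        fix z
        show "norm (exp (m * f n (x + r n * z))) \<le> exp (m * (B + \<bar>x\<bar>)) * exp (m * Q * \<bar>z\<bar>)"
          using mult_left_mono[OF bd[of n z] m] by (simp add: algebra_simps flip: exp_add)
      qed
      show "integrable gauss (\<lambda>z. exp (m * (B + \<bar>x\<bar>)) * exp (m * Q * \<bar>z\<bar>))"
        using integrable_gauss_exp_abs by simp
      show "AE z in gauss. (\<lambda>n. exp (m * f n (x + r n * z))) \<longlonglongrightarrow> exp (m * g (x + R * z))"
        by (intro AE_I2 tendsto_intros pt)
    qed auto
    then have "(\<lambda>n. ln (\<integral>z. exp (m * f n (x + r n * z)) \<partial>gauss) / m)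
        \<longlonglongrightarrow> ln (\<integral>z. exp (m * g (x + R * z)) \<partial>gauss) / m"
      using integral_exp_ge_1[OF f(2) m, of x R] False by (intro tendsto_intros) auto
    then show ?thesis using False by (simp add: gauss_T_def r_def R_def)
  qed
qed

text \<open>The recursion, read along the list of breakpoints from the left; \<open>p\<close> is the value of the path
  before the first breakpoint of the list. Values are looked up in \<open>q\<close>, so that refining
  the breakpoints leaves the other arguments unchanged.\<close>
fun parisi_list :: "(real \<Rightarrow> real) \<Rightarrow> real \<Rightarrow> real list \<Rightarrow> real \<Rightarrow> real" where
  "parisi_list q p [] = (\<lambda>x. ln (cosh x))"
| "parisi_list q p (m # ms) = gauss_T m (q m - p) (parisi_list q (q m) ms)"

lemma slow_ln_cosh: "slow (\<lambda>x. ln (cosh x))"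
proof -
  have dlc: "((\<lambda>x. ln (cosh x)) has_real_derivative tanh x) (at x)" for x :: real
    using cosh_real_pos[of x] by (auto intro!: derivative_eq_intros simp: tanh_def)
  have "norm (ln (cosh x) - ln (cosh y)) \<le> 1 * norm (x - y)" for x y :: real
  proof (rule field_differentiable_bound[of UNIV "\<lambda>x. ln (cosh x)" tanh])
    show "norm (tanh z) \<le> 1" for z :: real
      using tanh_real_lt_1[of z] tanh_real_gt_neg1[of z] by simp
  qed (use dlc in auto)
  then show ?thesis unfolding slow_def using cosh_real_ge_1 by (auto intro!: ln_ge_zero)
qed

lemma slow_parisi_list: "(\<And>m. m \<in> set ms \<Longrightarrow> 0 \<le> m) \<Longrightarrow> slow (parisi_list q p ms)"
  by (induction ms arbitrary: p) (auto intro: slow_ln_cosh gauss_T_slow)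

lemma parisi_list_tendsto:
  "(\<And>m. m \<in> set ms \<Longrightarrow> 0 \<le> m) \<Longrightarrow> (\<And>m. m \<in> set ms \<Longrightarrow> (\<lambda>n. q n m) \<longlonglongrightarrow> r m) \<Longrightarrow> p \<longlonglongrightarrow> p' \<Longrightarrow>
   (\<lambda>n. parisi_list (q n) (p n) ms x) \<longlonglongrightarrow> parisi_list r p' ms x"
proof (induction ms arbitrary: p p' x)
  case (Cons m ms)
  have "(\<lambda>n. parisi_list (q n) (q n m) ms y) \<longlonglongrightarrow> parisi_list r (r m) ms y" for y
    by (rule Cons.IH) (use Cons.prems in auto)
  then have "(\<lambda>n. gauss_T m (q n m - p n) (parisi_list (q n) (q n m) ms) x)
      \<longlonglongrightarrow> gauss_T m (r m - p') (parisi_list r (r m) ms) x"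
    by (intro gauss_T_tendsto slow_parisi_list tendsto_diff) (use Cons.prems in auto)
  then show ?case by simp
qed simp

fun increasing_above :: "(real \<Rightarrow> real) \<Rightarrow> real \<Rightarrow> real list \<Rightarrow> bool" where
  "increasing_above q p [] = True"
| "increasing_above q p (m # ms) = (p < q m \<and> increasing_above q (q m) ms)"

text \<open>The first breakpoint of a remaining list, or the right end \<open>1\<close> of the interval when none is left.\<close>
fun next_level :: "real list \<Rightarrow> real" where
  "next_level [] = 1"
| "next_level (m # ms) = m"

fun weighted_norm :: "(real \<Rightarrow> real) \<Rightarrow> real list \<Rightarrow> real" where
  "weighted_norm w [] = 0"
| "weighted_norm w (m # ms) = (next_level ms - m) * \<bar>w m\<bar> + weighted_norm w ms"

fun last_value :: "(real \<Rightarrow> real) \<Rightarrow> real \<Rightarrow> real list \<Rightarrow> real" where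
  "last_value q p [] = p"
| "last_value q p (m # ms) = last_value q (q m) ms"

text \<open>Induction from the right end: the terminal function has the invariants at level \<open>1\<close>, and each
  breakpoint first lowers the level to its own position and then performs one step. The gap between the
  levels is the weight with which the direction \<open>w\<close> enters the slope bound.\<close>
lemma parisi_list_along_segment:
  fixes v w :: "real \<Rightarrow> real"
  assumes I: "open I" "I \<subseteq> {-1<..<2}"
  shows "sorted_wrt (<) ms \<Longrightarrow> (\<And>m. m \<in> set ms \<Longrightarrow> 0 < m \<and> m < 1) \<Longrightarrow>
    (\<And>t. t \<in> I \<Longrightarrow> increasing_above (\<lambda>m. v m + t * w m) (p + t * p') ms) \<Longrightarrow>
    tame I (\<lambda>x t. parisi_list (\<lambda>m. v m + t * w m) (p + t * p') ms x) \<and>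
    tilt_concave I (next_level ms) (\<lambda>x t. parisi_list (\<lambda>m. v m + t * w m) (p + t * p') ms x) \<and>
    slope_bound I (next_level ms) p' (last_value w p' ms) (weighted_norm w ms)
      (\<lambda>x t. parisi_list (\<lambda>m. v m + t * w m) (p + t * p') ms x)"
proof (induction ms arbitrary: p p')
  case Nil
  then show ?case using terminal_invariants[OF I(1)] by simp
next
  case (Cons m ms)
  let ?V = "\<lambda>x t. parisi_list (\<lambda>m. v m + t * w m) (v m + t * w m) ms x"
  define d where "d t = (v m - p) + (w m - p') * t" for t
  have m: "0 < m" "m < 1" using Cons.prems(2) by auto
  have le: "m \<le> next_level ms" using Cons.prems by (cases ms) auto
  have inc: "increasing_above (\<lambda>m. v m + t * w m) (v m + t * w m) ms" "p + t * p' < v m + t * w m"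
    if "t \<in> I" for t using Cons.prems(3)[OF that] by auto
  have IH: "tame I ?V" "tilt_concave I (next_level ms) ?V"
    "slope_bound I (next_level ms) (w m) (last_value w (w m) ms) (weighted_norm w ms) ?V"
    using Cons.IH[of "v m" "w m"] Cons.prems inc by auto
  have conc: "tilt_concave I m ?V" by (rule tilt_concave_mono[OF I(1) IH(1) le IH(2)])
  have sb: "slope_bound I m (w m) (last_value w p' (m # ms)) (weighted_norm w (m # ms)) ?V"
    using slope_bound_mono[OF IH(1) le IH(3)] by (simp add: add.commute)
  have d: "d t = (v m - p) + (w m - p') * t" "t \<in> I \<Longrightarrow> 0 < d t"
    "t \<in> I \<Longrightarrow> d t \<le> \<bar>v m - p\<bar> + 2 * \<bar>w m - p'\<bar>" for t
  proof -
    show "d t = (v m - p) + (w m - p') * t" by (simp add: d_def)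
    assume t: "t \<in> I"
    show "0 < d t" using inc(2)[OF t] by (simp add: d_def algebra_simps)
    have "t \<in> {-1<..<2}" using I(2) t by blast
    then have "\<bar>t\<bar> \<le> 2" by (simp add: abs_le_iff)
    then have "\<bar>(w m - p') * t\<bar> \<le> \<bar>w m - p'\<bar> * 2" unfolding abs_mult by (intro mult_left_mono) auto
    then show "d t \<le> \<bar>v m - p\<bar> + 2 * \<bar>w m - p'\<bar>" by (simp add: d_def)
  qed
  have "parisi_list (\<lambda>m. v m + t * w m) (p + t * p') (m # ms) x = ln (heat d (\<lambda>x t. exp (m * ?V x t)) x t) / m"
    for x t
  proof -
    have "v m + t * w m - (p + t * p') = d t" by (simp add: d_def algebra_simps)
    then show ?thesis using m by (simp add: gauss_T_def heat_def)
  qed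
  then have eq: "(\<lambda>x t. parisi_list (\<lambda>m. v m + t * w m) (p + t * p') (m # ms) x)
      = (\<lambda>x t. ln (heat d (\<lambda>x t. exp (m * ?V x t)) x t) / m)"
    by (intro ext)
  show ?case
    using hopf_cole_step[OF I(1) d m(1) IH(1) conc sb] unfolding eq by simp
qed

lemma open_increasing_above: "open {t. increasing_above (\<lambda>m. v m + t * w m) (p + t * p') ms}"
proof (induction ms arbitrary: p p')
  case (Cons m ms)
  have "{t. increasing_above (\<lambda>m. v m + t * w m) (p + t * p') (m # ms)}
      = {t. p + t * p' < v m + t * w m} \<inter> {t. increasing_above (\<lambda>m. v m + t * w m) (v m + t * w m) ms}"
    by auto
  also have "open \<dots>"
    by (intro open_Int Cons.IH open_Collect_less continuous_intros)
  finally show ?case .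
qed simp

lemma increasing_above_segment:
  assumes t: "0 \<le> t" "t \<le> 1"
  shows "increasing_above (\<lambda>m. v m + 0 * w m) (p + 0 * p') ms \<Longrightarrow>
   increasing_above (\<lambda>m. v m + 1 * w m) (p + 1 * p') ms \<Longrightarrow>
   increasing_above (\<lambda>m. v m + t * w m) (p + t * p') ms"
proof (induction ms arbitrary: p p')
  case (Cons m ms)
  have "0 < (1 - t) * (v m - p) + t * ((v m + w m) - (p + p'))"
  proof (cases "t = 0")
    case False
    then show ?thesis using Cons.prems t by (intro add_nonneg_pos mult_nonneg_nonneg mult_pos_pos) auto
  qed (use Cons.prems in auto)
  then have "p + t * p' < v m + t * w m" by (simp add: algebra_simps)
  then show ?case using Cons.IH[of "v m" "w m"] Cons.prems by auto
qed simp

text \<open>Strictly increasing values keep all heat times positive on an open interval around the segment, where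
  the recursion is smooth in the parameter. The first breakpoint is \<open>0\<close>, so the last step is a plain
  Gaussian average, evaluated at \<open>0\<close>.\<close>
lemma parisi_list_concave_strict:
  fixes q0 q1 :: "real \<Rightarrow> real"
  assumes ms: "sorted_wrt (<) (0 # ms)" "\<And>m. m \<in> set ms \<Longrightarrow> m < 1"
    and q: "increasing_above q0 0 (0 # ms)" "increasing_above q1 0 (0 # ms)"
  defines "F \<equiv> \<lambda>q. parisi_list q 0 (0 # ms) 0"
  shows "0 \<le> l \<Longrightarrow> l \<le> 1 \<Longrightarrow> (1 - l) * F q0 + l * F q1 \<le> F (\<lambda>m. (1 - l) * q0 m + l * q1 m)"
    and "\<bar>(F q1 - last_value q1 0 (0 # ms)) - (F q0 - last_value q0 0 (0 # ms))\<bar>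
      \<le> weighted_norm (\<lambda>m. q1 m - q0 m) (0 # ms)"
proof -
  define w where "w m = q1 m - q0 m" for m
  define Q where "Q t m = q0 m + t * w m" for t m
  \<comment> \<open>An open set of parameters that contains the segment; it is bounded so that heat times are bounded.\<close>
  define I where "I = {-1<..<2} \<inter> {t. increasing_above (Q t) (0 + t * 0) (0 # ms)}"
  have I: "open I" "I \<subseteq> {-1<..<2}"
    unfolding I_def Q_def by (intro open_Int open_greaterThanLessThan open_increasing_above) auto
  have Q01: "Q 0 = q0" "Q 1 = q1" "Q l = (\<lambda>m. (1 - l) * q0 m + l * q1 m)" for l
    by (auto simp: Q_def w_def algebra_simps)
  have Qe: "Q t = (\<lambda>m. q0 m + t * w m)" for t by (simp add: Q_def[abs_def])
  have inI: "t \<in> I" if "0 \<le> t" "t \<le> 1" for t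
  proof -
    have "increasing_above (Q t) (0 + t * 0) (0 # ms)"
      unfolding Q_def
      by (rule increasing_above_segment[OF that]) (use q Q01[unfolded Q_def] in simp_all)
    then show ?thesis using that by (auto simp: I_def)
  qed
  have inc: "0 < Q t 0" "increasing_above (Q t) (Q t 0) ms" if "t \<in> I" for t
    using that by (auto simp: I_def)
  let ?V = "\<lambda>x t. parisi_list (\<lambda>m. q0 m + t * w m) (q0 0 + t * w 0) ms x"
  have V: "tame I ?V" "tilt_concave I (next_level ms) ?V"
    "slope_bound I (next_level ms) (w 0) (last_value w (w 0) ms) (weighted_norm w ms) ?V"
    using parisi_list_along_segment[OF I, of ms q0 w "q0 0" "w 0"] ms inc Qe by auto
  have le: "0 \<le> next_level ms" using ms by (cases ms) auto
  have conc: "tilt_concave I 0 ?V" by (rule tilt_concave_mono[OF I(1) V(1) le V(2)])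
  have sb: "slope_bound I 0 (w 0) (last_value w 0 (0 # ms)) (weighted_norm w (0 # ms)) ?V"
    using slope_bound_mono[OF V(1) le V(3)] by (simp add: add.commute)
  define d where "d t = q0 0 + w 0 * t" for t
  have d: "d t = q0 0 + w 0 * t" "t \<in> I \<Longrightarrow> 0 < d t" "t \<in> I \<Longrightarrow> d t \<le> \<bar>q0 0\<bar> + 2 * \<bar>w 0\<bar>" for t
  proof -
    show "d t = q0 0 + w 0 * t" by (simp add: d_def)
    assume t: "t \<in> I"
    show "0 < d t" using inc(1)[OF t] by (simp add: d_def Q_def mult.commute)
    have "t \<in> {-1<..<2}" using I(2) t by blast
    then have "\<bar>t\<bar> \<le> 2" by (simp add: abs_le_iff)
    then have "\<bar>w 0 * t\<bar> \<le> \<bar>w 0\<bar> * 2" unfolding abs_mult by (intro mult_left_mono) auto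
    then show "d t \<le> \<bar>q0 0\<bar> + 2 * \<bar>w 0\<bar>" by (simp add: d_def)
  qed
  have FH: "F (Q t) = heat d ?V 0 t" for t
    by (simp add: F_def gauss_T_def heat_def Q_def[abs_def] d_def mult.commute)
  define F1 where "F1 t = dt (heat d ?V) 0 t" for t
  define F2 where "F2 t = dt (dt (heat d ?V)) 0 t" for t
  have D: "((\<lambda>t. F (Q t)) has_real_derivative F1 t) (at t)" "(F1 has_real_derivative F2 t) (at t)"
    "F2 t \<le> 0" "\<bar>F1 t - last_value w 0 (0 # ms)\<bar> \<le> weighted_norm w (0 # ms)" if "t \<in> I" for t
    using gaussian_average_concave[OF I(1) d V(1) conc sb that] by (simp_all add: FH F1_def[abs_def] F2_def)
  show "(1 - l) * F q0 + l * F q1 \<le> F (\<lambda>m. (1 - l) * q0 m + l * q1 m)" if l: "0 \<le> l" "l \<le> 1"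
  proof -
    have "convex_on {0..1} (\<lambda>t. - F (Q t))"
    proof (rule f''_ge0_imp_convex)
      fix t :: real assume "t \<in> {0..1}"
      then have t: "t \<in> I" using inI by simp
      show "((\<lambda>t. - F (Q t)) has_real_derivative - F1 t) (at t)" by (rule DERIV_minus[OF D(1)[OF t]])
      show "((\<lambda>t. - F1 t) has_real_derivative - F2 t) (at t)" by (rule DERIV_minus[OF D(2)[OF t]])
      show "0 \<le> - F2 t" using D(3)[OF t] by simp
    qed simp
    from convex_onD[OF this, of l 0 1] l have "- F (Q l) \<le> (1 - l) * - F (Q 0) + l * - F (Q 1)" by simp
    then show ?thesis by (simp add: Q01)
  qed
  have lv: "last_value w (b - a) xs = last_value q1 b xs - last_value q0 a xs" for a b xs
    by (induction xs arbitrary: a b) (simp_all add: w_def)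
  have "\<exists>t>0. t < 1 \<and> (F (Q 1) - 1 * last_value w 0 (0 # ms)) - (F (Q 0) - 0 * last_value w 0 (0 # ms))
      = (1 - 0) * (F1 t - last_value w 0 (0 # ms))"
    by (rule MVT2) (use D(1) inI in \<open>auto intro!: derivative_eq_intros\<close>)
  then obtain t where t: "0 < t" "t < 1" "F q1 - last_value w 0 (0 # ms) - F q0 = F1 t - last_value w 0 (0 # ms)"
    by (auto simp: Q01)
  then show "\<bar>(F q1 - last_value q1 0 (0 # ms)) - (F q0 - last_value q0 0 (0 # ms))\<bar>
      \<le> weighted_norm (\<lambda>m. q1 m - q0 m) (0 # ms)"
    using D(4)[OF inI[of t]] lv[of 0 0 "0 # ms"] unfolding w_def[abs_def, symmetric]
    by simp
qed

text \<open>Adding the strictly increasing function \<open>e (1 + m)\<close> to both paths reduces the claim to the strict case;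
  the perturbation cancels in the difference of the paths, and \<open>e\<close> tends to \<open>0\<close>.\<close>
lemma parisi_list_concave:
  fixes q0 q1 :: "real \<Rightarrow> real"
  assumes ms: "sorted_wrt (<) (0 # ms)" "\<And>m. m \<in> set ms \<Longrightarrow> m < 1"
    and q0: "0 \<le> q0 0" "mono_on {0..<1} q0" and q1: "0 \<le> q1 0" "mono_on {0..<1} q1"
  defines "F \<equiv> \<lambda>q. parisi_list q 0 (0 # ms) 0"
  shows "0 \<le> l \<Longrightarrow> l \<le> 1 \<Longrightarrow> (1 - l) * F q0 + l * F q1 \<le> F (\<lambda>m. (1 - l) * q0 m + l * q1 m)"
    and "\<bar>(F q1 - last_value q1 0 (0 # ms)) - (F q0 - last_value q0 0 (0 # ms))\<bar>
      \<le> weighted_norm (\<lambda>m. q1 m - q0 m) (0 # ms)"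
proof -
  define e where "e n = 1 / real (Suc n)" for n
  have e: "0 < e n" for n by (simp add: e_def)
  have elim: "e \<longlonglongrightarrow> 0" unfolding e_def by (rule LIMSEQ_Suc[OF lim_1_over_n])
  define P where "P q n m = q m + e n * (1 + m)" for q :: "real \<Rightarrow> real" and n m
  have Plim: "(\<lambda>n. P q n m) \<longlonglongrightarrow> q m" for q m
  proof -
    have "(\<lambda>n. q m + e n * (1 + m)) \<longlonglongrightarrow> q m + 0 * (1 + m)" by (intro tendsto_intros elim)
    then show ?thesis by (simp add: P_def)
  qed
  have ms0: "0 \<le> m" if "m \<in> set (0 # ms)" for m using ms that by auto
  have Flim: "(\<lambda>n. F (P q n)) \<longlonglongrightarrow> F q" for q
    unfolding F_def by (rule parisi_list_tendsto) (use ms0 Plim in auto)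
  have inc: "increasing_above (P q n) 0 (0 # ms)" if q: "0 \<le> q 0" "mono_on {0..<1} q" for q n
  proof -
    have gen: "increasing_above (P q n) (P q n a) xs"
      if "sorted_wrt (<) (a # xs)" "\<And>m. m \<in> set (a # xs) \<Longrightarrow> 0 \<le> m \<and> m < 1" for a xs
      using that
    proof (induction xs arbitrary: a)
      case (Cons b xs)
      have "q a \<le> q b" using q(2) Cons.prems by (auto simp: mono_on_def)
      moreover have "e n * (1 + a) < e n * (1 + b)" using Cons.prems e[of n] by simp
      ultimately have "P q n a < P q n b" by (simp add: P_def)
      then show ?case using Cons by auto
    qed simp
    have "increasing_above (P q n) (P q n 0) ms"
      by (rule gen[OF ms(1)]) (use ms(2) ms0 in auto)
    moreover have "0 < P q n 0" using q(1) e[of n] by (simp add: P_def)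
    ultimately show ?thesis by simp
  qed
  show "(1 - l) * F q0 + l * F q1 \<le> F (\<lambda>m. (1 - l) * q0 m + l * q1 m)" if l: "0 \<le> l" "l \<le> 1"
  proof (rule LIMSEQ_le)
    show "(\<lambda>n. (1 - l) * F (P q0 n) + l * F (P q1 n)) \<longlonglongrightarrow> (1 - l) * F q0 + l * F q1"
      by (intro tendsto_intros Flim)
    show "(\<lambda>n. F (P (\<lambda>m. (1 - l) * q0 m + l * q1 m) n)) \<longlonglongrightarrow> F (\<lambda>m. (1 - l) * q0 m + l * q1 m)"
      by (rule Flim)
    have eq: "(\<lambda>m. (1 - l) * P q0 n m + l * P q1 n m) = P (\<lambda>m. (1 - l) * q0 m + l * q1 m) n" for n
      by (auto simp: P_def algebra_simps)
    show "\<exists>N. \<forall>n\<ge>N. (1 - l) * F (P q0 n) + l * F (P q1 n) \<le> F (P (\<lambda>m. (1 - l) * q0 m + l * q1 m) n)"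
      unfolding F_def eq[symmetric]
      using parisi_list_concave_strict(1)[OF ms inc[OF q0] inc[OF q1] l] by blast
  qed
  have lv: "(\<lambda>n. last_value (P q n) (p n) xs) \<longlonglongrightarrow> last_value q p' xs" if "p \<longlonglongrightarrow> p'" for q p p' xs
    using that by (induction xs arbitrary: p p') (auto intro: Plim)
  have lvl: "(\<lambda>n. F (P q n) - last_value (P q n) 0 (0 # ms)) \<longlonglongrightarrow> F q - last_value q 0 (0 # ms)" for q
    by (intro tendsto_diff Flim lv tendsto_const)
  have eq: "(\<lambda>m. P q1 n m - P q0 n m) = (\<lambda>m. q1 m - q0 m)" for n by (auto simp: P_def)
  show "\<bar>(F q1 - last_value q1 0 (0 # ms)) - (F q0 - last_value q0 0 (0 # ms))\<bar>
      \<le> weighted_norm (\<lambda>m. q1 m - q0 m) (0 # ms)"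
  proof (rule LIMSEQ_le_const2)
    show "(\<lambda>n. \<bar>(F (P q1 n) - last_value (P q1 n) 0 (0 # ms)) - (F (P q0 n) - last_value (P q0 n) 0 (0 # ms))\<bar>)
      \<longlonglongrightarrow> \<bar>(F q1 - last_value q1 0 (0 # ms)) - (F q0 - last_value q0 0 (0 # ms))\<bar>"
      by (intro tendsto_rabs tendsto_diff[OF lvl lvl])
    show "\<exists>N. \<forall>n\<ge>N. \<bar>(F (P q1 n) - last_value (P q1 n) 0 (0 # ms)) - (F (P q0 n) - last_value (P q0 n) 0 (0 # ms))\<bar>
        \<le> weighted_norm (\<lambda>m. q1 m - q0 m) (0 # ms)"
    proof (intro exI allI impI)
      fix n
      show "\<bar>(F (P q1 n) - last_value (P q1 n) 0 (0 # ms)) - (F (P q0 n) - last_value (P q0 n) 0 (0 # ms))\<bar>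
        \<le> weighted_norm (\<lambda>m. q1 m - q0 m) (0 # ms)"
        using parisi_list_concave_strict(2)[OF ms inc[OF q0, of n] inc[OF q1, of n]] unfolding F_def eq .
    qed
  qed
qed

section \<open>Step paths, their closure, and convexity\<close>

text \<open>The path is constant between consecutive points of \<open>A\<close>. Describing a representation by a finite set
  instead of by two finite sequences makes common refinements plain unions.\<close>
definition adapted :: "(real \<Rightarrow> real) \<Rightarrow> real set \<Rightarrow> bool" where
  "adapted q A \<longleftrightarrow> finite A \<and> 0 \<in> A \<and> A \<subseteq> {0..<1} \<and> 0 \<le> q 0 \<and> mono_on {0..<1} q \<and>
     (\<forall>u\<in>{0..<1}. \<forall>a\<in>A. a \<le> u \<longrightarrow> (\<forall>b\<in>A. b \<le> u \<longrightarrow> b \<le> a) \<longrightarrow> q u = q a)"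

definition parisi_value :: "(real \<Rightarrow> real) \<Rightarrow> real set \<Rightarrow> real" where
  "parisi_value q A =
     last_value q 0 (sorted_list_of_set A) - parisi_list q 0 (sorted_list_of_set A) 0"

lemma adaptedD:
  assumes "adapted q A"
  shows "finite A" "0 \<in> A" "A \<subseteq> {0..<1}" "0 \<le> q 0" "mono_on {0..<1} q"
  using assms by (simp_all add: adapted_def)

lemma adapted_cell:
  assumes "adapted q A" "u \<in> {0..<1}" "c \<in> A" "c \<le> u" "\<And>b. b \<in> A \<Longrightarrow> b \<le> u \<Longrightarrow> b \<le> c"
  shows "q u = q c"
  using assms unfolding adapted_def by blast

lemma last_filter_less:
  fixes xs :: "real list"
  assumes "sorted xs" "b \<in> set xs" "b < x"
  shows "last (filter (\<lambda>a. a < x) xs) \<in> set xs" "last (filter (\<lambda>a. a < x) xs) < x"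
    "b \<le> last (filter (\<lambda>a. a < x) xs)"
proof -
  let ?f = "filter (\<lambda>a. a < x) xs"
  have b: "b \<in> set ?f" using assms by simp
  then have "last ?f \<in> set ?f" by (intro last_in_set) (metis empty_iff empty_set)
  then show "last ?f \<in> set xs" "last ?f < x" by auto
  have "y \<le> last ys" if "sorted ys" "y \<in> set ys" for y :: real and ys
    using that by (induction ys) auto
  moreover have "sorted ?f" using assms(1) by (rule sorted_wrt_filter)
  ultimately show "b \<le> last ?f" using b by blast
qed

text \<open>At a superfluous breakpoint the path does not jump, so the additional step has heat time \<open>0\<close>.\<close>
lemma parisi_list_insort:
  assumes "sorted xs" "x \<notin> set xs"
    and "q x = (if filter (\<lambda>a. a < x) xs = [] then p else q (last (filter (\<lambda>a. a < x) xs)))"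
  shows "parisi_list q p (insort x xs) = parisi_list q p xs \<and> last_value q p (insort x xs) = last_value q p xs"
  using assms
proof (induction xs arbitrary: p)
  case Nil
  then show ?case by (simp add: gauss_T_zero_time)
next
  case (Cons y ys)
  show ?case
  proof (cases "x \<le> y")
    case True
    then have "filter (\<lambda>a. a < x) (y # ys) = []"
      using Cons.prems(1,2) by (auto simp: filter_empty_conv)
    then have "q x = p" using Cons.prems(3) by simp
    then show ?thesis using True by (simp add: gauss_T_zero_time)
  next
    case False
    then have "q x = (if filter (\<lambda>a. a < x) ys = [] then q y else q (last (filter (\<lambda>a. a < x) ys)))"
      using Cons.prems(3) by simp
    then show ?thesis using Cons.IH[of "q y"] Cons.prems(1,2) False by simp
  qed
qed

lemma adapted_insert:
  assumes A: "adapted q A" and x: "x \<in> {0..<1}"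
  shows "adapted q (insert x A)" "parisi_value q (insert x A) = parisi_value q A"
proof -
  note a = adaptedD[OF A]
  have cell: "q u = q c" if "u \<in> {0..<1}" "c \<in> A" "c \<le> u" "\<And>b. b \<in> A \<Longrightarrow> b \<le> u \<Longrightarrow> b \<le> c" for u c
    using adapted_cell[OF A that] .
  show "adapted q (insert x A)"
    unfolding adapted_def
  proof (intro conjI ballI impI)
    fix u c assume u: "u \<in> {0..<1}" and c: "c \<in> insert x A" "c \<le> u"
      and mx: "\<forall>b\<in>insert x A. b \<le> u \<longrightarrow> b \<le> c"
    show "q u = q c"
    proof (cases "c \<in> A")
      case True
      then show ?thesis using cell[OF u] c mx by blast
    next
      case False
      then have cx: "c = x" using c by simp
      have fin: "finite {b \<in> A. b \<le> u}" "{b \<in> A. b \<le> u} \<noteq> {}" using a u by auto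
      define g where "g = Max {b \<in> A. b \<le> u}"
      have g: "g \<in> A" "g \<le> u" using Max_in[OF fin] by (auto simp: g_def)
      have gm: "b \<le> g" if "b \<in> A" "b \<le> u" for b using that fin by (auto simp: g_def)
      have gx: "g \<le> x" using mx g cx by auto
      have "q u = q g" by (rule cell[OF u g gm])
      moreover have "q x = q g" using c(2) cx by (intro cell[OF x g(1) gx] gm) auto
      ultimately show ?thesis using cx by simp
    qed
  qed (use a x in auto)
  show "parisi_value q (insert x A) = parisi_value q A"
  proof (cases "x \<in> A")
    case False
    let ?L = "sorted_list_of_set A"
    have L: "sorted ?L" "set ?L = A" using a by auto
    have x0: "0 < x" using False x a by (cases "x = 0") auto
    have "filter (\<lambda>a. a < x) ?L \<noteq> []" using x0 L a by (auto simp: filter_empty_conv)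
    moreover have "q x = q (last (filter (\<lambda>a. a < x) ?L))"
    proof (rule cell[OF x])
      have 0: "0 \<in> set ?L" using a L by simp
      show "last (filter (\<lambda>a. a < x) ?L) \<in> A" using last_filter_less(1)[OF L(1) 0 x0] L by simp
      show "last (filter (\<lambda>a. a < x) ?L) \<le> x" using last_filter_less(2)[OF L(1) 0 x0] by simp
      show "b \<le> last (filter (\<lambda>a. a < x) ?L)" if "b \<in> A" "b \<le> x" for b
        using last_filter_less(3)[OF L(1), of b x] that False L by (cases "b = x") auto
    qed
    ultimately have "parisi_list q 0 (insort x ?L) = parisi_list q 0 ?L \<and> last_value q 0 (insort x ?L) = last_value q 0 ?L"
      by (intro parisi_list_insort) (use L False in auto)
    moreover have "sorted_list_of_set (insert x A) = insort x ?L"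
      using a False by (intro sorted_list_of_set.sorted_key_list_of_set_insert) auto
    ultimately show ?thesis by (simp add: parisi_value_def)
  qed (simp add: insert_absorb)
qed

lemma adapted_Un:
  assumes "adapted q A" "finite B" "B \<subseteq> {0..<1}"
  shows "adapted q (A \<union> B) \<and> parisi_value q (A \<union> B) = parisi_value q A"
  using assms(2,3)
proof (induction B rule: finite_induct)
  case (insert x B)
  then have IH: "adapted q (A \<union> B)" "parisi_value q (A \<union> B) = parisi_value q A" by auto
  show ?case using adapted_insert[OF IH(1), of x] IH(2) insert.prems by simp
qed (use assms(1) in simp)

lemma step_repr_less:
  assumes "step_repr q k m v" "i < j" "j \<le> Suc k"
  shows "m i < m j"
  using assms(2,3)
proof (induction j)
  case (Suc j)
  have "m j < m (Suc j)" using assms(1) Suc.prems by (auto simp: step_repr_def)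
  then show ?case using Suc by (cases "i = j") auto
qed simp

lemma indicator_sum_cell:
  fixes m v :: "nat \<Rightarrow> real"
  assumes less: "\<And>i j. i < j \<Longrightarrow> j \<le> Suc k \<Longrightarrow> m i < m j" and i: "i \<le> k" and u: "m i \<le> u" "u < m (Suc i)"
  shows "(\<Sum>j\<le>k. v j * indicator {m j..<m (Suc j)} u) = v i"
proof -
  have "(\<Sum>j\<le>k. v j * indicator {m j..<m (Suc j)} u) = (\<Sum>j\<in>{i}. v j * indicator {m j..<m (Suc j)} u)"
  proof (rule sum.mono_neutral_right)
    show "\<forall>j\<in>{..k} - {i}. v j * indicator {m j..<m (Suc j)} u = 0"
    proof
      fix j assume j: "j \<in> {..k} - {i}"
      have "u \<notin> {m j..<m (Suc j)}"
      proof (cases "j < i")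
        case True
        then have "m (Suc j) \<le> m i" using less[of "Suc j" i] i by (cases "Suc j = i") auto
        then show ?thesis using u by auto
      next
        case False
        then have "i < j" using j by auto
        then have "m (Suc i) \<le> m j" using less[of "Suc i" j] j by (cases "Suc i = j") auto
        then show ?thesis using u by auto
      qed
      then show "v j * indicator {m j..<m (Suc j)} u = 0" by simp
    qed
  qed (use i in auto)
  then show ?thesis using u by simp
qed

lemma cell_exists:
  fixes m :: "nat \<Rightarrow> real"
  assumes "m 0 \<le> u" "u < m (Suc k)"
  shows "\<exists>i\<le>k. m i \<le> u \<and> u < m (Suc i)"
  using assms(2)
proof (induction k)
  case 0
  then show ?case using assms(1) by auto
next
  case (Suc k)
  then show ?case by (cases "u < m (Suc k)") (auto intro: le_SucI)
qed

lemma step_repr_cell: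
  assumes "step_repr q k m v" "i \<le> k" "m i \<le> u" "u < m (Suc i)"
  shows "q u = v i" "u \<in> {0..<1}"
proof -
  have "m 0 \<le> m i" using step_repr_less[OF assms(1), of 0 i] assms(2) by (cases "i = 0") auto
  moreover have "m (Suc i) \<le> m (Suc k)"
    using step_repr_less[OF assms(1), of "Suc i" "Suc k"] assms(2) by (cases "i = k") auto
  ultimately show u: "u \<in> {0..<1}" using assms by (auto simp: step_repr_def)
  then have "q u = (\<Sum>j\<le>k. v j * indicator {m j..<m (Suc j)} u)"
    using assms(1) by (auto simp: step_repr_def)
  also have "\<dots> = v i"
    by (rule indicator_sum_cell) (use assms step_repr_less[OF assms(1)] in auto)
  finally show "q u = v i" .
qed

lemma step_repr_adapted:
  assumes R: "step_repr q k m v"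
  shows "adapted q (m ` {..k})" "v k - parisi_rec k m v 0 0 = parisi_value q (m ` {..k})"
proof -
  note less = step_repr_less[OF R]
  have m0: "m 0 = 0" "m (Suc k) = 1" and v0: "0 \<le> v 0" and vs: "\<And>i. i < k \<Longrightarrow> v i \<le> v (Suc i)"
    using R by (auto simp: step_repr_def)
  have qm: "q (m i) = v i" "m i \<in> {0..<1}" if "i \<le> k" for i
    using step_repr_cell[OF R that order_refl] less[of i "Suc i"] that by auto
  have vmono: "v i \<le> v j" if "i \<le> j" "j \<le> k" for i j
    using that by (induction j rule: dec_induct) (auto intro: order_trans[OF _ vs])
  have cell: "\<exists>i\<le>k. m i \<le> u \<and> u < m (Suc i)" if "u \<in> {0..<1}" for u
    using cell_exists[of m u k] that m0 by auto
  show "adapted q (m ` {..k})"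
    unfolding adapted_def
  proof (intro conjI ballI impI)
    show "0 \<in> m ` {..k}" using m0 by force
    show "0 \<le> q 0" using qm[of 0] m0 v0 by simp
    show "mono_on {0..<1} q"
    proof (rule mono_onI)
      fix r s :: real assume rs: "r \<in> {0..<1}" "s \<in> {0..<1}" "r \<le> s"
      obtain i where i: "i \<le> k" "m i \<le> r" "r < m (Suc i)" using cell[OF rs(1)] by blast
      obtain j where j: "j \<le> k" "m j \<le> s" "s < m (Suc j)" using cell[OF rs(2)] by blast
      have "i \<le> j"
      proof (rule ccontr)
        assume "\<not> i \<le> j"
        then have "m (Suc j) \<le> m i" using less[of "Suc j" i] i by (cases "Suc j = i") auto
        then show False using i j rs by simp
      qed
      then show "q r \<le> q s"
        using vmono[of i j] j(1) step_repr_cell(1)[OF R i] step_repr_cell(1)[OF R j] by simp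
    qed
    fix u a assume u: "u \<in> {0..<1}" and a: "a \<in> m ` {..k}" "a \<le> u"
      and mx: "\<forall>b\<in>m ` {..k}. b \<le> u \<longrightarrow> b \<le> a"
    obtain i where i: "i \<le> k" "m i \<le> u" "u < m (Suc i)" using cell[OF u] by blast
    obtain j where j: "j \<le> k" "a = m j" using a by auto
    have "m i \<le> m j" using mx i j by auto
    then have "i \<le> j" using less[of j i] i by (meson le_SucI not_le)
    moreover have "\<not> i < j"
    proof
      assume "i < j"
      then have "m (Suc i) \<le> m j" using less[of "Suc i" j] j by (cases "Suc i = j") auto
      then show False using i a j by simp
    qed
    ultimately show "q u = q a" using step_repr_cell(1)[OF R i] qm(1)[OF i(1)] j by simp
  qed (use qm in auto)
  have rec: "parisi_rec k m v i = parisi_list q (if i = 0 then 0 else v (i - 1)) (map m [i..<Suc k])"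
    if "i \<le> Suc k" for i
    using that
  proof (induction i rule: inc_induct)
    case base
    then show ?case by (simp add: parisi_rec.simps)
  next
    case (step i)
    then have ik: "i \<le> k" by simp
    let ?p = "if i = 0 then 0 else v (i - 1)"
    have nn: "0 \<le> v i - ?p" using v0 vs[of "i - 1"] ik by (cases i) auto
    have "slow (parisi_list q (v i) (map m [Suc i..<Suc k]))"
      by (rule slow_parisi_list) (use qm(2) in auto)
    note meas = slow_measurable[OF this]
    have "parisi_rec k m v i = T_op (m i) (v i - ?p) (parisi_list q (v i) (map m [Suc i..<Suc k]))"
      using ik step.IH by (subst parisi_rec.simps) simp
    also have "\<dots> = gauss_T (m i) (v i - ?p) (parisi_list q (v i) (map m [Suc i..<Suc k]))"
      by (rule ext) (rule T_op_eq_gauss_T[OF meas nn])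
    also have "\<dots> = parisi_list q ?p (map m [i..<Suc k])"
      using ik qm(1)[OF ik] by (simp add: upt_conv_Cons del: upt_Suc)
    finally show ?case .
  qed
  have L: "sorted_list_of_set (m ` {..k}) = map m [0..<Suc k]"
  proof (rule sorted_list_of_set_unique[THEN iffD1, OF finite_imageI[OF finite_atMost], symmetric, THEN sym])
    show "sorted_wrt (<) (map m [0..<Suc k]) \<and> set (map m [0..<Suc k]) = m ` {..k} \<and> length (map m [0..<Suc k]) = card (m ` {..k})"
    proof (intro conjI)
      show "sorted_wrt (<) (map m [0..<Suc k])"
        unfolding sorted_wrt_map by (rule sorted_wrt_mono_rel[OF _ sorted_wrt_upt]) (use less in auto)
      show "set (map m [0..<Suc k]) = m ` {..k}" by (auto simp: atLeast0LessThan lessThan_Suc_atMost simp del: upt_Suc)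
      have "inj_on m {..k}"
      proof (rule linorder_inj_onI)
        fix i j assume "i < j" "j \<in> {..k}" then show "m i \<noteq> m j" using less[of i j] by auto
      qed auto
      then show "length (map m [0..<Suc k]) = card (m ` {..k})" by (simp add: card_image del: upt_Suc)
    qed
  qed
  have "last_value q p (map m [i..<Suc k]) = v k" if "i \<le> k" for i p
    using that
  proof (induction i arbitrary: p rule: inc_induct)
    case (step i)
    then show ?case by (simp add: upt_conv_Cons del: upt_Suc)
  qed (use qm(1)[of k] in simp)
  from this[of 0 0] show "v k - parisi_rec k m v 0 0 = parisi_value q (m ` {..k})"
    unfolding parisi_value_def L using rec[of 0] by (simp del: upt_Suc)
qed

lemma adapted_step_repr:
  assumes A: "adapted q A"
  shows "\<exists>k m v. step_repr q k m v"
proof -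
  note a = adaptedD[OF A]
  let ?L = "sorted_list_of_set A"
  have L: "sorted_wrt (<) ?L" "set ?L = A" "length ?L = card A" using a by auto
  have c0: "0 < card A" using a by (auto simp: card_gt_0_iff)
  define k where "k = card A - 1"
  have k: "Suc k = card A" using c0 by (simp add: k_def)
  define m where "m i = (if i \<le> k then ?L ! i else 1)" for i
  have mA: "m i \<in> A" if "i \<le> k" for i
    using that L k nth_mem[of i ?L] by (auto simp: m_def)
  have less: "m i < m j" if "i < j" "j \<le> Suc k" for i j
  proof (cases "j \<le> k")
    case True
    then show ?thesis using that sorted_wrt_nth_less[OF L(1), of i j] L k by (auto simp: m_def)
  next
    case False
    then show ?thesis using that mA[of i] a by (auto simp: m_def)
  qed
  have surj: "\<exists>i\<le>k. m i = x" if "x \<in> A" for x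
  proof -
    have "x \<in> set ?L" using that L(2) by simp
    then obtain i where "i < length ?L" "?L ! i = x" unfolding in_set_conv_nth by blast
    then show ?thesis using L(3) k by (intro exI[of _ i]) (simp add: m_def)
  qed
  have m0: "m 0 = 0"
  proof -
    obtain i where i: "i \<le> k" "m i = 0" using surj[of 0] a by auto
    have "m 0 \<ge> 0" using mA[of 0] a by auto
    then show ?thesis using less[of 0 i] i by (cases "i = 0") auto
  qed
  have step: "step_repr q k m (\<lambda>i. q (m i))"
    unfolding step_repr_def
  proof (intro conjI allI impI ballI)
    show "m 0 = 0" by (rule m0)
    show "m (Suc k) = 1" by (simp add: m_def)
    show "m i < m (Suc i)" if "i \<le> k" for i using less[of i "Suc i"] that by simp
    show "0 \<le> q (m 0)" using m0 a by simp
    show "q (m i) \<le> q (m (Suc i))" if "i < k" for i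
    proof -
      have "mono_on {0..<1} q" using a by blast
      then show ?thesis
        by (rule mono_onD) (use mA[of i] mA[of "Suc i"] that less[of i "Suc i"] a in auto)
    qed
    fix u :: real assume u: "u \<in> {0..<1}"
    obtain i where i: "i \<le> k" "m i \<le> u" "u < m (Suc i)"
      using cell_exists[of m u k] u m0 by (auto simp: m_def)
    have "q u = q (m i)"
    proof -
      have "b \<le> m i" if b: "b \<in> A" "b \<le> u" for b
      proof -
        obtain j where j: "j \<le> k" "b = m j" using surj[OF b(1)] by auto
        have "\<not> i < j"
        proof
          assume "i < j"
          then have "m (Suc i) \<le> m j" using less[of "Suc i" j] j by (cases "Suc i = j") auto
          then show False using i b j by simp
        qed
        then show ?thesis using less[of j i] i j by (cases "j = i") auto
      qed
      then show ?thesis by (rule adapted_cell[OF A u mA[OF i(1)] i(2)])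
    qed
    then show "q u = (\<Sum>j\<le>k. q (m j) * indicator {m j..<m (Suc j)} u)"
      using indicator_sum_cell[OF less i, of "\<lambda>i. q (m i)"] by simp
  qed
  then show ?thesis by blast
qed

lemma step_paths_iff: "q \<in> step_paths \<longleftrightarrow> (\<exists>A. adapted q A)"
  unfolding step_paths_def using step_repr_adapted(1) adapted_step_repr by blast

text \<open>Two representations of the same path have a common refinement.\<close>
lemma psi_step_eq:
  assumes A: "adapted q A"
  shows "psi_step q = parisi_value q A"
  unfolding psi_step_def
proof (rule the_equality)
  have val: "v k - parisi_rec k m v 0 0 = parisi_value q A" if R: "step_repr q k m v" for k m v
  proof -
    note B = step_repr_adapted[OF R]
    have "parisi_value q (A \<union> m ` {..k}) = parisi_value q A"
      using adapted_Un[OF A, of "m ` {..k}"] B(1) by (simp add: adapted_def)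
    moreover have "parisi_value q (m ` {..k} \<union> A) = parisi_value q (m ` {..k})"
      using adapted_Un[OF B(1), of A] A by (simp add: adapted_def)
    ultimately show ?thesis using B(2) by (simp add: Un_commute)
  qed
  obtain k m v where R: "step_repr q k m v" using adapted_step_repr[OF A] by blast
  show "\<exists>k m v. step_repr q k m v \<and> parisi_value q A = v k - parisi_rec k m v 0 0"
    using R val[OF R] by metis
  show "L = parisi_value q A" if "\<exists>k m v. step_repr q k m v \<and> L = v k - parisi_rec k m v 0 0" for L
    using that val by auto
qed

lemma integral_eq_weighted_norm:
  fixes f :: "real \<Rightarrow> real"
  assumes "sorted_wrt (<) (a # xs)" "\<And>c. c \<in> set (a # xs) \<Longrightarrow> c < 1"
    and "\<And>u c. a \<le> u \<Longrightarrow> u < 1 \<Longrightarrow> c \<in> set (a # xs) \<Longrightarrow> c \<le> u \<Longrightarrow>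
      (\<And>b. b \<in> set (a # xs) \<Longrightarrow> b \<le> u \<Longrightarrow> b \<le> c) \<Longrightarrow> f u = f c"
  shows "set_integrable lborel {a..<1} f \<and> (LINT u:{a..<1}|lborel. \<bar>f u\<bar>) = weighted_norm f (a # xs)"
  using assms
proof (induction xs arbitrary: a)
  case Nil
  have c: "f u = f a" if "u \<in> {a..<1}" for u
    by (rule Nil.prems(3)) (use that in auto)
  have "set_integrable lborel {a..<1} f \<longleftrightarrow> set_integrable lborel {a..<1} (\<lambda>_. f a)"
    by (rule set_integrable_cong[OF refl refl]) (auto intro!: c)
  moreover have "(LINT u:{a..<1}|lborel. \<bar>f u\<bar>) = (LINT u:{a..<1}|lborel. \<bar>f a\<bar>)"
    by (rule set_lebesgue_integral_cong) (auto intro!: arg_cong[where f = abs] c)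
  moreover have "a < 1" using Nil.prems(2) by simp
  ultimately show ?case by (simp add: set_integrable_def set_lebesgue_integral_def)
next
  case (Cons b ys)
  have ab: "a < b" "b < 1" using Cons.prems(1,2) by auto
  have sb: "\<forall>c\<in>set ys. b < c" using Cons.prems(1) by auto
  have c: "f u = f a" if "u \<in> {a..<b}" for u
  proof (rule Cons.prems(3))
    show "d \<le> a" if d: "d \<in> set (a # b # ys)" "d \<le> u" for d
    proof (rule ccontr)
      assume "\<not> d \<le> a"
      then have "b \<le> d" using d(1) sb by (auto intro: less_imp_le)
      then show False using d(2) \<open>u \<in> {a..<b}\<close> by simp
    qed
  qed (use that ab in auto)
  have IH: "set_integrable lborel {b..<1} f \<and> (LINT u:{b..<1}|lborel. \<bar>f u\<bar>) = weighted_norm f (b # ys)"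
  proof (rule Cons.IH)
    show "sorted_wrt (<) (b # ys)" using Cons.prems(1) by simp
    show "c < 1" if "c \<in> set (b # ys)" for c using that Cons.prems(2) by auto
    fix u c assume u: "b \<le> u" "u < 1" and c: "c \<in> set (b # ys)" "c \<le> u"
      and mx: "\<And>d. d \<in> set (b # ys) \<Longrightarrow> d \<le> u \<Longrightarrow> d \<le> c"
    show "f u = f c"
    proof (rule Cons.prems(3))
      show "d \<le> c" if "d \<in> set (a # b # ys)" "d \<le> u" for d
      proof (cases "d = a")
        case True
        have "b \<le> c" using mx[of b] u by simp
        then show ?thesis using True ab by simp
      qed (use that mx in auto)
    qed (use u c ab in auto)
  qed
  have "set_integrable lborel {a..<b} f \<longleftrightarrow> set_integrable lborel {a..<b} (\<lambda>_. f a)"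
    by (rule set_integrable_cong[OF refl refl]) (auto intro!: c)
  then have i1: "set_integrable lborel {a..<b} f" using ab by (simp add: set_integrable_def)
  have "(LINT u:{a..<b}|lborel. \<bar>f u\<bar>) = (LINT u:{a..<b}|lborel. \<bar>f a\<bar>)"
    by (rule set_lebesgue_integral_cong) (auto intro!: arg_cong[where f = abs] c)
  then have I1: "(LINT u:{a..<b}|lborel. \<bar>f u\<bar>) = (b - a) * \<bar>f a\<bar>"
    using ab by (simp add: set_lebesgue_integral_def)
  have un: "{a..<1} = {a..<b} \<union> {b..<1}" using ab by auto
  show ?case
  proof
    show "set_integrable lborel {a..<1} f"
      unfolding un using i1 IH by (intro set_integrable_Un) auto
    have "(LINT u:{a..<1}|lborel. \<bar>f u\<bar>) = (LINT u:{a..<b}|lborel. \<bar>f u\<bar>) + (LINT u:{b..<1}|lborel. \<bar>f u\<bar>)"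
      unfolding un using i1 IH by (intro set_integral_Un) (auto intro: set_integrable_abs)
    then show "(LINT u:{a..<1}|lborel. \<bar>f u\<bar>) = weighted_norm f (a # b # ys)"
      using I1 IH by simp
  qed
qed

lemma adapted_list:
  assumes "adapted q A"
  obtains ms where "sorted_list_of_set A = 0 # ms" "sorted_wrt (<) (0 # ms)" "\<And>m. m \<in> set ms \<Longrightarrow> m < 1"
proof -
  note a = adaptedD[OF assms]
  let ?L = "sorted_list_of_set A"
  have L: "sorted_wrt (<) ?L" "set ?L = A" using a by auto
  obtain x ms where xs: "?L = x # ms" using L a by (cases ?L) auto
  have "x = 0"
  proof (rule ccontr)
    assume "x \<noteq> 0"
    moreover have "x \<in> A" "0 \<in> set (x # ms)" using L(2) xs a by auto
    ultimately have "0 < x" "x < 0" using a L(1) xs by auto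
    then show False by simp
  qed
  then show ?thesis using L xs a by (intro that[of ms]) auto
qed

lemma adapted_cell_function:
  assumes "adapted q0 A" "adapted q1 A"
    "sorted_list_of_set A = 0 # ms" "sorted_wrt (<) (0 # ms)" "\<And>m. m \<in> set ms \<Longrightarrow> m < 1"
  shows "set_integrable lborel {0..<1} (\<lambda>u. a * q0 u + b * q1 u)"
    "(LINT u:{0..<1}|lborel. \<bar>a * q0 u + b * q1 u\<bar>) = weighted_norm (\<lambda>u. a * q0 u + b * q1 u) (0 # ms)"
proof -
  have setA: "set (0 # ms) = A"
    using assms(1,3) set_sorted_list_of_set[of A] by (simp add: adapted_def)
  have "set_integrable lborel {0..<1} (\<lambda>u. a * q0 u + b * q1 u) \<and>
    (LINT u:{0..<1}|lborel. \<bar>a * q0 u + b * q1 u\<bar>) = weighted_norm (\<lambda>u. a * q0 u + b * q1 u) (0 # ms)"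
  proof (rule integral_eq_weighted_norm[OF assms(4)])
    show "c < 1" if "c \<in> set (0 # ms)" for c using that assms(5) by auto
    fix u c :: real assume u: "0 \<le> u" "u < 1" "c \<in> set (0 # ms)" "c \<le> u"
      "\<And>b. b \<in> set (0 # ms) \<Longrightarrow> b \<le> u \<Longrightarrow> b \<le> c"
    have "q0 u = q0 c" "q1 u = q1 c"
      using u unfolding setA by (intro adapted_cell[OF assms(1)] adapted_cell[OF assms(2)]; simp)+
    then show "a * q0 u + b * q1 u = a * q0 c + b * q1 c" by simp
  qed
  then show "set_integrable lborel {0..<1} (\<lambda>u. a * q0 u + b * q1 u)"
    "(LINT u:{0..<1}|lborel. \<bar>a * q0 u + b * q1 u\<bar>) = weighted_norm (\<lambda>u. a * q0 u + b * q1 u) (0 # ms)"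
    by auto
qed

lemma common_adapted:
  assumes "q0 \<in> step_paths" "q1 \<in> step_paths"
  obtains A where "adapted q0 A" "adapted q1 A"
proof -
  obtain A B where AB: "adapted q0 A" "adapted q1 B" using assms by (auto simp: step_paths_iff)
  have "adapted q0 (A \<union> B)" "adapted q1 (B \<union> A)"
    using adapted_Un[OF AB(1), of B] adapted_Un[OF AB(2), of A] adaptedD[OF AB(1)] adaptedD[OF AB(2)] by blast+
  then show ?thesis using that[of "A \<union> B"] by (simp add: Un_commute)
qed

lemma step_path_integrable: "q \<in> step_paths \<Longrightarrow> set_integrable lborel {0..<1} q"
proof -
  assume "q \<in> step_paths"
  then obtain A where A: "adapted q A" by (auto simp: step_paths_iff)
  obtain ms where ms: "sorted_list_of_set A = 0 # ms" "sorted_wrt (<) (0 # ms)" "\<And>m. m \<in> set ms \<Longrightarrow> m < 1"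
    using adapted_list[OF A] by blast
  show ?thesis using adapted_cell_function(1)[OF A A ms, of 1 0] by simp
qed

lemma adapted_mix:
  assumes "adapted q0 A" "adapted q1 A" "0 \<le> l" "l \<le> 1"
  shows "adapted (\<lambda>u. (1 - l) * q0 u + l * q1 u) A"
proof -
  note a = adaptedD[OF assms(1)] adaptedD[OF assms(2)]
  have "mono_on {0..<1} (\<lambda>u. (1 - l) * q0 u + l * q1 u)"
    using a assms(3,4) by (auto simp: mono_on_def intro!: add_mono mult_left_mono)
  moreover have cell: "(1 - l) * q0 u + l * q1 u = (1 - l) * q0 c + l * q1 c"
    if "u \<in> {0..<1}" "c \<in> A" "c \<le> u" "\<forall>b\<in>A. b \<le> u \<longrightarrow> b \<le> c" for u c
  proof -
    have "q0 u = q0 c" "q1 u = q1 c"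
      using that by (auto intro!: adapted_cell[OF assms(1)] adapted_cell[OF assms(2)])
    then show ?thesis by simp
  qed
  moreover have "0 \<le> (1 - l) * q0 0 + l * q1 0"
    using a assms(3,4) by simp
  ultimately show ?thesis
    unfolding adapted_def using a(1-3) by blast
qed

lemma step_paths_mix:
  assumes "q0 \<in> step_paths" "q1 \<in> step_paths" "0 \<le> l" "l \<le> 1"
  shows "(\<lambda>u. (1 - l) * q0 u + l * q1 u) \<in> step_paths"
  using common_adapted[OF assms(1,2)] adapted_mix[OF _ _ assms(3,4)] unfolding step_paths_iff by metis

lemma psi_step_convex:
  assumes "q0 \<in> step_paths" "q1 \<in> step_paths" and l: "0 \<le> l" "l \<le> 1"
  shows "psi_step (\<lambda>u. (1 - l) * q0 u + l * q1 u) \<le> (1 - l) * psi_step q0 + l * psi_step q1"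
proof -
  obtain A where A: "adapted q0 A" "adapted q1 A" using common_adapted[OF assms(1,2)] .
  obtain ms where ms: "sorted_list_of_set A = 0 # ms" "sorted_wrt (<) (0 # ms)" "\<And>m. m \<in> set ms \<Longrightarrow> m < 1"
    using adapted_list[OF A(1)] by blast
  have q: "0 \<le> q0 0" "mono_on {0..<1} q0" "0 \<le> q1 0" "mono_on {0..<1} q1"
    using adaptedD(4,5)[OF A(1)] adaptedD(4,5)[OF A(2)] by blast+
  have lv: "last_value (\<lambda>u. (1 - l) * q0 u + l * q1 u) ((1 - l) * a + l * b) xs
      = (1 - l) * last_value q0 a xs + l * last_value q1 b xs" for a b xs
    by (induction xs arbitrary: a b) simp_all
  show ?thesis
    unfolding psi_step_eq[OF A(1)] psi_step_eq[OF A(2)] psi_step_eq[OF adapted_mix[OF A l]]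
      parisi_value_def ms(1)
    using parisi_list_concave(1)[OF ms(2,3) q l] lv[of 0 0 "0 # ms"] by (simp add: algebra_simps)
qed

lemma psi_step_lipschitz:
  assumes "q0 \<in> step_paths" "q1 \<in> step_paths"
  shows "\<bar>psi_step q1 - psi_step q0\<bar> \<le> L1_dist q1 q0"
proof -
  obtain A where A: "adapted q0 A" "adapted q1 A" using common_adapted[OF assms(1,2)] .
  obtain ms where ms: "sorted_list_of_set A = 0 # ms" "sorted_wrt (<) (0 # ms)" "\<And>m. m \<in> set ms \<Longrightarrow> m < 1"
    using adapted_list[OF A(1)] by blast
  have q: "0 \<le> q0 0" "mono_on {0..<1} q0" "0 \<le> q1 0" "mono_on {0..<1} q1"
    using adaptedD(4,5)[OF A(1)] adaptedD(4,5)[OF A(2)] by blast+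
  have "L1_dist q1 q0 = weighted_norm (\<lambda>m. q1 m - q0 m) (0 # ms)"
    using adapted_cell_function(2)[OF A(2,1) ms, of 1 "-1"] by (simp add: L1_dist_def)
  moreover have "\<bar>(parisi_list q1 0 (0 # ms) 0 - last_value q1 0 (0 # ms)) - (parisi_list q0 0 (0 # ms) 0 - last_value q0 0 (0 # ms))\<bar>
      \<le> weighted_norm (\<lambda>m. q1 m - q0 m) (0 # ms)"
    by (rule parisi_list_concave(2)[OF ms(2,3) q])
  ultimately show ?thesis
    unfolding psi_step_eq[OF A(1)] psi_step_eq[OF A(2)] parisi_value_def ms(1) by linarith
qed

lemma L1_dist_triangle:
  assumes "set_integrable lborel {0..<1} p" "set_integrable lborel {0..<1} q" "set_integrable lborel {0..<1} r"
  shows "L1_dist p r \<le> L1_dist p q + L1_dist q r"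
proof -
  have i: "set_integrable lborel {0..<1} (\<lambda>u. \<bar>f u - g u\<bar>)"
    if "set_integrable lborel {0..<1} f" "set_integrable lborel {0..<1} g" for f g :: "real \<Rightarrow> real"
    by (intro set_integrable_abs set_integral_diff(1) that)
  have "L1_dist p r \<le> (LINT u:{0..<1}|lborel. \<bar>p u - q u\<bar> + \<bar>q u - r u\<bar>)"
    unfolding L1_dist_def
    by (intro set_integral_mono set_integral_add(1) i assms) auto
  also have "\<dots> = L1_dist p q + L1_dist q r"
    unfolding L1_dist_def by (intro set_integral_add(2) i assms)
  finally show ?thesis .
qed

lemma L1_dist_commute: "L1_dist p q = L1_dist q p"
  unfolding L1_dist_def by (simp add: abs_minus_commute)

lemma L1_dist_nonneg: "0 \<le> L1_dist p q"
  unfolding L1_dist_def set_lebesgue_integral_def by (intro Bochner_Integration.integral_nonneg) simp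

lemma L1_dist_mix:
  assumes i: "set_integrable lborel {0..<1} p0" "set_integrable lborel {0..<1} q0"
      "set_integrable lborel {0..<1} p1" "set_integrable lborel {0..<1} q1"
    and l: "0 \<le> l" "l \<le> 1"
  shows "L1_dist (\<lambda>u. (1 - l) * p0 u + l * p1 u) (\<lambda>u. (1 - l) * q0 u + l * q1 u)
    \<le> (1 - l) * L1_dist p0 q0 + l * L1_dist p1 q1"
proof -
  have j: "set_integrable lborel {0..<1} (\<lambda>u. c * \<bar>f u - g u\<bar>)"
    if "set_integrable lborel {0..<1} f" "set_integrable lborel {0..<1} g" for c and f g :: "real \<Rightarrow> real"
    using that by (intro set_integrable_mult_right set_integrable_abs set_integral_diff(1)) auto
  have "L1_dist (\<lambda>u. (1 - l) * p0 u + l * p1 u) (\<lambda>u. (1 - l) * q0 u + l * q1 u)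
      \<le> (LINT u:{0..<1}|lborel. (1 - l) * \<bar>p0 u - q0 u\<bar> + l * \<bar>p1 u - q1 u\<bar>)"
    unfolding L1_dist_def
  proof (rule set_integral_mono)
    show "set_integrable lborel {0..<1} (\<lambda>u. \<bar>((1 - l) * p0 u + l * p1 u) - ((1 - l) * q0 u + l * q1 u)\<bar>)"
      using i by (intro set_integrable_abs set_integral_diff(1) set_integral_add(1) set_integrable_mult_right) auto
    show "\<bar>((1 - l) * p0 u + l * p1 u) - ((1 - l) * q0 u + l * q1 u)\<bar> \<le> (1 - l) * \<bar>p0 u - q0 u\<bar> + l * \<bar>p1 u - q1 u\<bar>" for u
    proof -
      have "((1 - l) * p0 u + l * p1 u) - ((1 - l) * q0 u + l * q1 u) = (1 - l) * (p0 u - q0 u) + l * (p1 u - q1 u)"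
        by (simp add: algebra_simps)
      then show ?thesis using abs_triangle_ineq[of "(1 - l) * (p0 u - q0 u)" "l * (p1 u - q1 u)"] l
        by (simp add: abs_mult)
    qed
  qed (intro set_integral_add(1) j i)
  also have "\<dots> = (1 - l) * L1_dist p0 q0 + l * L1_dist p1 q1"
    unfolding L1_dist_def
    using set_integral_add(2)[OF j[OF i(1,2), of "1 - l"] j[OF i(3,4), of l]] by simp
  finally show ?thesis .
qed

text \<open>Sample \<open>q\<close> at the left end of each cell of a uniform grid. The samples stay below \<open>q\<close>, which dominates
  the error, and they converge at every point of continuity of \<open>q\<close>; a monotone function has only
  countably many other points.\<close>
lemma step_paths_dense:
  assumes q: "q \<in> L1_paths"
  shows "\<exists>p. (\<forall>n. p n \<in> step_paths) \<and> (\<lambda>n. L1_dist (p n) q) \<longlonglongrightarrow> 0"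
proof -
  have q0: "\<And>u. 0 \<le> u \<Longrightarrow> u < 1 \<Longrightarrow> 0 \<le> q u" and qm: "mono_on {0..<1} q" and qi: "set_integrable lborel {0..<1} q"
    using q by (auto simp: L1_paths_def paths_def)
  define g where "g n u = of_int \<lfloor>real (Suc n) * u\<rfloor> / real (Suc n)" for n u
  define p where "p n u = q (g n u)" for n u
  have g_le: "g n u \<le> u" for n u
    unfolding g_def by (simp add: divide_le_eq mult.commute)
  have g_ge: "u - 1 / real (Suc n) \<le> g n u" for n u
  proof -
    have "real (Suc n) * u - 1 \<le> of_int \<lfloor>real (Suc n) * u\<rfloor>" by linarith
    then have "(real (Suc n) * u - 1) / real (Suc n) \<le> g n u"
      unfolding g_def by (intro divide_right_mono) auto
    then show ?thesis by (simp add: diff_divide_distrib)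
  qed
  have g_nn: "0 \<le> g n u" if "0 \<le> u" for n u unfolding g_def using that by simp
  have g_mono: "g n u \<le> g n v" if "u \<le> v" for n u v
    unfolding g_def using that by (intro divide_right_mono) (auto intro!: floor_mono mult_left_mono)
  have p_step: "p n \<in> step_paths" for n
  proof -
    let ?N = "real (Suc n)"
    define A where "A = (\<lambda>i. real i / ?N) ` {..n}"
    have "adapted (p n) A" unfolding adapted_def
    proof (intro conjI ballI impI)
      show "finite A" by (simp add: A_def)
      show "0 \<in> A" unfolding A_def by force
      show "A \<subseteq> {0..<1}" by (auto simp: A_def divide_less_eq)
      show "0 \<le> p n 0" using q0[of 0] by (simp add: p_def g_def)
      show "mono_on {0..<1} (p n)"
      proof (rule mono_onI)
        fix r s :: real assume "r \<in> {0..<1}" "s \<in> {0..<1}" "r \<le> s"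
        then show "p n r \<le> p n s" unfolding p_def
          by (intro mono_onD[OF qm] g_mono) (auto intro: g_nn le_less_trans[OF g_le])
      qed
      fix u a assume u: "u \<in> {0..<1}" and a: "a \<in> A" "a \<le> u" and mx: "\<forall>b\<in>A. b \<le> u \<longrightarrow> b \<le> a"
      obtain i where i: "i \<le> n" "a = real i / ?N" using a by (auto simp: A_def)
      have "\<lfloor>?N * u\<rfloor> = int i"
      proof (rule floor_unique)
        show "of_int (int i) \<le> ?N * u" using a i by (simp add: divide_le_eq mult.commute)
        show "?N * u < of_int (int i) + 1"
        proof (rule ccontr)
          assume "\<not> ?N * u < of_int (int i) + 1"
          then have h: "real (Suc i) \<le> ?N * u" by simp
          also have "\<dots> < ?N * 1" using u by (intro mult_strict_left_mono) auto
          finally have "Suc i \<le> n" by simp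
          moreover have "real (Suc i) / ?N \<le> u" using h by (simp add: divide_le_eq mult.commute)
          ultimately have "real (Suc i) / ?N \<le> real i / ?N" using mx i by (force simp: A_def)
          then show False by (simp add: divide_le_cancel)
        qed
      qed
      moreover have "\<lfloor>?N * a\<rfloor> = int i" using i by simp
      ultimately show "p n u = p n a" unfolding p_def g_def by simp
    qed
    then show ?thesis by (auto simp: step_paths_iff)
  qed
  have "(\<lambda>n. \<integral>u. indicator {0..<1} u *\<^sub>R \<bar>p n u - q u\<bar> \<partial>lborel) \<longlonglongrightarrow> (\<integral>u. 0 \<partial>(lborel :: real measure))"
  proof (rule integral_dominated_convergence)
    show "integrable lborel (\<lambda>u. indicator {0..<1} u *\<^sub>R q u)"
      using qi by (simp add: set_integrable_def)
    show "(\<lambda>u. indicator {0..<1} u *\<^sub>R \<bar>p n u - q u\<bar>) \<in> borel_measurable lborel" for n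
    proof -
      have "set_integrable lborel {0..<1} (\<lambda>u. \<bar>p n u - q u\<bar>)"
        by (intro set_integrable_abs set_integral_diff(1) step_path_integrable p_step qi)
      then show ?thesis by (simp add: set_integrable_def)
    qed
    show "AE u in lborel. norm (indicator {0..<1} u *\<^sub>R \<bar>p n u - q u\<bar>) \<le> indicator {0..<1} u *\<^sub>R q u" for n
    proof (rule AE_I2)
      fix u :: real
      have "\<bar>p n u - q u\<bar> \<le> q u" if "u \<in> {0..<1}"
      proof -
        have gu: "g n u \<in> {0..<1}" using that g_nn[of u n] le_less_trans[OF g_le[of n u]] by auto
        have "p n u \<le> q u" unfolding p_def by (rule mono_onD[OF qm gu that g_le])
        moreover have "0 \<le> p n u" unfolding p_def using q0 gu by auto
        ultimately show ?thesis by simp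
      qed
      then show "norm (indicator {0..<1} u *\<^sub>R \<bar>p n u - q u\<bar>) \<le> indicator {0..<1} u *\<^sub>R q u"
        by (auto simp: indicator_def)
    qed
    have "mono_on {0<..<1} q" using qm by (rule mono_on_subset) auto
    then have "countable {u \<in> {0<..<1}. \<not> isCont q u}"
      by (rule mono_on_ctble_discont_open[rotated]) auto
    then have "countable (insert 0 {u \<in> {0<..<1}. \<not> isCont q u})" by simp
    then have "AE u in lborel. u \<notin> insert 0 {u \<in> {0<..<1}. \<not> isCont q u}"
      by (intro AE_not_in countable_imp_null_set_lborel)
    then show "AE u in lborel. (\<lambda>n. indicator {0..<1} u *\<^sub>R \<bar>p n u - q u\<bar>) \<longlonglongrightarrow> 0"
    proof eventually_elim
      case (elim u)
      show ?case
      proof (cases "u \<in> {0..<1}")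
        case True
        then have cont: "isCont q u" using elim by auto
        have lim: "(\<lambda>n. u - 1 / real (Suc n)) \<longlonglongrightarrow> u - 0"
          by (intro tendsto_diff tendsto_const LIMSEQ_Suc[OF lim_1_over_n])
        have "(\<lambda>n. g n u) \<longlonglongrightarrow> u"
          by (rule tendsto_sandwich[OF _ _ lim[simplified] tendsto_const]) (use g_ge g_le in auto)
        then have "(\<lambda>n. p n u) \<longlonglongrightarrow> q u"
          unfolding p_def by (rule isCont_tendsto_compose[OF cont])
        then have "(\<lambda>n. p n u - q u) \<longlonglongrightarrow> 0" by (rule Lim_null[THEN iffD1])
        then show ?thesis using True by (simp add: tendsto_rabs_zero)
      qed simp
    qed
  qed simp
  then have "(\<lambda>n. L1_dist (p n) q) \<longlonglongrightarrow> 0" by (simp add: L1_dist_def set_lebesgue_integral_def)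
  with p_step show ?thesis by blast
qed

text \<open>By the Lipschitz bound the values along one approximating sequence form a Cauchy sequence, and
  the value at any step path differs from their limit by at most its distance to \<open>q\<close>. Density makes the
  filter in the definition proper, so that \<open>Lim\<close> picks out this limit.\<close>
lemma psi_circ_limit:
  assumes q: "set_integrable lborel {0..<1} q"
    and p: "\<And>n. p n \<in> step_paths" and lim: "(\<lambda>n. L1_dist (p n) q) \<longlonglongrightarrow> 0"
  shows "(\<lambda>n. psi_step (p n)) \<longlonglongrightarrow> psi_circ q"
proof -
  let ?F = "inf (filtercomap (\<lambda>p. L1_dist p q) (nhds 0)) (principal step_paths)"
  have ev: "eventually P ?F \<longleftrightarrow> (\<exists>e>0. \<forall>p\<in>step_paths. L1_dist p q < e \<longrightarrow> P p)" for P
  proof -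
    have "eventually P ?F \<longleftrightarrow> (\<exists>e>0. \<forall>p. dist (L1_dist p q) 0 < e \<longrightarrow> p \<in> step_paths \<longrightarrow> P p)"
      unfolding eventually_inf_principal eventually_filtercomap eventually_nhds_metric
    proof
      assume "\<exists>e>0. \<forall>p. dist (L1_dist p q) 0 < e \<longrightarrow> p \<in> step_paths \<longrightarrow> P p"
      then obtain e where "0 < e" "\<forall>p. dist (L1_dist p q) 0 < e \<longrightarrow> p \<in> step_paths \<longrightarrow> P p" by blast
      then show "\<exists>Q. (\<exists>d>0. \<forall>y. dist y 0 < d \<longrightarrow> Q y) \<and> (\<forall>p. Q (L1_dist p q) \<longrightarrow> p \<in> step_paths \<longrightarrow> P p)"
        by (intro exI[of _ "\<lambda>y. dist y 0 < e"]) blast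
    qed blast
    then show ?thesis by (auto simp: dist_real_def abs_of_nonneg[OF L1_dist_nonneg])
  qed
  have lip: "\<bar>psi_step a - psi_step b\<bar> \<le> L1_dist a q + L1_dist b q" if "a \<in> step_paths" "b \<in> step_paths" for a b
    using psi_step_lipschitz[OF that(2,1)]
      L1_dist_triangle[OF step_path_integrable[OF that(1)] q step_path_integrable[OF that(2)]]
    by (simp add: L1_dist_commute[of q b])
  have "Cauchy (\<lambda>n. psi_step (p n))"
  proof (rule CauchyI)
    fix e :: real assume "0 < e"
    then have "eventually (\<lambda>n. L1_dist (p n) q < e / 2) sequentially"
      using lim by (intro order_tendstoD) auto
    then obtain N where N: "\<And>n. N \<le> n \<Longrightarrow> L1_dist (p n) q < e / 2"
      by (auto simp: eventually_sequentially)
    show "\<exists>M. \<forall>m\<ge>M. \<forall>n\<ge>M. norm (psi_step (p m) - psi_step (p n)) < e"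
    proof (intro exI allI impI)
      fix m n assume "N \<le> m" "N \<le> n"
      then show "norm (psi_step (p m) - psi_step (p n)) < e"
        using lip[OF p p, of m n] N[of m] N[of n] by simp
    qed
  qed
  then obtain L where L: "(\<lambda>n. psi_step (p n)) \<longlonglongrightarrow> L"
    using Cauchy_convergent convergent_def by blast
  have near: "\<bar>psi_step a - L\<bar> \<le> L1_dist a q" if a: "a \<in> step_paths" for a
  proof (rule LIMSEQ_le)
    show "(\<lambda>n. \<bar>psi_step a - psi_step (p n)\<bar>) \<longlonglongrightarrow> \<bar>psi_step a - L\<bar>"
      by (intro tendsto_intros L)
    have "(\<lambda>n. L1_dist a q + L1_dist (p n) q) \<longlonglongrightarrow> L1_dist a q + 0"
      by (intro tendsto_intros lim)
    then show "(\<lambda>n. L1_dist a q + L1_dist (p n) q) \<longlonglongrightarrow> L1_dist a q" by simp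
    show "\<exists>N. \<forall>n\<ge>N. \<bar>psi_step a - psi_step (p n)\<bar> \<le> L1_dist a q + L1_dist (p n) q"
      using lip[OF a p] by blast
  qed
  have "(psi_step \<longlongrightarrow> L) ?F"
  proof (rule tendstoI)
    fix e :: real assume "0 < e"
    then show "eventually (\<lambda>a. dist (psi_step a) L < e) ?F"
      unfolding ev dist_real_def using near by (intro exI[of _ e]) (auto intro: le_less_trans)
  qed
  moreover have "?F \<noteq> bot"
  proof
    assume "?F = bot"
    then have "eventually (\<lambda>_. False) ?F" by simp
    then obtain e where e: "0 < e" "\<And>a. a \<in> step_paths \<Longrightarrow> \<not> L1_dist a q < e"
      unfolding ev by blast
    have "eventually (\<lambda>n. L1_dist (p n) q < e) sequentially"
      using lim e(1) by (rule order_tendstoD)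
    then show False using e(2)[OF p] by (auto simp: eventually_sequentially)
  qed
  ultimately have "psi_circ q = L" unfolding psi_circ_def by (intro tendsto_Lim)
  then show ?thesis using L by simp
qed

lemma psi_circ_convex:
  assumes "q0 \<in> L1_paths" "q1 \<in> L1_paths" and l: "0 \<le> l" "l \<le> 1"
  shows "psi_circ (\<lambda>u. (1 - l) * q0 u + l * q1 u) \<le> (1 - l) * psi_circ q0 + l * psi_circ q1"
proof -
  have i: "set_integrable lborel {0..<1} q0" "set_integrable lborel {0..<1} q1"
    using assms by (auto simp: L1_paths_def)
  obtain p0 where p0: "\<And>n. p0 n \<in> step_paths" "(\<lambda>n. L1_dist (p0 n) q0) \<longlonglongrightarrow> 0"
    using step_paths_dense[OF assms(1)] by blast
  obtain p1 where p1: "\<And>n. p1 n \<in> step_paths" "(\<lambda>n. L1_dist (p1 n) q1) \<longlonglongrightarrow> 0"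
    using step_paths_dense[OF assms(2)] by blast
  let ?p = "\<lambda>n u. (1 - l) * p0 n u + l * p1 n u" and ?q = "\<lambda>u. (1 - l) * q0 u + l * q1 u"
  have "(\<lambda>n. (1 - l) * L1_dist (p0 n) q0 + l * L1_dist (p1 n) q1) \<longlonglongrightarrow> (1 - l) * 0 + l * 0"
    by (intro tendsto_intros p0 p1)
  then have up: "(\<lambda>n. (1 - l) * L1_dist (p0 n) q0 + l * L1_dist (p1 n) q1) \<longlonglongrightarrow> 0" by simp
  have "(\<lambda>n. L1_dist (?p n) ?q) \<longlonglongrightarrow> 0"
  proof (rule tendsto_sandwich[OF _ _ tendsto_const up])
    show "eventually (\<lambda>n. 0 \<le> L1_dist (?p n) ?q) sequentially" by (simp add: L1_dist_nonneg)
    show "eventually (\<lambda>n. L1_dist (?p n) ?q \<le> (1 - l) * L1_dist (p0 n) q0 + l * L1_dist (p1 n) q1) sequentially"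
      by (intro always_eventually allI L1_dist_mix step_path_integrable p0 p1 i l)
  qed
  moreover have "set_integrable lborel {0..<1} ?q"
    using i by (intro set_integral_add(1) set_integrable_mult_right) auto
  ultimately have "(\<lambda>n. psi_step (?p n)) \<longlonglongrightarrow> psi_circ ?q"
    by (intro psi_circ_limit step_paths_mix p0 p1 l)
  moreover have "(\<lambda>n. (1 - l) * psi_step (p0 n) + l * psi_step (p1 n)) \<longlonglongrightarrow> (1 - l) * psi_circ q0 + l * psi_circ q1"
    by (intro tendsto_intros psi_circ_limit p0 p1 i)
  ultimately show ?thesis
    by (rule LIMSEQ_le) (use psi_step_convex[OF p0(1) p1(1) l] in blast)
qed

theorem corollary2p3:
  fixes S :: "'s set" and lam_inf :: "'s \<Rightarrow> real"
    and q0 q1 :: "'s \<Rightarrow> real \<Rightarrow> real" and lam :: real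
  assumes "finite S"
    and "\<forall>s\<in>S. lam_inf s \<in> {0<..<1}"
    and "(\<Sum>s\<in>S. lam_inf s) = 1"
    and "\<forall>s\<in>S. q0 s \<in> L1_paths"
    and "\<forall>s\<in>S. q1 s \<in> L1_paths"
    and "lam \<in> {0..1}"
  shows "psi S lam_inf (\<lambda>s u. (1 - lam) * q0 s u + lam * q1 s u)
           \<le> (1 - lam) * psi S lam_inf q0 + lam * psi S lam_inf q1"
proof -
  have "psi S lam_inf (\<lambda>s u. (1 - lam) * q0 s u + lam * q1 s u)
      \<le> (\<Sum>s\<in>S. lam_inf s * ((1 - lam) * psi_circ (q0 s) + lam * psi_circ (q1 s)))"
    unfolding psi_def using assms by (intro sum_mono mult_left_mono psi_circ_convex) auto
  also have "\<dots> = (1 - lam) * psi S lam_inf q0 + lam * psi S lam_inf q1"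
    unfolding psi_def sum_distrib_left by (simp add: algebra_simps flip: sum.distrib)
  finally show ?thesis .
qed

end
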